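(* Let $\lambda$ be a partition and let $M,M'\in\mathrm{MLQ}_\lambda$ lie in the same connected component of the crystal graph on $\mathrm{MLQ}_\lambda$ (equivalently, $\rho_Q(M)=\rho_Q(M')$). Then \[ \mathrm{type}(\rho_N(M))=\mathrm{type}(\rho_N(M'))\implies \mathrm{type}(M)=\mathrm{type}(M'). \]
   Context: Fix $n$. For a partition $\lambda$ with $L=\lambda_1$, $n>\ell(\lambda)$, a multiline queue (MLQ) of shape $\lambda$ is a tuple $M=(B_1,\dots,B_L)$ of subsets of $[n]$ with $|B_r|=\lambda'_r$ ($\lambda'$ the conjugate partition), pictured as an $L\times n$ array with rows $1..L$ bottom to top and columns $1..n$ left to right, cyclically; a ball at $(r,j)$ iff $j\in B_r$. $\mathrm{MLQ}_\lambda$ is the set of these. FM labelling: for $r=L,\dots,2$: unlabelled balls of row $r$ get label $r$; then balls of row $r$ in order of decreasing label (left to right among equal labels) are each paired with the first not-yet-paired ball of row $r-1$ weakly to its right (cyclically wrapping from column $n$ to column 1), which gets the same label. Remaining unlabelled balls of row 1 get label 1. $\mathrm{type}(M)$ is the length-$n$ sequence of labels in row 1 (0 at empty sites). Bracketing: for a word $w$ and $i\ge1$, replace each $i$ by ")" and each $i+1$ by "(" (ignore other letters) and iteratively match a "(" with a ")" to its right when no unmatched parenthesis lies between them; other $i$'s, $(i+1)$'s are unmatched. Column operators: the row word $rw(M)$ lists column indices of balls reading rows top to bottom, each row right to left. For $1\le i<n$, $e^{\leftarrow}_i(M)$ moves the ball corresponding to the leftmost unmatched $i+1$ of $rw(M)$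 from column $i+1$ to column $i$ (same row), and $f^{\rightarrow}_i(M)$ moves the ball of the rightmost unmatched $i$ from column $i$ to column $i+1$; identity if none exists. The crystal graph has vertex set $\mathrm{MLQ}_\lambda$ and an edge $M\to f^{\rightarrow}_i(M)$ for each $i$; connected components are taken ignoring edge directions. Collapsing: for a tuple $N$ of subsets of $[n]$, $cw(N)$ lists row indices of balls, columns left to right, each column top to bottom. $e^{\downarrow}_j(N)$ moves the ball of the leftmost unmatched $j+1$ in $cw(N)$ (bracketing w.r.t. $j$) from row $j+1$ to row $j$ in the same column (identity if none); $e^{\downarrow\star}_j$ iterates $e^{\downarrow}_j$ until it acts trivially. For $M=(B_1,\dots,B_L)$: $M_1=M$, $Q_1$ one row of $|B_1|$ boxes filled with 1; for $i=1,\dots,L-1$, $M_{i+1}=e^{\downarrow\star}_1\cdots e^{\downarrow\star}_i(M_i)$ (rightmost first) and $Q_{i+1}$ is $Q_i$ with $|B^{(i+1)}_j|-|B^{(i)}_j|$ boxes added to row $j$ ($j\le i$) and $|B^{(i+1)}_{i+1}|$ boxes forming row $i+1$, all filled with $i+1$, where $M_i=(B^{(i)}_1,\dots,B^{(i)}_L)$. $\rho_N(M)=M_L$ (a nonwrapping MLQ) and $\rho_Q(M)=Q_L$ (a semistandard tableau, French convention). *)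

theory Defs
  imports "HOL-Library.While_Combinator"
begin

definition is_partition :: "nat list \<Rightarrow> bool" where
  "is_partition lam \<longleftrightarrow> sorted_wrt (\<ge>) lam \<and> (\<forall>x \<in> set lam. 0 < x)"

definition largest_part :: "nat list \<Rightarrow> nat" where
  "largest_part lam = (case lam of [] \<Rightarrow> 0 | x # _ \<Rightarrow> x)"

definition conj_part :: "nat list \<Rightarrow> nat \<Rightarrow> nat" where
  "conj_part lam r = card {i. i < length lam \<and> r \<le> lam ! i}"

text \<open>Rows and columns are numbered from 1. A tuple \<open>(B\<^sub>1, \<dots>, B\<^sub>L)\<close> is the list
  \<open>[B\<^sub>1, \<dots>, B\<^sub>L]\<close>, and likewise a tableau in French convention is the list of its rows
  from bottom to top.\<close>

type_synonym queue = "nat set list"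

definition row :: "'a list \<Rightarrow> nat \<Rightarrow> 'a" where
  "row X r = X ! (r - 1)"

definition MLQ :: "nat \<Rightarrow> nat list \<Rightarrow> queue set" where
  "MLQ n lam = {M. length M = largest_part lam \<and>
     (\<forall>r \<in> {1..largest_part lam}. row M r \<subseteq> {1..n} \<and> card (row M r) = conj_part lam r)}"

text \<open>The first element of \<open>S\<close> weakly to the right of \<open>j\<close>, wrapping around cyclically.\<close>

definition first_right :: "nat set \<Rightarrow> nat \<Rightarrow> nat" where
  "first_right S j = (if \<exists>k \<in> S. j \<le> k then Min {k \<in> S. j \<le> k} else Min S)"

text \<open>\<open>pair_balls lab js S acc\<close> lets the balls of the upper row in columns \<open>js\<close>, in this order,
  pair with the balls \<open>S\<close> of the lower row which are not paired yet; \<open>lab\<close> is the labelling of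
  the upper row and \<open>acc\<close> is the labelling of the lower row obtained so far. The case
  \<open>S = {}\<close> does not occur when the lower row has at least as many balls as the upper one.\<close>

fun pair_balls :: "(nat \<Rightarrow> nat) \<Rightarrow> nat list \<Rightarrow> nat set \<Rightarrow> (nat \<Rightarrow> nat) \<Rightarrow> (nat \<Rightarrow> nat)" where
  "pair_balls lab [] S acc = acc"
| "pair_balls lab (j # js) S acc =
     (if S = {} then acc
      else let k = first_right S j in pair_balls lab js (S - {k}) (acc(k := lab j)))"

text \<open>Decreasing label, left to right among equal labels (\<open>sort_key\<close> is stable).\<close>

definition pairing_order :: "(nat \<Rightarrow> nat) \<Rightarrow> nat set \<Rightarrow> nat list" where
  "pairing_order lab B = sort_key (\<lambda>j. - int (lab j)) (sorted_list_of_set B)"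

text \<open>\<open>fm_labels r [B\<^sub>r, B\<^sub>r\<^sub>+\<^sub>1, \<dots>, B\<^sub>L]\<close> is the labelling of row \<open>r\<close>, with value 0 at
  empty sites: the balls not labelled by a ball of row \<open>r + 1\<close> keep the initial label \<open>r\<close>.\<close>

fun fm_labels :: "nat \<Rightarrow> queue \<Rightarrow> (nat \<Rightarrow> nat)" where
  "fm_labels r [] = (\<lambda>_. 0)"
| "fm_labels r [B] = (\<lambda>j. if j \<in> B then r else 0)"
| "fm_labels r (B # C # Bs) =
     (let lab = fm_labels (Suc r) (C # Bs)
      in pair_balls lab (pairing_order lab C) B (\<lambda>j. if j \<in> B then r else 0))"

definition mlq_type :: "nat \<Rightarrow> queue \<Rightarrow> nat list" where
  "mlq_type n M = map (fm_labels 1 M) [1..<Suc n]"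

text \<open>\<open>matched i w p q\<close>: position \<open>p\<close> carries an opening bracket \<open>i + 1\<close> and is matched with
  the closing bracket \<open>i\<close> at position \<open>q\<close> to its right. Positions are numbered from 0. At the
  moment when \<open>p\<close> and \<open>q\<close> are matched, each bracket strictly between them is already matched,
  and \<open>p\<close>, \<open>q\<close> are not; hence the partners of the brackets in between lie in between, too.\<close>

inductive matched :: "nat \<Rightarrow> nat list \<Rightarrow> nat \<Rightarrow> nat \<Rightarrow> bool" for i :: nat and w :: "nat list" where
  match: "\<lbrakk>p < q; q < length w; w ! p = Suc i; w ! q = i;
     \<And>k. \<lbrakk>p < k; k < q; w ! k = i \<or> w ! k = Suc i\<rbrakk>
        \<Longrightarrow> \<exists>l. p < l \<and> l < q \<and> (matched i w k l \<or> matched i w l k)\<rbrakk>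
   \<Longrightarrow> matched i w p q"

definition unmatched_open :: "nat \<Rightarrow> nat list \<Rightarrow> nat set" where
  "unmatched_open i w = {p. p < length w \<and> w ! p = Suc i \<and> (\<nexists>q. matched i w p q)}"

definition unmatched_close :: "nat \<Rightarrow> nat list \<Rightarrow> nat set" where
  "unmatched_close i w = {q. q < length w \<and> w ! q = i \<and> (\<nexists>p. matched i w p q)}"

text \<open>Balls are given as (row, column).\<close>

definition move_ball :: "nat \<times> nat \<Rightarrow> nat \<times> nat \<Rightarrow> queue \<Rightarrow> queue" where
  "move_ball b b' M =
     (let M1 = M[fst b - 1 := row M (fst b) - {snd b}]
      in M1[fst b' - 1 := insert (snd b') (row M1 (fst b'))])"

definition rw_balls :: "nat \<Rightarrow> queue \<Rightarrow> (nat \<times> nat) list" where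
  "rw_balls n M = [(r, j). r \<leftarrow> rev [1..<Suc (length M)], j \<leftarrow> rev [1..<Suc n], j \<in> row M r]"

definition cw_balls :: "nat \<Rightarrow> queue \<Rightarrow> (nat \<times> nat) list" where
  "cw_balls n M = [(r, j). j \<leftarrow> [1..<Suc n], r \<leftarrow> rev [1..<Suc (length M)], j \<in> row M r]"

definition rw :: "nat \<Rightarrow> queue \<Rightarrow> nat list" where
  "rw n M = map snd (rw_balls n M)"

definition cw :: "nat \<Rightarrow> queue \<Rightarrow> nat list" where
  "cw n M = map fst (cw_balls n M)"

definition f_right :: "nat \<Rightarrow> nat \<Rightarrow> queue \<Rightarrow> queue" where
  "f_right n i M =
     (let U = unmatched_close i (rw n M)
      in if U = {} then M
         else let r = fst (rw_balls n M ! Max U) in move_ball (r, i) (r, Suc i) M)"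

definition e_down :: "nat \<Rightarrow> nat \<Rightarrow> queue \<Rightarrow> queue" where
  "e_down n j N =
     (let U = unmatched_open j (cw n N)
      in if U = {} then N
         else let c = snd (cw_balls n N ! Min U) in move_ball (Suc j, c) (j, c) N)"

definition e_down_star :: "nat \<Rightarrow> nat \<Rightarrow> queue \<Rightarrow> queue" where
  "e_down_star n j = while (\<lambda>N. e_down n j N \<noteq> N) (e_down n j)"

definition crystal_edge :: "nat \<Rightarrow> nat list \<Rightarrow> queue \<Rightarrow> queue \<Rightarrow> bool" where
  "crystal_edge n lam M M' \<longleftrightarrow> M \<in> MLQ n lam \<and> (\<exists>i. 1 \<le> i \<and> i < n \<and> M' = f_right n i M)"

definition same_component :: "nat \<Rightarrow> nat list \<Rightarrow> queue \<Rightarrow> queue \<Rightarrow> bool" where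
  "same_component n lam M M' \<longleftrightarrow>
     M \<in> MLQ n lam \<and> M' \<in> MLQ n lam \<and> equivclp (crystal_edge n lam) M M'"

text \<open>\<open>collapse n M i\<close> is \<open>M\<^sub>i\<close> for \<open>i \<ge> 1\<close>. The recursion starts at the dummy index 0, whose
  step applies no operator, so \<open>M\<^sub>1 = M\<close>. Similarly, \<open>rec_tab n M i\<close> is \<open>Q\<^sub>i\<close> for \<open>i \<ge> 1\<close>, where
  \<open>Q\<^sub>1\<close> arises from the empty tableau. Rows of \<open>Q\<^sub>i\<close> without boxes are kept as empty lists.
  The truncated subtraction is harmless: step \<open>i\<close> of the collapsing does not shrink rows \<open>1, \<dots>, i\<close>.\<close>

primrec collapse :: "nat \<Rightarrow> queue \<Rightarrow> nat \<Rightarrow> queue" where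
  "collapse n M 0 = M"
| "collapse n M (Suc i) = foldr (e_down_star n) [1..<Suc i] (collapse n M i)"

primrec rec_tab :: "nat \<Rightarrow> queue \<Rightarrow> nat \<Rightarrow> nat list list" where
  "rec_tab n M 0 = []"
| "rec_tab n M (Suc i) =
     map (\<lambda>j. row (rec_tab n M i) j @
              replicate (card (row (collapse n M (Suc i)) j) - card (row (collapse n M i) j)) (Suc i))
         [1..<Suc i]
     @ [replicate (card (row (collapse n M (Suc i)) (Suc i))) (Suc i)]"

definition rho_N :: "nat \<Rightarrow> queue \<Rightarrow> queue" where
  "rho_N n M = collapse n M (length M)"

definition rho_Q :: "nat \<Rightarrow> queue \<Rightarrow> nat list list" where
  "rho_Q n M = rec_tab n M (length M)"

end

theory Submission
  imports Defs
begin

text \<open>A queue is a finite set of cells, and the row operators \<open>e\<^sub>j\<close> commute with the column operators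
  \<open>f\<^sub>i\<close>. A configuration on which no row operator acts and which is extremal for all column
  operators has nested, justified rows and is thus determined by its column counts. Transporting
  along the column operators, any two sequences of row moves starting from the same configuration
  and ending in nonwrapping ones have the same end point. On a column-extremal queue the collapsing
  can be computed explicitly: it shows that \<open>\<rho>\<^sub>N\<close> is nonwrapping and that the shapes recorded by
  \<open>\<rho>\<^sub>Q\<close> determine the queue, whence the components are the fibres of \<open>\<rho>\<^sub>Q\<close>.

  For the types, the balls of row 1 with label at least \<open>k\<close> arise by cyclic pairing from row \<open>k\<close>
  downwards. One cyclic pairing step is a reflection in the crystal of the row operators, so that
  this set is the complete bottom row of a configuration \<open>Y\<close> connected to \<open>M\<close> by row operators,
  hence also to \<open>\<rho>\<^sub>N(M)\<close>. Raising the rows of \<open>Y\<close> to those of \<open>\<rho>\<^sub>N(M)\<close> one at a time, each row of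
  an intermediate configuration consists of the balls matched from above together with an initial
  part, of known size, of the remaining balls. This property survives the pairing with lower rows, so the
  bottom row of \<open>Y\<close> can be read off the label sets of \<open>\<rho>\<^sub>N(M)\<close> and sizes that are constant on the
  component.\<close>

subsection \<open>Heights and peaks\<close>

text \<open>The obstacle is that bracketing never wraps while the pairing of balls does. Moving the
  cyclically unpaired balls of a row upwards turns pairing into vertical moves read backwards. How
  many moves are needed depends only on the shape, so one word lifts all queues of a shape, and the
  lifts of connected queues are again connected. Column moves change positions, but row sizes and
  fixedness under row operators survive them because the two families commute. Statements of this
  second kind may therefore be checked at a convenient end of a component. Which end is convenient
  depends on what is known: left-justified representatives if the rows are in order from the bottom
  upwards, right-justified ones if they are in order from the top downwards. Both situations occur.
  Positions come back at one place only: an initial segment is determined by its size once the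
  surrounding set is known. It is essential that matching with a lower row turns a sandwich with an
  initial segment into another such sandwich.\<close>

text \<open>For an upper row \<open>A\<close> and a lower row \<open>B\<close>, \<open>hgt A B c\<close> is the excess of opening over closing
  brackets in the columns from \<open>c\<close> on. The leftmost unmatched opening bracket sits at the last
  maximum of this function.\<close>

definition hgt :: "nat set \<Rightarrow> nat set \<Rightarrow> nat \<Rightarrow> int" where
  "hgt A B c = int (card (A \<inter> {c..})) - int (card (B \<inter> {c..}))"

definition peak :: "nat set \<Rightarrow> nat set \<Rightarrow> nat \<Rightarrow> bool" where
  "peak A B c \<longleftrightarrow> (\<forall>x. hgt A B x \<le> hgt A B c) \<and> (\<forall>x>c. hgt A B x < hgt A B c)"

lemma card_Int_atLeast_insert:
  assumes "finite A" "c \<notin> A"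
  shows "card (insert c A \<inter> {x..}) = card (A \<inter> {x..}) + of_bool (x \<le> c)"
proof (cases "x \<le> c")
  case True
  then have "insert c A \<inter> {x..} = insert c (A \<inter> {x..})" by auto
  then show ?thesis using assms True by simp
next
  case False
  then have "insert c A \<inter> {x..} = A \<inter> {x..}" by auto
  then show ?thesis using False by simp
qed

lemma card_Int_atLeast_remove:
  assumes "finite A" "c \<in> A"
  shows "card (A \<inter> {x..}) = card ((A - {c}) \<inter> {x..}) + of_bool (x \<le> c)"
  using card_Int_atLeast_insert[of "A - {c}" c x] assms by (simp add: insert_absorb)

lemma hgt_insert1: "finite A \<Longrightarrow> c \<notin> A \<Longrightarrow> hgt (insert c A) B x = hgt A B x + of_bool (x \<le> c)"
  by (simp add: hgt_def card_Int_atLeast_insert)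

lemma hgt_insert2: "finite B \<Longrightarrow> c \<notin> B \<Longrightarrow> hgt A (insert c B) x = hgt A B x - of_bool (x \<le> c)"
  by (simp add: hgt_def card_Int_atLeast_insert)

lemma hgt_remove1: "finite A \<Longrightarrow> c \<in> A \<Longrightarrow> hgt (A - {c}) B x = hgt A B x - of_bool (x \<le> c)"
  by (simp add: hgt_def card_Int_atLeast_remove[of A c x])

lemma hgt_remove2: "finite B \<Longrightarrow> c \<in> B \<Longrightarrow> hgt A (B - {c}) x = hgt A B x + of_bool (x \<le> c)"
  by (simp add: hgt_def card_Int_atLeast_remove[of B c x])

lemma hgt_move:
  assumes "finite A" "finite B" "c \<in> A" "c \<notin> B"
  shows "hgt (A - {c}) (insert c B) x = hgt A B x - 2 * of_bool (x \<le> c)"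
  by (subst hgt_insert2) (use assms in \<open>auto simp: hgt_remove1\<close>)

lemma Int_atLeast_Suc: "A \<inter> {c..} = (if c \<in> A then insert c (A \<inter> {Suc c..}) else A \<inter> {Suc c..})"
  by (auto simp: Suc_le_eq order.order_iff_strict)

lemma hgt_Suc:
  assumes "finite A" "finite B"
  shows "hgt A B c = hgt A B (Suc c) + of_bool (c \<in> A) - of_bool (c \<in> B)"
proof -
  have "card (A \<inter> {c..}) = card (A \<inter> {Suc c..}) + of_bool (c \<in> A)" if "finite A" for A :: "nat set"
    using that by (subst Int_atLeast_Suc) auto
  then show ?thesis using assms by (simp add: hgt_def)
qed

lemma hgt_0: "hgt A B 0 = int (card A) - int (card B)"
  by (simp add: hgt_def)

lemma hgt_zero:
  assumes "finite A" "finite B"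
  obtains m where "\<And>x. m \<le> x \<Longrightarrow> hgt A B x = 0"
proof
  fix x assume "Suc (Max (insert 0 (A \<union> B))) \<le> x"
  then have *: "\<And>y. y \<in> A \<union> B \<Longrightarrow> y < x"
    using assms Max_ge[of "insert 0 (A \<union> B)"] by (metis Suc_le_lessD finite_Un finite_insert insertI2 le_less_trans)
  then have "A \<inter> {x..} = {}" "B \<inter> {x..} = {}" by force+
  then show "hgt A B x = 0" by (simp add: hgt_def)
qed

lemma hgt_subset_le: "finite B \<Longrightarrow> A \<subseteq> B \<Longrightarrow> hgt A B x \<le> 0"
  by (simp add: hgt_def) (meson Int_mono card_mono finite_Int order_refl)

lemma finite_range_hgt:
  assumes "finite A" "finite B"
  shows "finite (range (hgt A B))"
proof -
  obtain m where m: "\<And>x. m \<le> x \<Longrightarrow> hgt A B x = 0" using hgt_zero[OF assms] by blast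
  have "range (hgt A B) \<subseteq> insert 0 (hgt A B ` {..<m})"
  proof
    fix v assume "v \<in> range (hgt A B)"
    then obtain x where "v = hgt A B x" by blast
    then show "v \<in> insert 0 (hgt A B ` {..<m})" using m[of x] by (cases "m \<le> x") auto
  qed
  then show ?thesis using finite_subset by blast
qed

text \<open>The number of unmatched opening brackets, hence the number of times the operator can
  act: each move lowers the maximum by one, and it is 0 exactly when there is no peak.\<close>

definition mx :: "nat set \<Rightarrow> nat set \<Rightarrow> int" where
  "mx A B = Max (range (hgt A B))"

lemma mx_ge: "finite A \<Longrightarrow> finite B \<Longrightarrow> hgt A B x \<le> mx A B"
  by (simp add: mx_def finite_range_hgt)

lemma mx_attained: "finite A \<Longrightarrow> finite B \<Longrightarrow> \<exists>x. hgt A B x = mx A B"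
  unfolding mx_def using Max_in[OF finite_range_hgt[of A B]] by auto

lemma mx_eqI: "finite A \<Longrightarrow> finite B \<Longrightarrow> (\<And>x. hgt A B x \<le> v) \<Longrightarrow> hgt A B y = v \<Longrightarrow> mx A B = v"
  by (metis antisym mx_attained mx_ge)

lemma mx_nonneg: "finite A \<Longrightarrow> finite B \<Longrightarrow> 0 \<le> mx A B"
  by (metis hgt_zero mx_ge order_refl)

lemma peak_mx: "finite A \<Longrightarrow> finite B \<Longrightarrow> peak A B c \<Longrightarrow> mx A B = hgt A B c"
  by (rule mx_eqI) (auto simp: peak_def)

text \<open>Heights vanish far to the right, so a value strictly above everything to its right is
  positive.\<close>

lemma peak_pos: "finite A \<Longrightarrow> finite B \<Longrightarrow> peak A B c \<Longrightarrow> 0 < hgt A B c"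
  by (rule hgt_zero[of A B]) (auto simp: peak_def, metis less_Suc_eq_le linorder_not_le nat_le_linear)

lemma peak_unique: "peak A B c \<Longrightarrow> peak A B c' \<Longrightarrow> c = c'"
  unfolding peak_def by (metis linorder_neqE_nat linorder_not_less)

lemma peak_mem:
  assumes "finite A" "finite B" "peak A B c"
  shows "c \<in> A" "c \<notin> B" "hgt A B (Suc c) = hgt A B c - 1"
proof -
  have "hgt A B (Suc c) < hgt A B c" using assms(3) by (auto simp: peak_def)
  then show "c \<in> A" "c \<notin> B" "hgt A B (Suc c) = hgt A B c - 1"
    using hgt_Suc[OF assms(1,2), of c] by (auto simp: of_bool_def split: if_splits)
qed

lemma peak_exists:
  assumes "finite A" "finite B" "0 < hgt A B x"
  shows "\<exists>c. peak A B c"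
proof -
  obtain m where m: "\<And>x. m \<le> x \<Longrightarrow> hgt A B x = 0" using hgt_zero[OF assms(1,2)] by blast
  have pos: "0 < mx A B" using assms mx_ge[of A B x] by linarith
  let ?S = "{x. hgt A B x = mx A B}"
  have sub: "?S \<subseteq> {..<m}" 
  proof
    fix x assume "x \<in> ?S"
    then show "x \<in> {..<m}" using m[of x] pos by (cases "m \<le> x") auto
  qed
  have fin: "finite ?S" using sub finite_subset by blast
  have ne: "?S \<noteq> {}" using mx_attained[OF assms(1,2)] by auto
  have "peak A B (Max ?S)"
    unfolding peak_def
  proof (intro conjI allI impI)
    have M: "hgt A B (Max ?S) = mx A B" using Max_in[OF fin ne] by simp
    fix x
    show "hgt A B x \<le> hgt A B (Max ?S)" using M mx_ge[OF assms(1,2)] by simp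
    assume "Max ?S < x"
    then have "x \<notin> ?S" using Max_ge[OF fin] by (meson linorder_not_less)
    then show "hgt A B x < hgt A B (Max ?S)" using M mx_ge[OF assms(1,2), of x] by simp
  qed
  then show ?thesis by blast
qed

lemma no_peak_iff:
  assumes "finite A" "finite B"
  shows "(\<forall>c. \<not> peak A B c) \<longleftrightarrow> (\<forall>x. hgt A B x \<le> 0)"
  using peak_exists[OF assms] peak_pos[OF assms] by (meson linorder_not_less)

lemma mx_zero_iff:
  assumes "finite A" "finite B"
  shows "mx A B = 0 \<longleftrightarrow> (\<forall>x. hgt A B x \<le> 0)"
  using mx_ge[OF assms] mx_nonneg[OF assms] mx_attained[OF assms] by (metis antisym)

lemma mx_step:
  assumes "finite A" "finite B" "peak A B c"
  shows "mx (A - {c}) (insert c B) = mx A B - 1"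
proof (rule mx_eqI)
  show "finite (A - {c})" "finite (insert c B)" using assms by auto
  note m = peak_mem[OF assms]
  show "hgt (A - {c}) (insert c B) (Suc c) = mx A B - 1"
    using m assms by (simp add: hgt_move peak_mx)
  fix x
  have "hgt A B x \<le> hgt A B c" "x > c \<Longrightarrow> hgt A B x < hgt A B c"
    using assms(3) by (auto simp: peak_def)
  then show "hgt (A - {c}) (insert c B) x \<le> mx A B - 1"
    using m assms by (cases "x \<le> c") (auto simp: hgt_move peak_mx)
qed

text \<open>The inverse move. The hypothesis says that some closing bracket is unmatched; the ball
  to move back sits just left of the first maximum, and moving it back makes its column the last
  maximum.\<close>

lemma peak_inverse:
  assumes "finite A" "finite B" "hgt A B 0 < hgt A B x"
  obtains y where "y \<in> B" "y \<notin> A" "peak (insert y A) (B - {y}) y"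
proof -
  define v where "v = mx A B"
  define m where "m = (LEAST x. hgt A B x = v)"
  have "\<exists>x. hgt A B x = v" using mx_attained[OF assms(1,2)] v_def by simp
  then have m: "hgt A B m = v" unfolding m_def by (rule LeastI_ex)
  have m': "\<And>x. x < m \<Longrightarrow> hgt A B x < v"
  proof -
    fix x assume "x < m"
    then have "hgt A B x \<noteq> v" unfolding m_def by (rule not_less_Least)
    then show "hgt A B x < v" using mx_ge[OF assms(1,2), of x] v_def by simp
  qed
  have "m \<noteq> 0" using assms(3) m mx_ge[OF assms(1,2), of x] v_def by (metis not_le)
  then obtain y where y: "m = Suc y" using not0_implies_Suc by blast
  have "hgt A B y < hgt A B (Suc y)" using m m' y by auto
  then have yy: "y \<in> B" "y \<notin> A" "hgt A B y = v - 1"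
    using hgt_Suc[OF assms(1,2), of y] m y by (auto simp: of_bool_def split: if_splits)
  have h: "hgt (insert y A) (B - {y}) x = hgt A B x + 2 * of_bool (x \<le> y)" for x
    using yy assms by (simp add: hgt_insert1 hgt_remove2)
  have "peak (insert y A) (B - {y}) y"
    unfolding peak_def h
  proof (intro conjI allI impI)
    fix x
    have g: "hgt A B x \<le> v" using mx_ge[OF assms(1,2)] v_def by simp
    show "hgt A B x + 2 * of_bool (x \<le> y) \<le> hgt A B y + 2 * of_bool (y \<le> y)"
      using yy g m'[of x] y by (auto simp: of_bool_def)
    show "hgt A B x + 2 * of_bool (x \<le> y) < hgt A B y + 2 * of_bool (y \<le> y)" if "y < x"
      using yy g that by (auto simp: of_bool_def)
  qed
  then show ?thesis using that yy by blast
qed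

text \<open>A move at \<open>c\<close> makes \<open>Suc c\<close> the first maximum of the new
  height function, so \<open>c\<close> can be recovered from the two new rows alone.\<close>

lemma peak_step_inj:
  assumes "finite A" "finite B" "finite A'" "finite B'" "peak A B c" "peak A' B' c'"
    "A - {c} = A' - {c'}" "insert c B = insert c' B'"
  shows "c = c'"
proof -
  let ?g = "hgt (A - {c}) (insert c B)"
  have main: "hgt (A - {c}) (insert c B) x \<le> hgt (A - {c}) (insert c B) (Suc c) \<and>
      (x \<le> c \<longrightarrow> hgt (A - {c}) (insert c B) x < hgt (A - {c}) (insert c B) (Suc c))"
    if "finite A" "finite B" "peak A B c" for A B c x
  proof -
    note m = peak_mem[OF that]
    have "hgt A B x \<le> hgt A B c" "x > c \<Longrightarrow> hgt A B x < hgt A B c"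
      using that(3) by (auto simp: peak_def)
    then show ?thesis
      using hgt_move[OF that(1,2) m(1,2), of x] hgt_move[OF that(1,2) m(1,2), of "Suc c"] m(3)
      by (cases "x \<le> c") auto
  qed
  note 1 = main[OF assms(1,2,5)]
  have 2: "?g x \<le> ?g (Suc c') \<and> (x \<le> c' \<longrightarrow> ?g x < ?g (Suc c'))" for x
    using main[OF assms(3,4,6), of x] assms(7,8) by simp
  show ?thesis
  proof (rule linorder_cases[of c c'])
    assume "c < c'"
    then have "?g (Suc c) < ?g (Suc c')" using 2[of "Suc c"] by simp
    then show ?thesis using 1[of "Suc c'"] by simp
  next
    assume "c' < c"
    then have "?g (Suc c') < ?g (Suc c)" using 1[of "Suc c'"] by simp
    then show ?thesis using 2[of "Suc c"] by simp
  qed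
qed

section \<open>Moves of balls on finite sets of cells\<close>

type_synonym config = "(nat \<times> nat) set"

definition shift :: "nat \<Rightarrow> nat \<Rightarrow> config \<Rightarrow> config" where
  "shift a b X = (if \<exists>c. peak (X `` {a}) (X `` {b}) c
     then let c = (THE c. peak (X `` {a}) (X `` {b}) c) in insert (b, c) (X - {(a, c)}) else X)"

text \<open>Both operators move a ball at a peak: \<open>down j\<close> is \<open>e\<^sub>j\<close> acting on rows, and \<open>right i\<close> is
  \<open>f\<^sub>i\<close>, which becomes an operator of the same shape after exchanging rows and columns.\<close>

definition down :: "nat \<Rightarrow> config \<Rightarrow> config" where
  "down j = shift (Suc j) j"

definition right :: "nat \<Rightarrow> config \<Rightarrow> config" where
  "right i X = (shift i (Suc i) (X\<inverse>))\<inverse>"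

lemma shift_peak:
  assumes "peak (X `` {a}) (X `` {b}) c"
  shows "shift a b X = insert (b, c) (X - {(a, c)})"
proof -
  have "(THE c. peak (X `` {a}) (X `` {b}) c) = c"
    using assms peak_unique by blast
  then show ?thesis using assms by (auto simp: shift_def)
qed

lemma shift_no_peak: "(\<And>c. \<not> peak (X `` {a}) (X `` {b}) c) \<Longrightarrow> shift a b X = X"
  by (simp add: shift_def)

lemma finite_Image_sing: "finite X \<Longrightarrow> finite (X `` {r})"
  by (simp add: finite_Image)

lemma finite_shift: "finite X \<Longrightarrow> finite (shift a b X)"
  by (cases "\<exists>c. peak (X `` {a}) (X `` {b}) c") (auto simp: shift_peak shift_no_peak)

lemma shift_rows:
  assumes "a \<noteq> b" "peak (X `` {a}) (X `` {b}) c"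
  shows "shift a b X `` {a} = X `` {a} - {c}" "shift a b X `` {b} = insert c (X `` {b})"
    "r \<noteq> a \<Longrightarrow> r \<noteq> b \<Longrightarrow> shift a b X `` {r} = X `` {r}"
  using assms by (auto simp: shift_peak)

lemma shift_row_other: "r \<noteq> a \<Longrightarrow> r \<noteq> b \<Longrightarrow> shift a b X `` {r} = X `` {r}"
  by (cases "\<exists>c. peak (X `` {a}) (X `` {b}) c") (auto simp: shift_peak shift_no_peak)

lemma shift_neq:
  assumes "finite X" "a \<noteq> b" "peak (X `` {a}) (X `` {b}) c"
  shows "shift a b X \<noteq> X"
  using shift_rows(1)[OF assms(2,3)] peak_mem(1)[OF _ _ assms(3)] assms(1)
  by (metis Diff_iff finite_Image_sing insertI1)

lemma shift_eq_iff:
  assumes "finite X" "a \<noteq> b"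
  shows "shift a b X = X \<longleftrightarrow> (\<forall>x. hgt (X `` {a}) (X `` {b}) x \<le> 0)"
  using shift_neq[OF assms] shift_no_peak[of X a b] no_peak_iff[of "X `` {a}" "X `` {b}"] assms(1)
  by (meson finite_Image_sing)

lemma card_insert_diff: "finite T \<Longrightarrow> x \<in> T \<Longrightarrow> y \<notin> T \<Longrightarrow> card (insert y (T - {x})) = card T"
  by (metis Diff_iff card_Suc_Diff1 card_insert_disjoint finite_Diff)

lemma card_col_shift:
  assumes "finite X" "a \<noteq> b"
  shows "card ((shift a b X)\<inverse> `` {c}) = card (X\<inverse> `` {c})"
proof (cases "\<exists>c. peak (X `` {a}) (X `` {b}) c")
  case True
  then obtain d where d: "peak (X `` {a}) (X `` {b}) d" by blast
  note m = peak_mem[OF finite_Image_sing[OF assms(1)] finite_Image_sing[OF assms(1)] d]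
  have "(shift a b X)\<inverse> `` {c} = (if c = d then insert b (X\<inverse> `` {c} - {a}) else X\<inverse> `` {c})"
    using d assms(2) by (auto simp: shift_peak)
  moreover have "card (insert b (X\<inverse> `` {d} - {a})) = card (X\<inverse> `` {d})"
    using m assms by (intro card_insert_diff) (auto simp: finite_Image_sing)
  ultimately show ?thesis by simp
qed (simp add: shift_no_peak)

lemma shift_inj:
  assumes "finite X" "finite Y" "a \<noteq> b" "shift a b X \<noteq> X" "shift a b Y \<noteq> Y" "shift a b X = shift a b Y"
  shows "X = Y"
proof -
  obtain c where c: "peak (X `` {a}) (X `` {b}) c" using assms(4) shift_no_peak by blast
  obtain d where d: "peak (Y `` {a}) (Y `` {b}) d" using assms(5) shift_no_peak by blast
  note fin = finite_Image_sing[OF assms(1)] finite_Image_sing[OF assms(2)]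
  have "c = d" using peak_step_inj[OF fin(1) fin(1) fin(2) fin(2) c d]
      shift_rows(1,2)[OF assms(3) c] shift_rows(1,2)[OF assms(3) d] assms(6) by auto
  moreover have "(a, c) \<in> X" "(b, c) \<notin> X" using peak_mem[OF fin(1) fin(1) c] by auto
  moreover have "(a, d) \<in> Y" "(b, d) \<notin> Y" using peak_mem[OF fin(2) fin(2) d] by auto
  moreover have "X = insert (a, c) (shift a b X - {(b, c)})" if "(a, c) \<in> X" "(b, c) \<notin> X"
    using that assms(3) by (auto simp: shift_peak[OF c])
  moreover have "Y = insert (a, d) (shift a b Y - {(b, d)})" if "(a, d) \<in> Y" "(b, d) \<notin> Y"
    using that assms(3) by (auto simp: shift_peak[OF d])
  ultimately show ?thesis using assms(6) by simp
qed

subsection \<open>The two commuting families of operators\<close>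

abbreviation col :: "config \<Rightarrow> nat \<Rightarrow> nat set" where
  "col X c \<equiv> X\<inverse> `` {c}"

abbreviation rowc :: "config \<Rightarrow> nat \<Rightarrow> nat set" where
  "rowc X r \<equiv> X `` {r}"

lemma down_peak: "peak (rowc X (Suc j)) (rowc X j) c \<Longrightarrow> down j X = insert (j, c) (X - {(Suc j, c)})"
  by (simp add: down_def shift_peak)

lemma down_no_peak: "(\<And>c. \<not> peak (rowc X (Suc j)) (rowc X j) c) \<Longrightarrow> down j X = X"
  by (simp add: down_def shift_no_peak)

lemma right_peak: "peak (col X i) (col X (Suc i)) r \<Longrightarrow> right i X = insert (r, Suc i) (X - {(r, i)})"
  by (auto simp: right_def shift_peak)

lemma right_no_peak: "(\<And>r. \<not> peak (col X i) (col X (Suc i)) r) \<Longrightarrow> right i X = X"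
  by (simp add: right_def shift_no_peak)

lemma finite_down: "finite X \<Longrightarrow> finite (down j X)"
  by (simp add: down_def finite_shift)

lemma finite_right: "finite X \<Longrightarrow> finite (right i X)"
  by (simp add: right_def finite_shift)

lemma finite_col: "finite X \<Longrightarrow> finite (col X c)"
  by (simp add: finite_Image)

text \<open>A ball going from row \<open>j + 1\<close> to row \<open>j\<close> affects the number of
  balls of its column in rows \<ge> \<open>r\<close> only for \<open>r = j + 1\<close>. Hence the
  two families can interact only within a single square.\<close>

lemma col_hgt_vertical_move:
  assumes "finite X" "(Suc j, c) \<in> X" "(j, c) \<notin> X"
  defines "Y \<equiv> insert (j, c) (X - {(Suc j, c)})"
  shows "hgt (col Y i) (col Y (Suc i)) r =
    hgt (col X i) (col X (Suc i)) r + of_bool (c = Suc i \<and> r = Suc j) - of_bool (c = i \<and> r = Suc j)"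
proof -
  have Y: "col Y k = (if k = c then insert j (col X k - {Suc j}) else col X k)" for k
    by (auto simp: Y_def)
  have m: "Suc j \<in> col X c" "j \<notin> col X c" using assms by auto
  have le: "r \<le> Suc j \<longleftrightarrow> r \<le> j \<or> r = Suc j" by auto
  consider "c = i" | "c = Suc i" | "c \<noteq> i" "c \<noteq> Suc i" by blast
  then show ?thesis
  proof cases
    case 1
    then show ?thesis using m assms(1)
      by (simp add: Y hgt_insert1 hgt_remove1 finite_col le)
  next
    case 2
    then show ?thesis using m assms(1)
      by (simp add: Y hgt_insert2 hgt_remove2 finite_col le)
  next
    case 3
    then show ?thesis by (simp add: Y)
  qed
qed

lemma row_hgt_horizontal_move:
  assumes "finite X" "(r, i) \<in> X" "(r, Suc i) \<notin> X"
  defines "Y \<equiv> insert (r, Suc i) (X - {(r, i)})"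
  shows "hgt (rowc Y (Suc j)) (rowc Y j) c =
    hgt (rowc X (Suc j)) (rowc X j) c + of_bool (r = Suc j \<and> c = Suc i) - of_bool (r = j \<and> c = Suc i)"
proof -
  have Y: "rowc Y k = (if k = r then insert (Suc i) (rowc X k - {i}) else rowc X k)" for k
    by (auto simp: Y_def)
  have m: "Suc i \<notin> rowc X r" "i \<in> rowc X r" using assms by auto
  have le: "c \<le> Suc i \<longleftrightarrow> c \<le> i \<or> c = Suc i" by auto
  consider "r = j" | "r = Suc j" | "r \<noteq> j" "r \<noteq> Suc j" by blast
  then show ?thesis
  proof cases
    case 1
    then show ?thesis using m assms(1)
      by (simp add: Y hgt_insert2 hgt_remove2 finite_Image_sing le)
  next
    case 2
    then show ?thesis using m assms(1)
      by (simp add: Y hgt_insert1 hgt_remove1 finite_Image_sing le)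
  next
    case 3
    then show ?thesis by (simp add: Y)
  qed
qed

text \<open>The whole case analysis happens in the square of rows \<open>j, j + 1\<close> and columns \<open>i, i + 1\<close>:
  the four differences below are read off its entries.\<close>

lemma down_right_commute:
  assumes fin: "finite X"
  shows "down j (right i X) = right i (down j X)"
proof -
  define D where "D = hgt (rowc X (Suc j)) (rowc X j)"
  define P where "P = hgt (col X i) (col X (Suc i))"
  define a b e d :: int
    where "a = of_bool ((Suc j, i) \<in> X)" and "b = of_bool ((Suc j, Suc i) \<in> X)"
      and "e = of_bool ((j, i) \<in> X)" and "d = of_bool ((j, Suc i) \<in> X)"
  note finr = finite_Image_sing[OF fin] and finc = finite_col[OF fin]
  have D1: "D i = D (Suc i) + a - e" and D2: "D (Suc i) = D (Suc (Suc i)) + b - d"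
    unfolding D_def a_def b_def e_def d_def by (subst hgt_Suc; simp add: finr)+
  have P1: "P j = P (Suc j) + e - d" and P2: "P (Suc j) = P (Suc (Suc j)) + a - b"
    unfolding P_def a_def b_def e_def d_def by (subst hgt_Suc; simp add: finc)+
  have bits: "a = 0 \<or> a = 1" "b = 0 \<or> b = 1" "e = 0 \<or> e = 1" "d = 0 \<or> d = 1"
    by (auto simp: a_def b_def e_def d_def)
  let ?E = "\<lambda>X. peak (rowc X (Suc j)) (rowc X j)" and ?F = "\<lambda>X. peak (col X i) (col X (Suc i))"
  show ?thesis
  proof (cases "\<exists>c. ?E X c")
    case noE: False
    then have D0: "\<And>x. D x \<le> 0" using no_peak_iff[OF finr finr] by (auto simp: D_def)
    show ?thesis
    proof (cases "\<exists>r. ?F X r")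
      case False
      then show ?thesis using noE by (simp add: down_no_peak right_no_peak)
    next
      case True
      then obtain r where r: "?F X r" by blast
      note m = peak_mem[OF finc finc r]
      define Y where "Y = right i X"
      have Y: "Y = insert (r, Suc i) (X - {(r, i)})" by (simp add: Y_def right_peak[OF r])
      have Pr: "\<And>x. P x \<le> P r" using r by (auto simp: peak_def P_def)
      have "D x + of_bool (r = Suc j \<and> x = Suc i) - of_bool (r = j \<and> x = Suc i) \<le> 0" for x
      proof (cases "r = Suc j \<and> x = Suc i")
        case True
        then have "a = 1" "b = 0" using m by (auto simp: a_def b_def)
        \<comment> \<open>Maximality of \<open>P\<close> at \<open>j + 1\<close> gives
          \<open>e \<le> d\<close>. If \<open>d = 1\<close>, then
          \<open>D (Suc i) < D (Suc (Suc i)) \<le> 0\<close>; if \<open>d = e = 0\<close>, then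
          \<open>D (Suc i) < D i \<le> 0\<close>.\<close>
        then show ?thesis using D1 D2 P1 D0[of i] D0[of "Suc i"] D0[of "Suc (Suc i)"] Pr[of j] True bits
          by auto
      qed (use D0[of x] in auto)
      then have "\<And>x. hgt (rowc Y (Suc j)) (rowc Y j) x \<le> 0"
        unfolding Y using row_hgt_horizontal_move[OF fin, of r i j] m by (simp add: D_def)
      then have "\<And>c. \<not> ?E Y c"
        using no_peak_iff[of "rowc Y (Suc j)" "rowc Y j"] finite_right[OF fin, of i]
        by (auto simp: Y_def finite_Image_sing)
      then show ?thesis using noE by (simp add: Y_def down_no_peak)
    qed
  next
    case True
    then obtain c where c: "?E X c" by blast
    note mc = peak_mem[OF finr finr c]
    define Z where "Z = down j X"
    have Z: "Z = insert (j, c) (X - {(Suc j, c)})" by (simp add: Z_def down_peak[OF c])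
    have Dc: "\<And>x. D x \<le> D c" "\<And>x. c < x \<Longrightarrow> D x < D c" using c by (auto simp: peak_def D_def)
    have c1: "c = i \<Longrightarrow> a = 1 \<and> e = 0" and c2: "c = Suc i \<Longrightarrow> b = 1 \<and> d = 0"
      using mc by (auto simp: a_def b_def e_def d_def)
    have PZ: "hgt (col Z i) (col Z (Suc i)) x
        = P x + of_bool (c = Suc i \<and> x = Suc j) - of_bool (c = i \<and> x = Suc j)" for x
      unfolding Z using col_hgt_vertical_move[OF fin, of j c i] mc by (simp add: P_def)
    show ?thesis
    proof (cases "\<exists>r. ?F X r")
      case noF: False
      then have P0: "\<And>x. P x \<le> 0" using no_peak_iff[OF finc finc] by (auto simp: P_def)
      have "P x + of_bool (c = Suc i \<and> x = Suc j) - of_bool (c = i \<and> x = Suc j) \<le> 0" for x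
      proof (cases "c = Suc i \<and> x = Suc j")
        case True
        then show ?thesis using c2 D1 P1 P2 P0[of j] P0[of "Suc j"] P0[of "Suc (Suc j)"] Dc(1)[of i] bits
          by auto
      qed (use P0[of x] in auto)
      then have "\<And>r. \<not> ?F Z r"
        using no_peak_iff[of "col Z i" "col Z (Suc i)"] finite_down[OF fin, of j]
        by (auto simp: PZ finite_col Z_def[symmetric])
      then show ?thesis using noF by (simp add: Z_def right_no_peak)
    next
      case True
      then obtain r where r: "?F X r" by blast
      note mr = peak_mem[OF finc finc r]
      define Y where "Y = right i X"
      have Y: "Y = insert (r, Suc i) (X - {(r, i)})" by (simp add: Y_def right_peak[OF r])
      have Pr: "\<And>x. P x \<le> P r" "\<And>x. r < x \<Longrightarrow> P x < P r" using r by (auto simp: peak_def P_def)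
      have r1: "r = Suc j \<Longrightarrow> a = 1 \<and> b = 0" and r2: "r = j \<Longrightarrow> e = 1 \<and> d = 0"
        using mr by (auto simp: a_def b_def e_def d_def)
      have DY: "hgt (rowc Y (Suc j)) (rowc Y j) x
          = D x + of_bool (r = Suc j \<and> x = Suc i) - of_bool (r = j \<and> x = Suc i)" for x
        unfolding Y using row_hgt_horizontal_move[OF fin, of r i j] mr by (simp add: D_def)
      let ?D = "\<lambda>x. D x + of_bool (r = Suc j \<and> x = Suc i) - of_bool (r = j \<and> x = Suc i)"
        and ?P = "\<lambda>x. P x + of_bool (c = Suc i \<and> x = Suc j) - of_bool (c = i \<and> x = Suc j)"
      have goal: "down j Y = right i Z \<Longrightarrow> ?thesis" by (simp add: Y_def Z_def)
      have mem: "(Suc j, c) \<in> X" "(j, c) \<notin> X" "(r, i) \<in> X" "(r, Suc i) \<notin> X"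
        using mc mr by auto
      \<comment> \<open>The moves interfere in two ways only: both want the ball at
        \<open>(j + 1, i)\<close>, or both want the cell \<open>(j, i + 1)\<close>. In the first
        case the ball goes around either side of the square; in the second, whichever operator comes
        later moves the ball at \<open>(j + 1, i)\<close> instead. Otherwise both peaks stay where
        they are.\<close>
      consider "c = i" "r = Suc j" | "c = Suc i" "r = j" | "\<not> (c = i \<and> r = Suc j)" "\<not> (c = Suc i \<and> r = j)"
        by blast
      then show ?thesis
      proof cases
        case 1
        \<comment> \<open>With \<open>d = 1\<close> the heights at \<open>i\<close> and
          \<open>i + 2\<close> would agree, although \<open>i\<close> is the last maximum.\<close>
        have d: "d = 0" using 1 c1 r1 bits D1 D2 Dc(2)[of "Suc (Suc i)"] by auto
        have "?E Y (Suc i)"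
          unfolding peak_def DY
        proof (intro conjI allI impI)
          fix x
          show "?D x \<le> ?D (Suc i)"
            using 1 c1 D1 Dc(1)[of x] by auto
          assume "Suc i < x"
          then show "?D x < ?D (Suc i)"
            using 1 c1 D1 Dc(2)[of x] by auto
        qed
        moreover have "?F Z j"
          unfolding peak_def PZ
        proof (intro conjI allI impI)
          fix x
          show "?P x \<le> ?P j"
            using 1 c1 d P1 Pr(1)[of x] by auto
          assume "j < x"
          then show "?P x < ?P j"
            using 1 c1 d P1 Pr(2)[of x] by (cases "x = Suc j") auto
        qed
        ultimately have "down j Y = insert (j, Suc i) (Y - {(Suc j, Suc i)})"
          "right i Z = insert (j, Suc i) (Z - {(j, i)})" by (simp_all add: down_peak right_peak)
        then show ?thesis using mem 1 by (intro goal) (auto simp: Y Z)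
      next
        case 2
        have a: "a = 1" using 2 c2 r2 bits P1 P2 Pr(2)[of "Suc j"] Pr(2)[of "Suc (Suc j)"] by auto
        have e: "e = 1" "d = 0" "b = 1" using 2 c2 r2 by auto
        have "?E Y i"
          unfolding peak_def DY
        proof (intro conjI allI impI)
          fix x
          show "?D x \<le> ?D i"
            using 2 a e D1 Dc(1)[of x] by auto
          assume "i < x"
          then show "?D x < ?D i"
            using 2 a e D1 Dc(2)[of x] by (cases "x = Suc i") auto
        qed
        moreover have "?F Z (Suc j)"
          unfolding peak_def PZ
        proof (intro conjI allI impI)
          fix x
          show "?P x \<le> ?P (Suc j)"
            using 2 a e P1 Pr(1)[of x] by auto
          assume "Suc j < x"
          then show "?P x < ?P (Suc j)"
            using 2 a e P1 Pr(2)[of x] by auto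
        qed
        ultimately have eq: "down j Y = insert (j, i) (Y - {(Suc j, i)})"
          "right i Z = insert (Suc j, Suc i) (Z - {(Suc j, i)})" by (simp_all add: down_peak right_peak)
        have "(Suc j, i) \<in> X" "(j, i) \<in> X" using a e by (auto simp: a_def e_def)
        then show ?thesis using mem 2 eq by (intro goal) (auto simp: Y Z)
      next
        case 3
        have E: "D (Suc i) + 1 \<le> D c \<and> (c < Suc i \<longrightarrow> D (Suc i) + 1 < D c)" if "r = Suc j"
          using 3 that c1 c2 r1 bits D1 D2 P1 Pr(1)[of j] Dc(1)[of "Suc i"] Dc(1)[of i]
            Dc(1)[of "Suc (Suc i)"] Dc(2)[of "Suc i"] Dc(2)[of i] Dc(2)[of "Suc (Suc i)"]
          by (cases "c < i"; cases "c = i"; cases "c = Suc i"; cases "c > Suc i") auto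
        have F: "P (Suc j) + 1 \<le> P r \<and> (r < Suc j \<longrightarrow> P (Suc j) + 1 < P r)" if "c = Suc i"
          using 3 that r1 r2 c2 bits P1 P2 D1 Dc(1)[of i] Pr(1)[of "Suc j"] Pr(1)[of j]
            Pr(1)[of "Suc (Suc j)"] Pr(2)[of "Suc j"] Pr(2)[of j] Pr(2)[of "Suc (Suc j)"]
          by (cases "r < j"; cases "r = j"; cases "r = Suc j"; cases "r > Suc j") auto
        have "?E Y c"
          unfolding peak_def DY
        proof (intro conjI allI impI)
          fix x
          show "?D x \<le> ?D c"
            using 3 E Dc(1)[of x] r1 c2 by (auto simp: of_bool_def)
          assume "c < x"
          then show "?D x < ?D c"
            using 3 E Dc(2)[of x] r1 c2 by (auto simp: of_bool_def)
        qed
        moreover have "?F Z r"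
          unfolding peak_def PZ
        proof (intro conjI allI impI)
          fix x
          show "?P x \<le> ?P r"
            using 3 F Pr(1)[of x] r1 c2 by (auto simp: of_bool_def)
          assume "r < x"
          then show "?P x < ?P r"
            using 3 F Pr(2)[of x] r1 c2 by (auto simp: of_bool_def)
        qed
        ultimately have eq: "down j Y = insert (j, c) (Y - {(Suc j, c)})"
          "right i Z = insert (r, Suc i) (Z - {(r, i)})" by (simp_all add: down_peak right_peak)
        show ?thesis using mem 3 eq by (intro goal) (auto simp: Y Z)
      qed
    qed
  qed
qed

lemma card_row_right: "finite X \<Longrightarrow> card (rowc (right i X) r) = card (rowc X r)"
  using card_col_shift[of "X\<inverse>" i "Suc i" r] by (simp add: right_def)

lemma card_col_down: "finite X \<Longrightarrow> card (col (down j X) c) = card (col X c)"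
  by (simp add: down_def card_col_shift)

lemma down_fixed_iff: "finite X \<Longrightarrow> down j X = X \<longleftrightarrow> (\<forall>x. hgt (rowc X (Suc j)) (rowc X j) x \<le> 0)"
  by (simp add: down_def shift_eq_iff)

lemma right_fixed_iff: "finite X \<Longrightarrow> right i X = X \<longleftrightarrow> (\<forall>x. hgt (col X i) (col X (Suc i)) x \<le> 0)"
  using shift_eq_iff[of "X\<inverse>" i "Suc i"] unfolding right_def by (metis converse_converse finite_converse n_not_Suc_n)

lemma down_rows:
  assumes "peak (rowc X (Suc j)) (rowc X j) c"
  shows "rowc (down j X) (Suc j) = rowc X (Suc j) - {c}" "rowc (down j X) j = insert c (rowc X j)"
  using shift_rows[OF _ assms] by (simp_all add: down_def)

lemma right_cols:
  assumes "peak (col X i) (col X (Suc i)) r"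
  shows "col (right i X) i = col X i - {r}" "col (right i X) (Suc i) = insert r (col X (Suc i))"
  by (auto simp: right_peak[OF assms])

lemma down_row_other: "r \<noteq> j \<Longrightarrow> r \<noteq> Suc j \<Longrightarrow> rowc (down j X) r = rowc X r"
  by (simp add: down_def shift_row_other)

section \<open>String lengths and their invariance under the other family\<close>

definition mxrow :: "nat \<Rightarrow> config \<Rightarrow> int" where
  "mxrow j X = mx (rowc X (Suc j)) (rowc X j)"

definition mxcol :: "nat \<Rightarrow> config \<Rightarrow> int" where
  "mxcol i X = mx (col X i) (col X (Suc i))"

lemma mxrow_nonneg: "finite X \<Longrightarrow> 0 \<le> mxrow j X"
  by (simp add: mxrow_def mx_nonneg finite_Image_sing)

lemma mxcol_nonneg: "finite X \<Longrightarrow> 0 \<le> mxcol j X"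
  by (simp add: mxcol_def mx_nonneg finite_col)

lemma mxrow_zero: "finite X \<Longrightarrow> mxrow j X = 0 \<longleftrightarrow> down j X = X"
  by (simp add: mxrow_def mx_zero_iff finite_Image_sing down_fixed_iff)

lemma mxcol_zero: "finite X \<Longrightarrow> mxcol i X = 0 \<longleftrightarrow> right i X = X"
  by (simp add: mxcol_def mx_zero_iff finite_col right_fixed_iff)

lemma mxrow_step:
  assumes "finite X" "down j X \<noteq> X"
  shows "mxrow j (down j X) = mxrow j X - 1"
proof -
  obtain c where c: "peak (rowc X (Suc j)) (rowc X j) c" using assms(2) down_no_peak by blast
  show ?thesis using mx_step[OF _ _ c] assms(1) by (simp add: mxrow_def down_rows[OF c] finite_Image_sing)
qed

lemma mxcol_step:
  assumes "finite X" "right i X \<noteq> X"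
  shows "mxcol i (right i X) = mxcol i X - 1"
proof -
  obtain c where c: "peak (col X i) (col X (Suc i)) c" using assms(2) right_no_peak by blast
  show ?thesis using mx_step[OF _ _ c] assms(1) by (simp add: mxcol_def right_cols[OF c] finite_col)
qed

lemma card_row_down_step:
  assumes "finite X" "down j X \<noteq> X"
  shows "card (rowc (down j X) j) = Suc (card (rowc X j))"
proof -
  obtain c where c: "peak (rowc X (Suc j)) (rowc X j) c" using assms(2) down_no_peak by blast
  show ?thesis using peak_mem[OF _ _ c] assms(1) by (simp add: down_rows[OF c] finite_Image_sing)
qed

lemma card_col_right_step:
  assumes "finite X" "right i X \<noteq> X"
  shows "card (col (right i X) (Suc i)) = Suc (card (col X (Suc i)))"
proof -
  obtain c where c: "peak (col X i) (col X (Suc i)) c" using assms(2) right_no_peak by blast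
  show ?thesis using peak_mem[OF _ _ c] assms(1) by (simp add: right_cols[OF c] finite_col)
qed

text \<open>A proper row move enlarges row \<open>j\<close>, whereas column moves keep all row
  sizes; by commutation, a column move can neither create nor destroy properness.\<close>

lemma down_right_fixed_iff:
  assumes "finite X"
  shows "down j (right i X) = right i X \<longleftrightarrow> down j X = X"
proof
  assume "down j (right i X) = right i X"
  then have "card (rowc (right i (down j X)) j) = card (rowc (right i X) j)"
    using down_right_commute[OF assms] by simp
  then show "down j X = X"
    using assms card_row_down_step[OF assms, of j] by (auto simp: card_row_right finite_down)
qed (simp add: down_right_commute[OF assms])

lemma right_down_fixed_iff:
  assumes "finite X"
  shows "right i (down j X) = down j X \<longleftrightarrow> right i X = X"
proof
  assume "right i (down j X) = down j X"
  then have "card (col (down j (right i X)) (Suc i)) = card (col (down j X) (Suc i))"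
    using down_right_commute[OF assms] by simp
  then show "right i X = X"
    using assms card_col_right_step[OF assms, of i] by (auto simp: card_col_down finite_right)
qed (simp flip: down_right_commute[OF assms])

text \<open>\<open>F\<close> counts the steps of \<open>S\<close> until it acts trivially. Since
  \<open>T\<close> commutes with \<open>S\<close> and respects being fixed in both directions, the
  two orbits stop after equally many steps.\<close>

lemma mx_commuting:
  fixes F :: "config \<Rightarrow> int"
  assumes fin: "\<And>X. finite X \<Longrightarrow> finite (S X)"
    and comm: "\<And>X. finite X \<Longrightarrow> S (T X) = T (S X)"
    and fixed: "\<And>X. finite X \<Longrightarrow> S (T X) = T X \<longleftrightarrow> S X = X"
    and F: "\<And>X. finite X \<Longrightarrow> 0 \<le> F X" "\<And>X. finite X \<Longrightarrow> F X = 0 \<longleftrightarrow> S X = X"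
      "\<And>X. finite X \<Longrightarrow> S X \<noteq> X \<Longrightarrow> F (S X) = F X - 1"
    and finT: "\<And>X. finite X \<Longrightarrow> finite (T X)"
  shows "finite X \<Longrightarrow> F (T X) = F X"
proof (induction "nat (F X)" arbitrary: X)
  case 0
  then have "F X = 0" using F(1)[of X] by simp
  then show ?case using 0 F(2) fixed finT by metis
next
  case (Suc m)
  then have ne: "S X \<noteq> X" using F(2)[of X] by auto
  have "F (T X) = F (S (T X)) + 1"
    using F(3)[OF finT[OF Suc.prems]] fixed[OF Suc.prems] ne by simp
  also have "F (S (T X)) = F (S X)"
    using Suc.hyps(1)[of "S X"] Suc.hyps(2) F(3)[OF Suc.prems ne] by (simp add: comm fin Suc.prems)
  finally show ?case using F(3)[OF Suc.prems ne] by simp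
qed

lemma mxrow_right: "finite X \<Longrightarrow> mxrow j (right i X) = mxrow j X"
  by (rule mx_commuting[where S = "down j" and T = "right i" and F = "mxrow j"])
    (simp_all add: finite_down finite_right down_right_fixed_iff mxrow_nonneg mxrow_zero mxrow_step,
      simp add: down_right_commute)

lemma mxcol_down: "finite X \<Longrightarrow> mxcol i (down j X) = mxcol i X"
  by (rule mx_commuting[where S = "right i" and T = "down j" and F = "mxcol i"])
    (simp_all add: finite_down finite_right right_down_fixed_iff mxcol_nonneg mxcol_zero mxcol_step,
      simp add: down_right_commute)

section \<open>Words of operators and complete iterates\<close>

definition downs :: "nat list \<Rightarrow> config \<Rightarrow> config" where
  "downs js X = foldr down js X"

definition rights :: "nat list \<Rightarrow> config \<Rightarrow> config" where
  "rights is X = foldr right is X"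

lemma downs_simps [simp]: "downs [] X = X" "downs (j # js) X = down j (downs js X)"
  "downs (js @ ks) X = downs js (downs ks X)"
  by (simp_all add: downs_def)

lemma rights_simps [simp]: "rights [] X = X" "rights (j # js) X = right j (rights js X)"
  "rights (js @ ks) X = rights js (rights ks X)"
  by (simp_all add: rights_def)

lemma finite_downs: "finite X \<Longrightarrow> finite (downs js X)"
  by (induction js) (auto simp: finite_down)

lemma finite_rights: "finite X \<Longrightarrow> finite (rights js X)"
  by (induction js) (auto simp: finite_right)

lemma downs_right: "finite X \<Longrightarrow> downs js (right i X) = right i (downs js X)"
  by (induction js) (auto simp: down_right_commute finite_downs)

lemma downs_rights: "finite X \<Longrightarrow> downs js (rights is X) = rights is (downs js X)"
  by (induction "is") (auto simp: downs_right finite_rights)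

lemma card_col_downs: "finite X \<Longrightarrow> card (col (downs js X) c) = card (col X c)"
  by (induction js) (auto simp: card_col_down finite_downs)

lemma card_row_rights: "finite X \<Longrightarrow> card (rowc (rights is X) r) = card (rowc X r)"
  by (induction "is") (auto simp: card_row_right finite_rights)

lemma mxcol_downs: "finite X \<Longrightarrow> mxcol i (downs js X) = mxcol i X"
  by (induction js) (auto simp: mxcol_down finite_downs)

lemma down_rights_fixed_iff: "finite X \<Longrightarrow> down j (rights is X) = rights is X \<longleftrightarrow> down j X = X"
  by (induction "is") (auto simp: down_right_fixed_iff finite_rights)

text \<open>Every letter, read from right to left, moves a ball. Such a word can be undone, and
  column moves neither create nor destroy the property.\<close>

fun reduced :: "nat list \<Rightarrow> config \<Rightarrow> bool" where
  "reduced [] X = True"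
| "reduced (j # js) X = (reduced js X \<and> down j (downs js X) \<noteq> downs js X)"

lemma reduced_append: "reduced (js @ ks) X \<longleftrightarrow> reduced ks X \<and> reduced js (downs ks X)"
  by (induction js) auto

lemma reduced_right: "finite X \<Longrightarrow> reduced js (right i X) \<longleftrightarrow> reduced js X"
  by (induction js) (auto simp: downs_right down_right_fixed_iff finite_downs)

lemma reduced_inj:
  "finite X \<Longrightarrow> finite Y \<Longrightarrow> reduced js X \<Longrightarrow> reduced js Y \<Longrightarrow> downs js X = downs js Y \<Longrightarrow> X = Y"
proof (induction js)
  case (Cons j js)
  then have "downs js X = downs js Y"
    using shift_inj[of "downs js X" "downs js Y" "Suc j" j] by (simp add: finite_downs down_def)
  then show ?case using Cons by simp
qed simp

text \<open>The number of repetitions is fixed in advance as the string length, so the complete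
  iterate is a total function to which all facts about words apply.\<close>

definition star :: "nat \<Rightarrow> config \<Rightarrow> config" where
  "star j X = downs (replicate (nat (mxrow j X)) j) X"

lemma downs_replicate_Suc: "downs (replicate (Suc k) j) X = downs (replicate k j) (down j X)"
  by (metis downs_simps replicate_append_same replicate_Suc)

lemma star_fixed: "finite X \<Longrightarrow> down j X = X \<Longrightarrow> star j X = X"
  using mxrow_zero[of X j] by (simp add: star_def)

lemma star_step:
  assumes "finite X" "down j X \<noteq> X"
  shows "star j X = star j (down j X)"
proof -
  have "0 < mxrow j X" using assms mxrow_zero[of X j] mxrow_nonneg[of X j] by linarith
  then have "nat (mxrow j X) = Suc (nat (mxrow j (down j X)))" using mxrow_step[OF assms] by simp
  then show ?thesis unfolding star_def by (simp only: downs_replicate_Suc)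
qed

lemma star_induct [consumes 1, case_names fixed step]:
  assumes "finite X"
    and "\<And>X. finite X \<Longrightarrow> down j X = X \<Longrightarrow> star j X = X \<Longrightarrow> P X"
    and "\<And>X. finite X \<Longrightarrow> down j X \<noteq> X \<Longrightarrow> star j X = star j (down j X) \<Longrightarrow> P (down j X) \<Longrightarrow> P X"
  shows "P X"
  using assms(1)
proof (induction "nat (mxrow j X)" arbitrary: X rule: less_induct)
  case less
  show ?case
  proof (cases "down j X = X")
    case False
    then have "0 < mxrow j X" using less mxrow_zero[of X j] mxrow_nonneg[of X j] by linarith
    then have "P (down j X)" using less mxrow_step[OF less.prems False] by (simp add: finite_down)
    then show ?thesis using assms(3) less False star_step by blast
  qed (use less assms(2) star_fixed in blast)
qed

lemma finite_star: "finite X \<Longrightarrow> finite (star j X)"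
  by (simp add: star_def finite_downs)

lemma star_right: "finite X \<Longrightarrow> star j (right i X) = right i (star j X)"
  by (simp add: star_def mxrow_right downs_right)

lemma star_row_other: "r \<noteq> j \<Longrightarrow> r \<noteq> Suc j \<Longrightarrow> rowc (star j X) r = rowc X r"
proof -
  assume "r \<noteq> j" "r \<noteq> Suc j"
  then have "rowc (downs (replicate k j) X) r = rowc X r" for k
    by (induction k) (auto simp: down_row_other)
  then show ?thesis by (simp add: star_def)
qed

section \<open>Effect of a complete iterate on its two rows\<close>

lemma hgt_split:
  assumes "finite A" "finite B" "x \<le> y"
  shows "hgt A B x = hgt A B y + int (card (A \<inter> {x..<y})) - int (card (B \<inter> {x..<y}))"
proof -
  have "card (A \<inter> {x..}) = card (A \<inter> {x..<y}) + card (A \<inter> {y..})" if "finite A" for A :: "nat set"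
  proof -
    have "A \<inter> {x..} = (A \<inter> {x..<y}) \<union> (A \<inter> {y..})" using assms(3) by auto
    then show ?thesis using that by (simp add: card_Un_disjoint disjoint_iff)
  qed
  then show ?thesis using assms by (simp add: hgt_def)
qed

text \<open>The hypothesis says that right of an upper ball over an empty cell, every lower ball is
  cancelled by an upper ball in its own column. So each upper ball over an empty cell is unmatched
  and drops.\<close>

lemma star_rows_drop:
  assumes "finite X" "\<And>x y. x \<in> rowc X (Suc j) - rowc X j \<Longrightarrow> y \<in> rowc X j \<Longrightarrow> x < y \<Longrightarrow> y \<in> rowc X (Suc j)"
  shows "rowc (star j X) (Suc j) = rowc X (Suc j) \<inter> rowc X j \<and>
    rowc (star j X) j = rowc X (Suc j) \<union> rowc X j"
  using assms
proof (induction X rule: star_induct[where j = j])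
  case (fixed X)
  let ?A = "rowc X (Suc j)" and ?B = "rowc X j"
  have "?A \<subseteq> ?B"
  proof (rule ccontr)
    assume "\<not> ?A \<subseteq> ?B"
    then obtain x where x: "x \<in> ?A" "x \<notin> ?B" by auto
    then have sub: "?B \<inter> {x..} \<subset> ?A \<inter> {x..}" using fixed.prems[of x] by (force simp: order.order_iff_strict)
    have "card (?B \<inter> {x..}) < card (?A \<inter> {x..})"
      using psubset_card_mono[OF _ sub] fixed.hyps(1) by (simp add: finite_Image_sing)
    then show False using fixed.hyps down_fixed_iff[of X j] by (auto simp: hgt_def dest!: spec[of _ x])
  qed
  then show ?case using fixed.hyps by auto
next
  case (step X)
  let ?A = "rowc X (Suc j)" and ?B = "rowc X j"
  obtain c where c: "peak ?A ?B c" using step.hyps(2) down_no_peak by blast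
  note fin = finite_Image_sing[OF step.hyps(1)]
  note m = peak_mem[OF fin fin c]
  \<comment> \<open>Thus the peak is the leftmost ball of \<open>?A - ?B\<close>, and the hypothesis
    survives its move.\<close>
  have lt: "x \<notin> ?A - ?B" if "x < c" for x
  proof
    assume x: "x \<in> ?A - ?B"
    then have sub: "?B \<inter> {x..<c} \<subset> ?A \<inter> {x..<c}"
      using step.prems[OF x] that by (force simp: order.order_iff_strict)
    have "card (?B \<inter> {x..<c}) < card (?A \<inter> {x..<c})"
      using psubset_card_mono[OF _ sub] fin by simp
    then have "hgt ?A ?B c < hgt ?A ?B x" using hgt_split[OF fin fin, of x c] that by simp
    then show False using c by (auto simp: peak_def not_le dest!: spec[of _ x])
  qed
  have "y \<in> rowc (down j X) (Suc j)"
    if "x \<in> rowc (down j X) (Suc j) - rowc (down j X) j" "y \<in> rowc (down j X) j" "x < y" for x y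
    using that lt step.prems[of x y] by (auto simp: down_rows[OF c])
  from step.IH[OF this] step.hyps(3) m show ?case by (auto simp: down_rows[OF c])
qed

text \<open>The balls of \<open>B\<close> whose closing brackets are matched. This set does not change while balls
  of \<open>A\<close> move down, and the balls which move down lie to the right of the unmatched ones of \<open>B\<close>.\<close>

definition matched_part :: "nat set \<Rightarrow> nat set \<Rightarrow> nat set" where
  "matched_part A B = {c \<in> B. \<exists>a\<le>c. hgt A B (Suc c) \<le> hgt A B a}"

lemma matched_part_subset: "matched_part A B \<subseteq> B"
  by (auto simp: matched_part_def)

lemma matched_part_step:
  assumes "finite A" "finite B" "peak A B c"
  shows "matched_part (A - {c}) (insert c B) = matched_part A B"
    "\<forall>y \<in> B - matched_part A B. y < c"
proof -
  note m = peak_mem[OF assms]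
  have h: "hgt (A - {c}) (insert c B) x = hgt A B x - 2 * of_bool (x \<le> c)" for x
    using hgt_move[OF assms(1,2) m(1,2)] .
  have le: "hgt A B x \<le> hgt A B c" and less: "c < x \<Longrightarrow> hgt A B x < hgt A B c" for x
    using assms(3) by (auto simp: peak_def)
  show *: "\<forall>y \<in> B - matched_part A B. y < c"
  proof (intro ballI, rule ccontr)
    fix y assume y: "y \<in> B - matched_part A B" "\<not> y < c"
    then show False using le[of "Suc y"] by (auto simp: matched_part_def not_less)
  qed
  have "y \<in> matched_part (A - {c}) (insert c B) \<longleftrightarrow> y \<in> matched_part A B" for y
  proof -
    consider "y < c" | "y = c" | "c < y" by linarith
    then show ?thesis
    proof cases
      case 1
      then have "a \<le> y \<Longrightarrow> hgt (A - {c}) (insert c B) a = hgt A B a - 2" for a by (simp add: h)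
      moreover have "hgt (A - {c}) (insert c B) (Suc y) = hgt A B (Suc y) - 2" using 1 by (simp add: h)
      ultimately show ?thesis using 1 by (auto simp: matched_part_def)
    next
      case 2
      have "\<not> hgt A B c - 1 \<le> hgt A B a - 2" for a using le[of a] by linarith
      then show ?thesis using 2 m by (auto simp: matched_part_def h)
    next
      case 3
      have "y \<in> matched_part (A - {c}) (insert c B)" if "y \<in> B"
        using that 3 less[of "Suc y"] m
        by (auto simp: matched_part_def h intro!: exI[of _ "Suc c"])
      moreover have "y \<in> matched_part A B" if "y \<in> B" using * 3 that by (metis DiffI less_asym)
      ultimately show ?thesis using 3 matched_part_subset by blast
    qed
  qed
  then show "matched_part (A - {c}) (insert c B) = matched_part A B" by blast
qed

text \<open>Equivalently, \<open>W \<subseteq> E \<subseteq> V\<close> and \<open>E - W\<close> is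
  an initial segment of \<open>V - W\<close>. For finite \<open>V\<close>, the sets \<open>W\<close>
  and \<open>V\<close> and the size of \<open>E\<close> determine \<open>E\<close>; in this form a
  row before a sweep is remembered by the rows after it.\<close>

definition initial_ext :: "nat set \<Rightarrow> nat set \<Rightarrow> nat set \<Rightarrow> bool" where
  "initial_ext W V E \<longleftrightarrow> W \<subseteq> E \<and> E \<subseteq> V \<and> (\<forall>x \<in> E - W. \<forall>y \<in> V - E. x < y)"

text \<open>Each move adds a lower ball to the right of all unmatched lower balls and leaves the
  matched ones alone. The old lower row therefore consists of the matched balls and the leftmost
  ones among the others.\<close>

lemma star_initial_ext:
  assumes "finite X"
  shows "matched_part (rowc (star j X) (Suc j)) (rowc (star j X) j)
      = matched_part (rowc X (Suc j)) (rowc X j) \<and>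
    initial_ext (matched_part (rowc X (Suc j)) (rowc X j)) (rowc (star j X) j) (rowc X j)"
  using assms
proof (induction X rule: star_induct[where j = j])
  case (fixed X)
  then show ?case using matched_part_subset by (auto simp: initial_ext_def)
next
  case (step X)
  obtain c where c: "peak (rowc X (Suc j)) (rowc X j) c" using step.hyps(2) down_no_peak by blast
  note fin = finite_Image_sing[OF step.hyps(1)]
  note s = matched_part_step[OF fin fin c]
  let ?F = "matched_part (rowc X (Suc j)) (rowc X j)" and ?B' = "rowc (star j X) j"
  have IH: "matched_part (rowc (star j X) (Suc j)) ?B' = ?F" "?F \<subseteq> insert c (rowc X j)" "insert c (rowc X j) \<subseteq> ?B'"
    "\<And>x y. x \<in> insert c (rowc X j) - ?F \<Longrightarrow> y \<in> ?B' - insert c (rowc X j) \<Longrightarrow> x < y"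
    using step.IH s(1) unfolding step.hyps(3) down_rows[OF c] initial_ext_def by auto
  have "x < y" if "x \<in> rowc X j - ?F" "y \<in> ?B' - rowc X j" for x y
    using that IH(4)[of x y] s(2) by (cases "y = c") auto
  then show ?case using IH(1,3) matched_part_subset by (auto simp: initial_ext_def)
qed

subsection \<open>Extremal configurations and components\<close>

abbreviation box :: "nat \<Rightarrow> nat \<Rightarrow> config" where
  "box L n \<equiv> {1..L} \<times> {1..n}"

lemma finite_box: "X \<subseteq> box L n \<Longrightarrow> finite X"
  by (rule finite_subset) auto

lemma box_down:
  assumes "X \<subseteq> box L n" "1 \<le> j" "j < L"
  shows "down j X \<subseteq> box L n"
proof (cases "\<exists>c. peak (rowc X (Suc j)) (rowc X j) c")
  case True
  then obtain c where c: "peak (rowc X (Suc j)) (rowc X j) c" by blast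
  have "c \<in> rowc X (Suc j)"
    using peak_mem(1)[OF _ _ c] finite_Image_sing[OF finite_box[OF assms(1)]] by blast
  then show ?thesis using assms by (auto simp: down_peak[OF c])
qed (use assms in \<open>simp add: down_no_peak\<close>)

lemma box_right:
  assumes "X \<subseteq> box L n" "1 \<le> i" "i < n"
  shows "right i X \<subseteq> box L n"
proof (cases "\<exists>c. peak (col X i) (col X (Suc i)) c")
  case True
  then obtain c where c: "peak (col X i) (col X (Suc i)) c" by blast
  have "c \<in> col X i" using peak_mem(1)[OF _ _ c] finite_col[OF finite_box[OF assms(1)]] by blast
  then show ?thesis using assms by (auto simp: right_peak[OF c])
qed (use assms in \<open>simp add: right_no_peak\<close>)

lemma box_downs: "X \<subseteq> box L n \<Longrightarrow> set js \<subseteq> {1..<L} \<Longrightarrow> downs js X \<subseteq> box L n"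
proof (induction js)
  case (Cons j js)
  then show ?case using box_down[of "downs js X" L n j] by simp
qed simp

lemma box_rights: "X \<subseteq> box L n \<Longrightarrow> set is \<subseteq> {1..<n} \<Longrightarrow> rights is X \<subseteq> box L n"
proof (induction "is")
  case (Cons i "is")
  then show ?case using box_right[of "rights is X" L n i] by simp
qed simp

text \<open>Equivalently, no opening bracket \<open>i + 1\<close> of the row word is unmatched, so \<open>X\<close> is not in the
  image of a proper move of \<open>right i\<close>.\<close>

definition dominant :: "nat \<Rightarrow> config \<Rightarrow> bool" where
  "dominant i X \<longleftrightarrow> mxcol i X = int (card (col X i)) - int (card (col X (Suc i)))"

lemma dominant_downs: "finite X \<Longrightarrow> dominant i (downs js X) \<longleftrightarrow> dominant i X"
  by (simp add: dominant_def mxcol_downs card_col_downs)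

lemma dominant_iff:
  assumes "finite X"
  shows "dominant i X \<longleftrightarrow> (\<forall>r. hgt (col X i) (col X (Suc i)) r \<le> hgt (col X i) (col X (Suc i)) 0)"
  unfolding dominant_def mxcol_def hgt_0[symmetric]
  using mx_ge[of "col X i" "col X (Suc i)"] mx_eqI[of "col X i" "col X (Suc i)" _ 0] assms
  by (metis finite_col)

lemma not_dominant:
  assumes "finite X" "\<not> dominant i X"
  obtains r where "(r, Suc i) \<in> X" "(r, i) \<notin> X" "right i (insert (r, i) (X - {(r, Suc i)})) = X"
proof -
  obtain x where "hgt (col X i) (col X (Suc i)) 0 < hgt (col X i) (col X (Suc i)) x"
    using assms dominant_iff not_le by blast
  then obtain r where r: "r \<in> col X (Suc i)" "r \<notin> col X i"
    "peak (insert r (col X i)) (col X (Suc i) - {r}) r"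
    using peak_inverse[OF finite_col finite_col] assms(1) by metis
  let ?Y = "insert (r, i) (X - {(r, Suc i)})"
  have "col ?Y i = insert r (col X i)" "col ?Y (Suc i) = col X (Suc i) - {r}" by auto
  then have "peak (col ?Y i) (col ?Y (Suc i)) r" using r by simp
  then have "right i ?Y = insert (r, Suc i) (?Y - {(r, i)})" by (rule right_peak)
  also have "\<dots> = X" using r by auto
  finally show ?thesis using that r by blast
qed

lemma sum_move:
  fixes g :: "nat \<times> nat \<Rightarrow> nat"
  assumes "finite X" "x \<in> X" "y \<notin> X"
  shows "sum g (insert y (X - {x})) + g x = sum g X + g y"
  using assms sum.remove[of X x g] by simp

text \<open>Undoing a proper column move lowers the sum of all column indices, so the process stops,
  and it can only stop where nothing is left to undo.\<close>

lemma exists_dominant: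
  assumes "X \<subseteq> box L n"
  shows "\<exists>is Y. Y \<subseteq> box L n \<and> set is \<subseteq> {1..<n} \<and> X = rights is Y \<and> (\<forall>i\<in>{1..<n}. dominant i Y)"
  using assms
proof (induction "sum snd X" arbitrary: X rule: less_induct)
  case less
  note fin = finite_box[OF less.prems]
  show ?case
  proof (cases "\<forall>i\<in>{1..<n}. dominant i X")
    case True
    then show ?thesis using less.prems by (intro exI[of _ "[]"] exI[of _ X]) auto
  next
    case False
    then obtain i where i: "i \<in> {1..<n}" "\<not> dominant i X" by blast
    obtain r where r: "(r, Suc i) \<in> X" "(r, i) \<notin> X" "right i (insert (r, i) (X - {(r, Suc i)})) = X"
      using not_dominant[OF fin i(2)] by blast
    let ?Y = "insert (r, i) (X - {(r, Suc i)})"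
    have "sum snd ?Y < sum snd X" using sum_move[OF fin r(1,2), of snd] by simp
    moreover have "?Y \<subseteq> box L n" using less.prems r(1) i(1) by auto
    ultimately obtain "is" Z where Z: "Z \<subseteq> box L n" "set is \<subseteq> {1..<n}" "?Y = rights is Z"
      "\<forall>i\<in>{1..<n}. dominant i Z" using less.hyps[of ?Y] by (elim meta_impE exE conjE) (assumption | blast)+
    from Z(3) have "X = rights (i # is) Z" using r(3) by simp
    then show ?thesis using i(1) Z(1,2,4) by (intro exI[of _ "i # is"] exI[of _ Z]) simp
  qed
qed

lemma iterate_until_fixed:
  fixes f :: "'a \<Rightarrow> config \<Rightarrow> config" and g :: "config \<Rightarrow> nat"
  assumes "\<And>k X. X \<subseteq> B \<Longrightarrow> k \<in> K \<Longrightarrow> f k X \<subseteq> B"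
    and "\<And>k X. X \<subseteq> B \<Longrightarrow> k \<in> K \<Longrightarrow> f k X \<noteq> X \<Longrightarrow> g (f k X) < g X"
  shows "X \<subseteq> B \<Longrightarrow> \<exists>ks. set ks \<subseteq> K \<and> (\<forall>k\<in>K. f k (foldr f ks X) = foldr f ks X)"
proof (induction "g X" arbitrary: X rule: less_induct)
  case less
  show ?case
  proof (cases "\<forall>k\<in>K. f k X = X")
    case True
    then show ?thesis by (intro exI[of _ "[]"]) auto
  next
    case False
    then obtain k where k: "k \<in> K" "f k X \<noteq> X" by blast
    then obtain ks where "set ks \<subseteq> K" "\<forall>l\<in>K. f l (foldr f ks (f k X)) = foldr f ks (f k X)"
      using less assms by metis
    then show ?thesis using k by (intro exI[of _ "ks @ [k]"]) auto
  qed
qed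

lemma exists_right_fixed:
  assumes "X \<subseteq> box L n"
  shows "\<exists>is. set is \<subseteq> {1..<n} \<and> (\<forall>i\<in>{1..<n}. right i (rights is X) = rights is X)"
  unfolding rights_def
proof (rule iterate_until_fixed[where g = "sum (\<lambda>b. n - snd b)", OF _ _ assms])
  fix i X assume X: "X \<subseteq> box L n" and i: "i \<in> {1..<n}"
  show "right i X \<subseteq> box L n" using box_right[OF X, of i] i by simp
  assume "right i X \<noteq> X"
  then obtain r where r: "peak (col X i) (col X (Suc i)) r" using right_no_peak by blast
  note fin = finite_box[OF X] and fc = finite_col[OF finite_box[OF X]]
  have m: "(r, i) \<in> X" "(r, Suc i) \<notin> X" using peak_mem(1,2)[OF fc fc r] by auto
  show "sum (\<lambda>b. n - snd b) (right i X) < sum (\<lambda>b. n - snd b) X"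
    using sum_move[OF fin m, of "\<lambda>b. n - snd b"] i unfolding right_peak[OF r] snd_conv by auto
qed

lemma exists_down_fixed:
  assumes "X \<subseteq> box L n" "J \<subseteq> {1..<L}"
  shows "\<exists>js. set js \<subseteq> J \<and> (\<forall>j\<in>J. down j (downs js X) = downs js X)"
  unfolding downs_def
proof (rule iterate_until_fixed[where g = "sum fst", OF _ _ assms(1)])
  fix j X assume X: "X \<subseteq> box L n" and "j \<in> J"
  then have "1 \<le> j" "j < L" using assms(2) by auto
  then show "down j X \<subseteq> box L n" by (rule box_down[OF X])
  assume "down j X \<noteq> X"
  then obtain c where c: "peak (rowc X (Suc j)) (rowc X j) c" using down_no_peak by blast
  note fin = finite_box[OF X] and fr = finite_Image_sing[OF finite_box[OF X]]
  have m: "(Suc j, c) \<in> X" "(j, c) \<notin> X" using peak_mem(1,2)[OF fr fr c] by auto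
  show "sum fst (down j X) < sum fst X"
    using sum_move[OF fin m, of fst] by (simp add: down_peak[OF c])
qed

section \<open>Connectedness under column moves and the two extremal ends\<close>

definition sim :: "nat \<Rightarrow> config \<Rightarrow> config \<Rightarrow> bool" where
  "sim n = equivclp (\<lambda>X Y. \<exists>i\<in>{1..<n}. Y = right i X)"

lemma finite_right_iff: "finite (right i X) \<longleftrightarrow> finite X"
proof
  assume "finite (right i X)"
  then show "finite X"
    by (cases "\<exists>r. peak (col X i) (col X (Suc i)) r") (auto simp: right_peak right_no_peak)
qed (rule finite_right)

lemma sim_refl: "sim n X X"
  by (simp add: sim_def)

lemma sim_sym: "sim n X Y \<Longrightarrow> sim n Y X"
  unfolding sim_def by (rule equivclp_sym)

lemma sim_trans: "sim n X Y \<Longrightarrow> sim n Y Z \<Longrightarrow> sim n X Z"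
  unfolding sim_def by (rule equivclp_trans)

lemma sim_right: "i \<in> {1..<n} \<Longrightarrow> sim n X (right i X)"
  unfolding sim_def by (rule r_into_equivclp) auto

lemma sim_induct [consumes 2, case_names refl right left]:
  assumes "sim n X Y" "finite X" "P X"
    and "\<And>Y i. finite Y \<Longrightarrow> i \<in> {1..<n} \<Longrightarrow> P Y \<Longrightarrow> P (right i Y)"
    and "\<And>Y i. finite Y \<Longrightarrow> i \<in> {1..<n} \<Longrightarrow> P (right i Y) \<Longrightarrow> P Y"
  shows "P Y"
proof -
  have "finite Y \<and> P Y"
    using assms(1) unfolding sim_def
  proof (induction rule: equivclp_induct)
    case (step Y Z)
    then show ?case using assms(4,5) finite_right_iff by blast
  qed (use assms in auto)
  then show ?thesis ..
qed

lemma sim_invariant: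
  assumes "sim n X Y" "finite X" "\<And>X i. finite X \<Longrightarrow> F (right i X) = F X"
  shows "F Y = F X"
  using assms(1,2) by (induction rule: sim_induct) (use assms(3) in auto)

lemma sim_map:
  assumes "sim n X Y" "finite X" "\<And>X i. finite X \<Longrightarrow> G (right i X) = right i (G X)"
  shows "sim n (G X) (G Y)"
  using assms(1,2)
proof (induction rule: sim_induct)
  case (right Y i)
  then show ?case using sim_trans[OF _ sim_right[of i n "G Y"]] assms(3) by simp
next
  case (left Y i)
  then show ?case using sim_trans[OF _ sim_sym[OF sim_right[of i n "G Y"]]] assms(3) by simp
qed (rule sim_refl)

text \<open>Nesting and justification feed each other from the bottom row upwards: above a
  left-justified row, a ball over an empty cell would be unmatched, and nesting in turn lets
  dominance of two neighbouring columns exclude a gap.\<close>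

lemma extremal_left:
  assumes X: "X \<subseteq> box L n" and dom: "\<And>i. i \<in> {1..<n} \<Longrightarrow> dominant i X"
    and fixed: "\<And>j. 1 \<le> j \<Longrightarrow> j < m \<Longrightarrow> down j X = X"
    and r: "1 \<le> r" "r \<le> m"
  shows "(1 < r \<longrightarrow> rowc X r \<subseteq> rowc X (r - 1)) \<and> (\<forall>c c'. 1 \<le> c' \<longrightarrow> c' \<le> c \<longrightarrow> c \<in> rowc X r \<longrightarrow> c' \<in> rowc X r)"
  using r
proof (induction r rule: less_induct)
  case (less r)
  note fin = finite_box[OF X]
  have nest: "rowc X r \<subseteq> rowc X (r - 1)" if "1 < r"
  proof
    fix x assume x: "x \<in> rowc X r"
    have q: "r = Suc (r - 1)" "1 \<le> r - 1" using that by auto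
    define q where "q = r - 1"
    note q = q[folded q_def]
    have seg: "\<And>c c'. 1 \<le> c' \<Longrightarrow> c' \<le> c \<Longrightarrow> c \<in> rowc X q \<Longrightarrow> c' \<in> rowc X q"
      using less.IH[of q] less.prems q by auto
    show "x \<in> rowc X (r - 1)"
    proof (rule ccontr)
      assume "x \<notin> rowc X (r - 1)"
      moreover have "1 \<le> x" using x X by auto
      ultimately have "rowc X q \<inter> {x..} = {}" using seg[of x] by (auto simp: q_def)
      moreover have "0 < card (rowc X r \<inter> {x..})" using x fin by (auto simp: card_gt_0_iff finite_Image_sing)
      ultimately have "0 < hgt (rowc X (Suc q)) (rowc X q) x" by (simp add: hgt_def q)
      moreover have "hgt (rowc X (Suc q)) (rowc X q) x \<le> 0"
        using fixed[of q] less.prems q fin down_fixed_iff by auto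
      ultimately show False by simp
    qed
  qed
  have nests: "rowc X r \<subseteq> rowc X s" if "1 \<le> s" "s < r" for s
    using less_imp_le[OF that(2)] that
  proof (induction s rule: inc_induct)
    case (step s)
    have "rowc X (Suc s) \<subseteq> rowc X s"
      using less.IH[of "Suc s"] nest step less.prems by (cases "Suc s = r") auto
    then show ?case using step by (cases "Suc s = r") auto
  qed simp
  have step: "c \<in> rowc X r" if c: "1 \<le> c" "Suc c \<in> rowc X r" for c
  proof (rule ccontr)
    assume n: "c \<notin> rowc X r"
    have "Suc c \<le> n" using c X by auto
    \<comment> \<open>Nesting puts \<open>Suc c\<close> into each of the rows 1 to \<open>r\<close>,
      so up to row \<open>r\<close> column \<open>Suc c\<close> contains column \<open>c\<close>,
      strictly because of row \<open>r\<close>.\<close>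
    have sub: "col X c \<inter> {0..<Suc r} \<subset> col X (Suc c) \<inter> {0..<Suc r}"
    proof
      show "col X c \<inter> {0..<Suc r} \<subseteq> col X (Suc c) \<inter> {0..<Suc r}"
      proof
        fix s assume s: "s \<in> col X c \<inter> {0..<Suc r}"
        then have "s \<noteq> r" "1 \<le> s" using n X by auto
        then show "s \<in> col X (Suc c) \<inter> {0..<Suc r}" using nests[of s] s c by auto
      qed
      have "r \<in> col X (Suc c) \<inter> {0..<Suc r}" "r \<notin> col X c" using c n by auto
      then show "col X c \<inter> {0..<Suc r} \<noteq> col X (Suc c) \<inter> {0..<Suc r}" by blast
    qed
    have "card (col X c \<inter> {0..<Suc r}) < card (col X (Suc c) \<inter> {0..<Suc r})"
      using psubset_card_mono[OF _ sub] by simp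
    then have "hgt (col X c) (col X (Suc c)) 0 < hgt (col X c) (col X (Suc c)) (Suc r)"
      using hgt_split[OF finite_col[OF fin] finite_col[OF fin], of 0 "Suc r" c "Suc c"] by simp
    moreover have "hgt (col X c) (col X (Suc c)) (Suc r) \<le> hgt (col X c) (col X (Suc c)) 0"
      using dom[of c] \<open>Suc c \<le> n\<close> c dominant_iff[OF fin] by auto
    ultimately show False by simp
  qed
  have "1 \<le> c' \<Longrightarrow> c' \<le> c \<Longrightarrow> c \<in> rowc X r \<Longrightarrow> c' \<in> rowc X r" for c c'
  proof (induction "c - c'" arbitrary: c)
    case (Suc d)
    then obtain b where b: "c = Suc b" by (cases c) auto
    show ?case using Suc.hyps(1)[of b] Suc.hyps(2) Suc.prems step[of b] b by auto
  qed simp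
  then show ?case using nest by blast
qed

text \<open>The induction runs from the top row downwards, so only the row operators from
  \<open>m\<close> on are needed. A gap at \<open>Suc c\<close> in row \<open>r\<close> empties that
  column from \<open>r\<close> upwards by nesting, and the ball at \<open>(r, c)\<close> could still
  move right.\<close>

lemma extremal_right:
  assumes X: "X \<subseteq> box L n" and fixr: "\<And>i. i \<in> {1..<n} \<Longrightarrow> right i X = X"
    and fixed: "\<And>j. m \<le> j \<Longrightarrow> j < L \<Longrightarrow> down j X = X"
    and r: "m \<le> r" "r \<le> L"
  shows "(r < L \<longrightarrow> rowc X (Suc r) \<subseteq> rowc X r) \<and> (\<forall>c c'. c \<le> c' \<longrightarrow> c' \<le> n \<longrightarrow> c \<in> rowc X r \<longrightarrow> c' \<in> rowc X r)"
  using r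
proof (induction "L - r" arbitrary: r rule: less_induct)
  case less
  note fin = finite_box[OF X]
  have nest: "rowc X (Suc r) \<subseteq> rowc X r" if "r < L"
  proof
    fix x assume x: "x \<in> rowc X (Suc r)"
    have seg: "\<And>c c'. c \<le> c' \<Longrightarrow> c' \<le> n \<Longrightarrow> c \<in> rowc X (Suc r) \<Longrightarrow> c' \<in> rowc X (Suc r)"
      using less.hyps[of "Suc r"] less.prems that by auto
    show "x \<in> rowc X r"
    proof (rule ccontr)
      assume "x \<notin> rowc X r"
      then have "rowc X r \<inter> {x..} \<subset> rowc X (Suc r) \<inter> {x..}" using seg[of x] x X by auto
      then have "card (rowc X r \<inter> {x..}) < card (rowc X (Suc r) \<inter> {x..})"
        using psubset_card_mono fin by (meson finite_Image_sing finite_Int)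
      then have "0 < hgt (rowc X (Suc r)) (rowc X r) x" by (simp add: hgt_def)
      moreover have "hgt (rowc X (Suc r)) (rowc X r) x \<le> 0"
        using fixed[of r] less.prems that fin down_fixed_iff by auto
      ultimately show False by simp
    qed
  qed
  have nests: "rowc X s \<subseteq> rowc X r" if "r \<le> s" "s \<le> L" for s
    using that
  proof (induction s rule: dec_induct)
    case (step s)
    have "rowc X (Suc s) \<subseteq> rowc X s"
      using less.hyps[of s] nest step less.prems by (cases "s = r") auto
    then show ?case using step by auto
  qed simp
  have step: "Suc c \<in> rowc X r" if c: "c \<in> rowc X r" "Suc c \<le> n" for c
  proof (rule ccontr)
    assume n: "Suc c \<notin> rowc X r"
    have "col X (Suc c) \<inter> {r..} = {}" using nests n X by (force simp: Image_iff)
    moreover have "0 < card (col X c \<inter> {r..})" using c fin by (auto simp: card_gt_0_iff finite_Image_sing)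
    ultimately have "0 < hgt (col X c) (col X (Suc c)) r" by (simp add: hgt_def)
    moreover have "1 \<le> c" using c X by auto
    ultimately show False using fixr[of c] that right_fixed_iff[OF fin, of c] by (metis Suc_le_eq atLeastLessThan_iff not_le)
  qed
  have "c \<le> c' \<Longrightarrow> c' \<le> n \<Longrightarrow> c \<in> rowc X r \<Longrightarrow> c' \<in> rowc X r" for c c'
  proof (induction "c' - c" arbitrary: c')
    case (Suc d)
    then obtain b where b: "c' = Suc b" by (cases c') auto
    show ?case using Suc.hyps(1)[of b] Suc.hyps(2) Suc.prems step[of b] b by auto
  qed simp
  then show ?case using nest by blast
qed

lemma down_closed_eq:
  assumes "finite S" "0 \<notin> S" "\<And>s t. s \<in> S \<Longrightarrow> 1 \<le> t \<Longrightarrow> t \<le> s \<Longrightarrow> t \<in> S"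
  shows "S = {1..card S}"
proof (cases "S = {}")
  case False
  have "S = {1..Max S}"
  proof
    show "S \<subseteq> {1..Max S}" using assms(1,2) by (auto simp: Suc_le_eq intro!: Nat.gr0I)
    show "{1..Max S} \<subseteq> S" using assms(3)[OF Max_in[OF assms(1) False]] by auto
  qed
  moreover from this have "card S = Max S" by (metis card_atLeastAtMost diff_Suc_1)
  ultimately show ?thesis by metis
qed simp

lemma nested_determined:
  assumes "X \<subseteq> box L n" "Y \<subseteq> box L n"
    and "\<And>j. 1 \<le> j \<Longrightarrow> j < L \<Longrightarrow> rowc X (Suc j) \<subseteq> rowc X j"
    and "\<And>j. 1 \<le> j \<Longrightarrow> j < L \<Longrightarrow> rowc Y (Suc j) \<subseteq> rowc Y j"
    and "\<And>c. card (col X c) = card (col Y c)"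
  shows "X = Y"
proof -
  have *: "col X c = {1..card (col X c)}"
    if X: "X \<subseteq> box L n" and nest: "\<And>j. 1 \<le> j \<Longrightarrow> j < L \<Longrightarrow> rowc X (Suc j) \<subseteq> rowc X j" for X c
  proof (rule down_closed_eq)
    show "finite (col X c)" using finite_col finite_box[OF X] by blast
    show "0 \<notin> col X c" using X by auto
    fix s t :: nat assume "s \<in> col X c" "1 \<le> t" "t \<le> s"
    then show "t \<in> col X c"
    proof (induction "s - t" arbitrary: s)
      case (Suc d)
      then obtain b where b: "s = Suc b" by (cases s) auto
      have "b \<in> col X c" using nest[of b] Suc b X by force
      then show ?case using Suc.hyps(1)[of b] Suc.hyps(2) Suc.prems b by auto
    qed simp
  qed
  have "col X c = col Y c" for c using *[of X c] *[of Y c] assms by metis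
  then show ?thesis by (auto simp: set_eq_iff Image_iff)
qed

text \<open>The passage to the left end is made at \<open>X\<close>, before either word acts. Both
  results then come from one dominant \<open>Y\<close>, are nested, and have the column counts of
  \<open>Y\<close>.\<close>

lemma downs_fixed_unique:
  assumes X: "X \<subseteq> box L n" and v: "set v \<subseteq> {1..<L}" "set w \<subseteq> {1..<L}"
    and fixed: "\<And>j. j \<in> {1..<L} \<Longrightarrow> down j (downs v X) = downs v X"
      "\<And>j. j \<in> {1..<L} \<Longrightarrow> down j (downs w X) = downs w X"
  shows "downs v X = downs w X"
proof -
  obtain "is" Y where Y: "Y \<subseteq> box L n" "set is \<subseteq> {1..<n}" "X = rights is Y" "\<forall>i\<in>{1..<n}. dominant i Y"
    using exists_dominant[OF X] by blast
  note fin = finite_box[OF Y(1)]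
  have nest: "rowc (downs u Y) (Suc j) \<subseteq> rowc (downs u Y) j"
    if "set u \<subseteq> {1..<L}" "\<And>j. j \<in> {1..<L} \<Longrightarrow> down j (downs u X) = downs u X" "1 \<le> j" "j < L" for u j
  proof -
    have "down j (downs u Y) = downs u Y" if "1 \<le> j" "j < L" for j
      using that \<open>\<And>j. j \<in> {1..<L} \<Longrightarrow> down j (downs u X) = downs u X\<close>[of j]
      by (simp add: Y(3) downs_rights fin down_rights_fixed_iff finite_downs)
    then show ?thesis
      using extremal_left[of "downs u Y" L n L "Suc j"] box_downs[OF Y(1) that(1)] Y(4) that(3,4)
      by (auto simp: dominant_downs fin)
  qed
  have "downs v Y = downs w Y"
  proof (rule nested_determined)
    show "downs v Y \<subseteq> box L n" "downs w Y \<subseteq> box L n" using box_downs Y(1) v by blast+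
  qed (use nest[OF v(1) fixed(1)] nest[OF v(2) fixed(2)] in \<open>auto simp: card_col_downs fin\<close>)
  then show ?thesis by (simp add: Y(3) downs_rights fin)
qed

subsection \<open>Collapsing configurations\<close>

primrec coll :: "config \<Rightarrow> nat \<Rightarrow> config" where
  "coll X 0 = X"
| "coll X (Suc i) = foldr star [1..<Suc i] (coll X i)"

lemma finite_foldr_star: "finite X \<Longrightarrow> finite (foldr star js X)"
  by (induction js) (auto simp: finite_star)

lemma foldr_star_right: "finite X \<Longrightarrow> foldr star js (right i X) = right i (foldr star js X)"
  by (induction js) (auto simp: star_right finite_foldr_star)

lemma finite_coll: "finite X \<Longrightarrow> finite (coll X k)"
  by (induction k) (simp_all add: finite_foldr_star del: upt_Suc)

lemma coll_right: "finite X \<Longrightarrow> coll (right i X) k = right i (coll X k)"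
  by (induction k) (simp_all add: foldr_star_right finite_coll del: upt_Suc)

lemma coll_rights: "finite X \<Longrightarrow> coll (rights is X) k = rights is (coll X k)"
  by (induction "is") (simp_all add: coll_right finite_rights)

lemma foldr_star_downs: "\<exists>v. set v \<subseteq> set js \<and> foldr star js X = downs v X"
proof (induction js)
  case (Cons j js)
  then obtain v where v: "set v \<subseteq> set js" "foldr star js X = downs v X" by blast
  have "foldr star (j # js) X = downs (replicate (nat (mxrow j (downs v X))) j @ v) X"
    by (simp add: v(2)) (simp add: star_def)
  moreover have "set (replicate (nat (mxrow j (downs v X))) j @ v) \<subseteq> set (j # js)" using v(1) by auto
  ultimately show ?case by blast
qed (auto intro: exI[of _ "[]"])

lemma coll_downs: "\<exists>v. set v \<subseteq> {1..<i} \<and> coll X i = downs v X"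
proof (induction i)
  case (Suc i)
  then obtain v where v: "set v \<subseteq> {1..<i}" "coll X i = downs v X" by blast
  obtain w where w: "set w \<subseteq> set [1..<Suc i]" "foldr star [1..<Suc i] (downs v X) = downs w (downs v X)"
    using foldr_star_downs by blast
  have "set (w @ v) \<subseteq> {1..<Suc i}" using v(1) w(1) by (auto simp del: upt_Suc)
  moreover have "coll X (Suc i) = downs (w @ v) X" using v(2) w(2) by (simp del: upt_Suc)
  ultimately show ?case by blast
qed (auto intro: exI[of _ "[]"])

text \<open>Gravity: rows 1 to \<open>i\<close> form justified stacks, and the balls of
  \<open>B\<close> fall, row by row, onto the stacks in their columns. At stage \<open>m\<close>,
  row \<open>m\<close> also carries the balls that are still falling. \<open>Zp\<close> is empty
  above \<open>i\<close> because row \<open>i + 1\<close> holds nothing but the falling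
  balls.\<close>

lemma foldr_star_rows:
  assumes Z: "Z \<subseteq> box L n"
    and nest: "\<And>r. 1 < r \<Longrightarrow> r \<le> i \<Longrightarrow> rowc Z r \<subseteq> rowc Z (r - 1)"
    and seg: "\<And>r c c'. 1 \<le> r \<Longrightarrow> r \<le> i \<Longrightarrow> 1 \<le> c' \<Longrightarrow> c' \<le> c \<Longrightarrow> c \<in> rowc Z r \<Longrightarrow> c' \<in> rowc Z r"
    and m: "m \<le> Suc i" "1 \<le> m"
  defines "Zp \<equiv> \<lambda>r. if r \<le> i then rowc Z r else {}" and "B \<equiv> rowc Z (Suc i)"
  shows "rowc (foldr star [m..<Suc i] Z) r = (if r = m then Zp m \<union> B
    else if m < r \<and> r \<le> Suc i then (Zp r \<union> B) \<inter> rowc Z (r - 1) else rowc Z r)"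
  using m
proof (induction m arbitrary: r rule: inc_induct)
  case base
  then show ?case by (auto simp: Zp_def B_def)
next
  case (step m)
  define W where "W = foldr star [Suc m..<Suc i] Z"
  have W: "foldr star [m..<Suc i] Z = star m W"
    unfolding W_def using step.hyps by (subst upt_conv_Cons) (auto simp del: upt_Suc)
  note IH = step.IH[OF le_SucI[OF step.prems], folded W_def]
  have r1: "rowc W (Suc m) = Zp (Suc m) \<union> B" and r2: "rowc W m = rowc Z m"
    using IH[of "Suc m"] IH[of m] by auto
  have Zm: "rowc Z m = Zp m" "Zp (Suc m) \<subseteq> Zp m"
    using step.hyps step.prems nest[of "Suc m"] by (auto simp: Zp_def)
  have pos: "\<And>x. x \<in> Zp (Suc m) \<union> B \<Longrightarrow> 1 \<le> x" using Z by (auto simp: Zp_def B_def split: if_splits)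
  have "finite W" unfolding W_def using finite_foldr_star finite_box[OF Z] by blast
  \<comment> \<open>The premise is contradictory: row \<open>m\<close> is left-justified, so right
    of one of its empty cells there is no ball.\<close>
  moreover have "y \<in> rowc W (Suc m)"
    if "x \<in> rowc W (Suc m) - rowc W m" "y \<in> rowc W m" "x < y" for x y
    using seg[of m x y] that step.prems step.hyps pos[of x] by (simp add: r1 r2)
  ultimately have *: "rowc (star m W) (Suc m) = rowc W (Suc m) \<inter> rowc W m \<and>
    rowc (star m W) m = rowc W (Suc m) \<union> rowc W m" by (rule star_rows_drop)
  consider "r = m" | "r = Suc m" | "r \<noteq> m" "r \<noteq> Suc m" by blast
  then show ?case
  proof cases
    case 1
    then show ?thesis unfolding \<open>foldr star [m..<Suc i] Z = star m W\<close> using * r1 r2 Zm by auto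
  next
    case 2
    then show ?thesis unfolding \<open>foldr star [m..<Suc i] Z = star m W\<close> using * r1 r2 Zm step.hyps by auto
  next
    case 3
    then have "rowc (star m W) r = rowc W r" by (simp add: star_row_other)
    then show ?thesis unfolding \<open>foldr star [m..<Suc i] Z = star m W\<close> using 3 IH[of r] by auto
  qed
qed

text \<open>At the left end, step \<open>i\<close> lets row \<open>i\<close> fall onto justified
  stacks, and each ball lands on top of the stack in its own column. So the newly occupied cells
  show the columns of row \<open>i\<close> of \<open>X\<close>; this clause later recovers
  \<open>X\<close> from the recorded shapes.\<close>

lemma coll_dominant:
  assumes X: "X \<subseteq> box L n" and dom: "\<And>i. i \<in> {1..<n} \<Longrightarrow> dominant i X"
    and "1 \<le> i" "i \<le> L"
  shows "(\<forall>j. 1 \<le> j \<longrightarrow> j < i \<longrightarrow> down j (coll X i) = coll X i) \<and> (\<forall>r>i. rowc (coll X i) r = rowc X r) \<and>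
    (1 < i \<longrightarrow> (\<forall>r\<in>{1..<i}. rowc (coll X (i - 1)) r \<subseteq> rowc (coll X i) r) \<and>
      rowc X i = (\<Union>r\<in>{1..i}. rowc (coll X i) r - (if r < i then rowc (coll X (i - 1)) r else {})))"
  using assms(3,4)
proof (induction i rule: nat_induct_at_least)
  case base
  then show ?case by simp
next
  case (Suc i)
  let ?Z = "coll X i" and ?W = "coll X (Suc i)"
  let ?U = "\<Union>r\<in>{1..Suc i}. rowc ?W r - (if r < Suc i then rowc ?Z r else {})"
  note finX = finite_box[OF X]
  obtain v where v: "set v \<subseteq> {1..<i}" "?Z = downs v X" using coll_downs by blast
  have Z: "?Z \<subseteq> box L n" unfolding v(2) using v(1) Suc.prems by (intro box_downs[OF X]) auto
  note finZ = finite_box[OF Z]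
  have domZ: "\<And>i. i \<in> {1..<n} \<Longrightarrow> dominant i ?Z" unfolding v(2) using dom dominant_downs[OF finX] by blast
  have fixed: "\<And>j. 1 \<le> j \<Longrightarrow> j < i \<Longrightarrow> down j ?Z = ?Z" and above: "\<And>r. i < r \<Longrightarrow> rowc ?Z r = rowc X r"
    using Suc by auto
  note ext = extremal_left[where m = i, OF Z domZ fixed]
  have nest: "rowc ?Z r \<subseteq> rowc ?Z (r - 1)" if "1 < r" "r \<le> i" for r
    using ext[of r] that by auto
  have seg: "c' \<in> rowc ?Z r" if "1 \<le> r" "r \<le> i" "1 \<le> c'" "c' \<le> c" "c \<in> rowc ?Z r" for r c c'
    using ext[of r] that by blast
  let ?Zp = "\<lambda>r. if r \<le> i then rowc ?Z r else {}" and ?B = "rowc X (Suc i)"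
  have W: "rowc ?W r = (if r = 1 then ?Zp 1 \<union> ?B
    else if 1 < r \<and> r \<le> Suc i then (?Zp r \<union> ?B) \<inter> rowc ?Z (r - 1) else rowc ?Z r)" for r
    using foldr_star_rows[where i = i and m = 1 and r = r, OF Z nest seg] above[of "Suc i"] Suc.hyps by (simp del: upt_Suc)
  have finW: "finite ?W" using finite_coll[OF finX] .
  have "rowc ?W (Suc j) \<subseteq> rowc ?W j" if "1 \<le> j" "j < Suc i" for j
  proof -
    have "rowc ?W (Suc j) \<subseteq> rowc ?Z j" using that by (simp add: W del: coll.simps)
    also have "\<dots> \<subseteq> rowc ?W j" using that nest[of j] by (auto simp: W simp del: coll.simps)
    finally show ?thesis .
  qed
  then have "down j ?W = ?W" if "1 \<le> j" "j < Suc i" for j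
    using that down_fixed_iff[OF finW, of j] hgt_subset_le[OF finite_Image_sing[OF finW], of "rowc ?W (Suc j)" j]
    by (simp del: coll.simps)
  moreover have "rowc ?W r = rowc X r" if "Suc i < r" for r
    using that above by (simp add: W del: coll.simps)
  moreover have "rowc ?Z r \<subseteq> rowc ?W r" if "r \<in> {1..<Suc i}" for r
    using that nest[of r] by (auto simp: W simp del: coll.simps)
  moreover have "?B = ?U"
  proof
    show "?U \<subseteq> ?B"
      by (auto simp: W simp del: coll.simps split: if_splits)
    show "?B \<subseteq> ?U"
    proof
      fix x assume x: "x \<in> ?B"
      \<comment> \<open>The landing row of \<open>x\<close>: the first row which the stack in its
        column does not reach. Row \<open>Suc i\<close> always qualifies, as \<open>?Zp\<close> is
        empty there.\<close>
      define s where "s = (LEAST r. 1 \<le> r \<and> x \<notin> ?Zp r)"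
      have "1 \<le> Suc i \<and> x \<notin> ?Zp (Suc i)" by simp
      then have s: "1 \<le> s \<and> x \<notin> ?Zp s" and "s \<le> Suc i"
        unfolding s_def by (rule LeastI, rule Least_le)
      moreover have "x \<in> rowc ?W s"
      proof (cases "s = 1")
        case False
        then have "\<not> (1 \<le> s - 1 \<and> x \<notin> ?Zp (s - 1))"
          using not_less_Least[of "s - 1" "\<lambda>r. 1 \<le> r \<and> x \<notin> ?Zp r"] s s_def by auto
        then have "x \<in> rowc ?Z (s - 1)" using s False \<open>s \<le> Suc i\<close> by (auto split: if_splits)
        then show ?thesis using x s False \<open>s \<le> Suc i\<close> by (auto simp: W simp del: coll.simps)
      qed (use x in \<open>simp add: W del: coll.simps\<close>)
      ultimately show "x \<in> ?U"
        by (auto simp: less_Suc_eq_le)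
    qed
  qed
  ultimately show ?case unfolding diff_Suc_1 using Suc.hyps by (simp del: coll.simps)
qed

lemma coll_fixed:
  assumes X: "X \<subseteq> box L n" and "1 \<le> j" "j < L"
  shows "down j (coll X L) = coll X L"
proof -
  obtain "is" Y where Y: "Y \<subseteq> box L n" "set is \<subseteq> {1..<n}" "X = rights is Y" "\<forall>i\<in>{1..<n}. dominant i Y"
    using exists_dominant[OF X] by blast
  note fin = finite_box[OF Y(1)]
  have "down j (coll Y L) = coll Y L" using coll_dominant[OF Y(1), of L] Y(4) assms by simp
  then show ?thesis by (simp add: Y(3) coll_rights fin down_rights_fixed_iff finite_coll)
qed

text \<open>Left-justified rows are known from their sizes, and the cells gained in step
  \<open>i\<close> have exactly the columns of row \<open>i\<close> of the original
  configuration.\<close>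

lemma dominant_determined:
  assumes X: "X \<subseteq> box L n" "\<And>i. i \<in> {1..<n} \<Longrightarrow> dominant i X"
    and Y: "Y \<subseteq> box L n" "\<And>i. i \<in> {1..<n} \<Longrightarrow> dominant i Y"
    and card: "\<And>i j. 1 \<le> j \<Longrightarrow> j \<le> i \<Longrightarrow> i \<le> L \<Longrightarrow> card (rowc (coll X i) j) = card (rowc (coll Y i) j)"
  shows "X = Y"
proof -
  have seg: "rowc (coll X i) j = {1..card (rowc (coll X i) j)}"
    if X: "X \<subseteq> box L n" "\<And>i. i \<in> {1..<n} \<Longrightarrow> dominant i X" and ij: "1 \<le> j" "j \<le> i" "i \<le> L" for X i j
  proof (rule down_closed_eq)
    obtain v where v: "set v \<subseteq> {1..<i}" "coll X i = downs v X" using coll_downs by blast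
    have Z: "coll X i \<subseteq> box L n" unfolding v(2) using v(1) ij by (intro box_downs[OF X(1)]) auto
    have dom: "\<And>k. k \<in> {1..<n} \<Longrightarrow> dominant k (coll X i)"
      unfolding v(2) using X(2) dominant_downs[OF finite_box[OF X(1)]] by blast
    have fixed: "\<And>k. 1 \<le> k \<Longrightarrow> k < i \<Longrightarrow> down k (coll X i) = coll X i"
      using coll_dominant[OF X, of i] ij by auto
    show "finite (rowc (coll X i) j)" using finite_Image_sing[OF finite_box[OF Z]] .
    show "0 \<notin> rowc (coll X i) j" using Z by auto
    show "t \<in> rowc (coll X i) j" if "s \<in> rowc (coll X i) j" "1 \<le> t" "t \<le> s" for s t
      using extremal_left[where m = i and r = j, OF Z dom fixed] ij that by blast
  qed
  have eq: "rowc (coll X i) j = rowc (coll Y i) j" if "1 \<le> j" "j \<le> i" "i \<le> L" for i j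
    using seg[OF X that] seg[OF Y that] card[OF that] by simp
  have "rowc X i = rowc Y i" if i: "1 \<le> i" "i \<le> L" for i
  proof (cases "i = 1")
    case True
    then show ?thesis using eq[of 1 1] i by simp
  next
    case False
    have "rowc (coll X (i - 1)) r = rowc (coll Y (i - 1)) r" if "1 \<le> r" "r < i" for r
      using eq[of r "i - 1"] that i by auto
    then have "(\<Union>r\<in>{1..i}. rowc (coll X i) r - (if r < i then rowc (coll X (i - 1)) r else {})) =
      (\<Union>r\<in>{1..i}. rowc (coll Y i) r - (if r < i then rowc (coll Y (i - 1)) r else {}))"
      using eq[of _ i] i by (intro SUP_cong) auto
    then show ?thesis using coll_dominant[OF X i] coll_dominant[OF Y i] False i by simp
  qed
  then show ?thesis using X(1) Y(1) by (auto simp: set_eq_iff Image_iff)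
qed

text \<open>When the rows above the first one are already nonwrapping, a single sweep from the bottom to
  the top suffices to make the whole configuration nonwrapping.\<close>

primrec up :: "config \<Rightarrow> nat \<Rightarrow> config" where
  "up X 0 = X"
| "up X (Suc m) = star (Suc m) (up X m)"

lemma finite_up: "finite X \<Longrightarrow> finite (up X m)"
  by (induction m) (simp_all add: finite_star)

lemma up_right: "finite X \<Longrightarrow> up (right i X) m = right i (up X m)"
  by (induction m) (simp_all add: star_right finite_up)

lemma up_rights: "finite X \<Longrightarrow> up (rights is X) m = rights is (up X m)"
  by (induction "is") (simp_all add: up_right finite_rights)

lemma up_downs: "\<exists>v. set v \<subseteq> {1..m} \<and> up X m = downs v X"
proof (induction m)
  case (Suc m)
  then obtain v where "set v \<subseteq> {1..m}" "up X m = downs v X" by blast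
  then show ?case
    by (intro exI[of _ "replicate (nat (mxrow (Suc m) (downs v X))) (Suc m) @ v"]) (auto simp: star_def)
qed (auto intro: exI[of _ "[]"])

lemma up_row_above: "Suc m < r \<Longrightarrow> rowc (up X m) r = rowc X r"
  by (induction m) (auto simp: star_row_other)

lemma up_row_below: "m \<le> k \<Longrightarrow> 1 \<le> m \<Longrightarrow> rowc (up X k) m = rowc (up X m) m"
  by (induction k rule: dec_induct) (auto simp: star_row_other)

text \<open>With right-justified nested upper rows, the sweep lowers by one each stack that stands
  over an empty cell of row 1 and leaves the other stacks alone. Setting \<open>K 1 = UNIV\<close>
  lets the formula include the bottom row.\<close>

lemma up_rows:
  assumes X: "X \<subseteq> box L n"
    and nest: "\<And>r. 2 \<le> r \<Longrightarrow> r < L \<Longrightarrow> rowc X (Suc r) \<subseteq> rowc X r"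
    and seg: "\<And>r c c'. 2 \<le> r \<Longrightarrow> r \<le> L \<Longrightarrow> c \<le> c' \<Longrightarrow> c' \<le> n \<Longrightarrow> c \<in> rowc X r \<Longrightarrow> c' \<in> rowc X r"
  defines "C \<equiv> rowc X 1" and "K \<equiv> \<lambda>r. if r = 1 then UNIV else rowc X r"
  shows "m < L \<Longrightarrow> (\<forall>r. 1 \<le> r \<longrightarrow> r \<le> m \<longrightarrow> rowc (up X m) r = (C \<inter> K r) \<union> K (Suc r)) \<and>
    rowc (up X m) (Suc m) = C \<inter> K (Suc m)"
proof (induction m)
  case 0
  then show ?case by (simp add: C_def K_def)
next
  case (Suc m)
  let ?Y = "up X m"
  have IH: "\<And>r. 1 \<le> r \<Longrightarrow> r \<le> m \<Longrightarrow> rowc ?Y r = (C \<inter> K r) \<union> K (Suc r)"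
    "rowc ?Y (Suc m) = C \<inter> K (Suc m)" using Suc by auto
  have A: "rowc ?Y (Suc (Suc m)) = K (Suc (Suc m))" by (simp add: up_row_above K_def)
  have C: "C \<subseteq> {1..n}" using X by (auto simp: C_def)
  \<comment> \<open>Here right-justification supplies the upper ball over \<open>y\<close> that
    dropping requires.\<close>
  have "y \<in> rowc ?Y (Suc (Suc m))"
    if "x \<in> rowc ?Y (Suc (Suc m)) - rowc ?Y (Suc m)" "y \<in> rowc ?Y (Suc m)" "x < y" for x y
    using seg[of "Suc (Suc m)" x y] that Suc.prems C by (auto simp: A IH(2) K_def)
  with finite_up[OF finite_box[OF X]]
  have *: "rowc (star (Suc m) ?Y) (Suc (Suc m)) = rowc ?Y (Suc (Suc m)) \<inter> rowc ?Y (Suc m) \<and>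
    rowc (star (Suc m) ?Y) (Suc m) = rowc ?Y (Suc (Suc m)) \<union> rowc ?Y (Suc m)" by (rule star_rows_drop)
  have "K (Suc (Suc m)) \<subseteq> K (Suc m)" using nest[of "Suc m"] Suc.prems by (auto simp: K_def)
  then have "rowc (up X (Suc m)) (Suc (Suc m)) = C \<inter> K (Suc (Suc m))" using * A IH(2) by auto
  moreover have "rowc (up X (Suc m)) r = (C \<inter> K r) \<union> K (Suc r)" if "1 \<le> r" "r \<le> Suc m" for r
  proof (cases "r = Suc m")
    case True
    then show ?thesis using * A IH(2) by auto
  next
    case False
    then show ?thesis using IH(1)[of r] that by (simp add: star_row_other)
  qed
  ultimately show ?case by blast
qed

text \<open>Fixedness under row operators is insensitive to column moves, so it suffices to look at
  the right end, where \<open>up_rows\<close> shows that the resulting rows are nested.\<close>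

lemma up_fixed:
  assumes X: "X \<subseteq> box L n" and fixed: "\<And>j. 2 \<le> j \<Longrightarrow> j < L \<Longrightarrow> down j X = X" and j: "1 \<le> j" "j < L"
  shows "down j (up X (L - 1)) = up X (L - 1)"
proof -
  note finX = finite_box[OF X]
  obtain "is" where "is": "set is \<subseteq> {1..<n}" "\<forall>i\<in>{1..<n}. right i (rights is X) = rights is X"
    using exists_right_fixed[OF X] by blast
  let ?Y = "rights is X"
  have Y: "?Y \<subseteq> box L n" using box_rights[OF X "is"(1)] .
  have fY: "down j ?Y = ?Y" if "2 \<le> j" "j < L" for j
    using fixed[OF that] down_rights_fixed_iff[OF finX] by simp
  have ext: "(r < L \<longrightarrow> rowc ?Y (Suc r) \<subseteq> rowc ?Y r) \<and>
    (\<forall>c c'. c \<le> c' \<longrightarrow> c' \<le> n \<longrightarrow> c \<in> rowc ?Y r \<longrightarrow> c' \<in> rowc ?Y r)" if "2 \<le> r" "r \<le> L" for r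
    using extremal_right[OF Y _ fY that] "is"(2) by blast
  have rows: "(\<forall>r. 1 \<le> r \<longrightarrow> r \<le> L - 1 \<longrightarrow>
      rowc (up ?Y (L - 1)) r = (rowc ?Y 1 \<inter> (if r = 1 then UNIV else rowc ?Y r)) \<union> rowc ?Y (Suc r)) \<and>
    rowc (up ?Y (L - 1)) (Suc (L - 1)) = rowc ?Y 1 \<inter> (if L = 1 then UNIV else rowc ?Y (Suc (L - 1)))"
    using up_rows[OF Y, of "L - 1"] ext j by (auto simp: le_diff_conv2)
  have "rowc (up ?Y (L - 1)) (Suc j) \<subseteq> rowc ?Y (Suc j)"
  proof (cases "Suc j = L")
    case True
    then show ?thesis using rows j by auto
  next
    case False
    then have "rowc (up ?Y (L - 1)) (Suc j) = (rowc ?Y 1 \<inter> rowc ?Y (Suc j)) \<union> rowc ?Y (Suc (Suc j))"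
      using rows j by auto
    then show ?thesis using ext[of "Suc j"] j False by auto
  qed
  also have "\<dots> \<subseteq> rowc (up ?Y (L - 1)) j" using rows j by auto
  finally have "down j (up ?Y (L - 1)) = up ?Y (L - 1)"
    using down_fixed_iff finite_up[OF finite_box[OF Y]] hgt_subset_le finite_Image_sing by metis
  then show ?thesis using finX by (simp add: up_rights down_rights_fixed_iff finite_up)
qed

text \<open>Row \<open>m\<close> is touched for the last time in step \<open>m\<close> of the sweep,
  so \<open>star_initial_ext\<close> for that step already speaks about the final row.\<close>

lemma up_initial_ext:
  assumes "finite X" "1 \<le> m" "m < L"
  shows "initial_ext (matched_part (rowc (up X m) (Suc m)) (rowc (up X (L - 1)) m))
    (rowc (up X (L - 1)) m) (rowc (up X (m - 1)) m)"
proof -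
  have "up X m = star m (up X (m - 1))" using assms(2) by (cases m) auto
  moreover have "rowc (up X (L - 1)) m = rowc (up X m) m" using up_row_below[of m "L - 1"] assms by simp
  ultimately show ?thesis using star_initial_ext[OF finite_up[OF assms(1), of "m - 1"], of m] by simp
qed

section \<open>Initial extensions under matching\<close>

lemma matched_part_iff:
  assumes "finite A" "finite B"
  shows "c \<in> matched_part A B \<longleftrightarrow> c \<in> B \<and> (\<exists>a\<le>c. card (B \<inter> {a..<Suc c}) \<le> card (A \<inter> {a..<Suc c}))"
proof -
  have "hgt A B (Suc c) \<le> hgt A B a \<longleftrightarrow> card (B \<inter> {a..<Suc c}) \<le> card (A \<inter> {a..<Suc c})" if "a \<le> c" for a
    using hgt_split[OF assms, of a "Suc c"] that by simp
  then show ?thesis by (auto simp only: matched_part_def)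
qed

lemma matched_part_mono:
  assumes "finite V" "finite B" "W \<subseteq> V"
  shows "matched_part W B \<subseteq> matched_part V B"
proof
  fix c assume "c \<in> matched_part W B"
  then obtain a where a: "c \<in> B" "a \<le> c" "card (B \<inter> {a..<Suc c}) \<le> card (W \<inter> {a..<Suc c})"
    using matched_part_iff assms finite_subset by metis
  have "card (W \<inter> {a..<Suc c}) \<le> card (V \<inter> {a..<Suc c})" using assms by (intro card_mono) auto
  then show "c \<in> matched_part V B" using a matched_part_iff[OF assms(1,2)] by (meson order_trans)
qed

text \<open>Suppose \<open>y < x\<close>, where \<open>y\<close> needs \<open>V\<close> beyond
  \<open>E\<close> and \<open>x\<close> needs \<open>E\<close> beyond \<open>W\<close>. A window for
  \<open>y\<close> contains some \<open>v \<in> V - E\<close>, so all of \<open>E - W\<close> lies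
  left of \<open>y\<close>. A window for \<open>x\<close> contains a ball of \<open>E - W\<close>
  and hence starts before \<open>y\<close>. Up to \<open>y\<close> it has too few balls of
  \<open>E\<close>, so the part after \<open>y\<close> suffices for \<open>x\<close>; but there
  \<open>E\<close> and \<open>W\<close> agree, and \<open>x\<close> would be matched by
  \<open>W\<close>.\<close>

lemma initial_ext_matched_part:
  assumes ext: "initial_ext W V E" and fin: "finite V" "finite B"
  shows "initial_ext (matched_part W B) (matched_part V B) (matched_part E B)"
proof -
  have sub: "W \<subseteq> E" "E \<subseteq> V" and lt: "\<And>x y. x \<in> E - W \<Longrightarrow> y \<in> V - E \<Longrightarrow> x < y"
    using ext by (auto simp: initial_ext_def)
  have finE: "finite E" and finW: "finite W" using sub fin by (auto dest: finite_subset)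
  have "x < y" if x: "x \<in> matched_part E B - matched_part W B" and y: "y \<in> matched_part V B - matched_part E B" for x y
  proof (rule ccontr)
    assume "\<not> x < y"
    then have yx: "y < x" using x y by (metis DiffD1 DiffD2 linorder_neqE_nat)
    note mV = matched_part_iff[OF fin(1,2)] and mE = matched_part_iff[OF finE fin(2)]
      and mW = matched_part_iff[OF finW fin(2)]
    have yE: "card (E \<inter> {a..<Suc y}) < card (B \<inter> {a..<Suc y})" if "a \<le> y" for a
      using y that unfolding Diff_iff mV mE by (meson not_le)
    have xW: "card (W \<inter> {a..<Suc x}) < card (B \<inter> {a..<Suc x})" if "a \<le> x" for a
      using x that unfolding Diff_iff mW mE by (meson not_le)
    obtain a where a: "a \<le> y" "card (B \<inter> {a..<Suc y}) \<le> card (V \<inter> {a..<Suc y})"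
      using y unfolding Diff_iff mV by blast
    have "\<not> V \<inter> {a..<Suc y} \<subseteq> E \<inter> {a..<Suc y}"
      using yE[OF a(1)] a(2) card_mono[of "E \<inter> {a..<Suc y}" "V \<inter> {a..<Suc y}"] finE by auto
    then obtain v where "v \<in> V \<inter> {a..<Suc y}" "v \<notin> E \<inter> {a..<Suc y}" by blast
    then have v: "v \<in> V - E" "v \<le> y" by auto
    then have lty: "\<And>e. e \<in> E - W \<Longrightarrow> e < y" using lt by (meson order_less_le_trans)
    obtain b where b: "b \<le> x" "card (B \<inter> {b..<Suc x}) \<le> card (E \<inter> {b..<Suc x})"
      using x unfolding Diff_iff mE by blast
    have "\<not> E \<inter> {b..<Suc x} \<subseteq> W \<inter> {b..<Suc x}"
      using xW[OF b(1)] b(2) card_mono[of "W \<inter> {b..<Suc x}" "E \<inter> {b..<Suc x}"] finW by auto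
    then obtain e where "e \<in> E \<inter> {b..<Suc x}" "e \<notin> W \<inter> {b..<Suc x}" by blast
    then have e: "e \<in> E - W" "b \<le> e" by auto
    then have "b \<le> y" using lty by (meson less_imp_le order_trans)
    have split: "card (A \<inter> {b..<Suc x}) = card (A \<inter> {b..<Suc y}) + card (A \<inter> {Suc y..<Suc x})" if "finite A" for A :: "nat set"
    proof -
      have "A \<inter> {b..<Suc x} = (A \<inter> {b..<Suc y}) \<union> (A \<inter> {Suc y..<Suc x})" using \<open>b \<le> y\<close> yx by auto
      then show ?thesis using that by (simp add: card_Un_disjoint disjoint_iff)
    qed
    have "card (B \<inter> {Suc y..<Suc x}) \<le> card (E \<inter> {Suc y..<Suc x})"
      using b(2) yE[OF \<open>b \<le> y\<close>] split[OF fin(2)] split[OF finE] by linarith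
    moreover have "E \<inter> {Suc y..<Suc x} = W \<inter> {Suc y..<Suc x}" using lty sub(1) by force
    ultimately show False using xW[of "Suc y"] yx by simp
  qed
  then show ?thesis
    using matched_part_mono[OF finE fin(2) sub(1)] matched_part_mono[OF fin sub(2)]
    by (simp add: initial_ext_def)
qed

lemma initial_ext_unique:
  assumes "initial_ext W V E" "initial_ext W V E'" "finite V" "card E = card E'"
  shows "E = E'"
proof (rule ccontr)
  assume ne: "E \<noteq> E'"
  have fin: "finite E" "finite E'" using assms(1-3) finite_subset[of _ V] by (simp_all add: initial_ext_def)
  have "\<not> E \<subseteq> E'" "\<not> E' \<subseteq> E" using ne assms(4) fin card_subset_eq by metis+
  then obtain x y where "x \<in> E - E'" "y \<in> E' - E" by blast
  then have "x < y" "y < x" using assms(1,2) unfolding initial_ext_def by blast+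
  then show False by simp
qed

text \<open>In \<open>push N r Y\<close> the set \<open>Y\<close> lives in row \<open>r + 1\<close>;
  it is carried through the rows \<open>r\<close> to 1, so a set in row \<open>t\<close> needs
  \<open>t - 1\<close> steps.\<close>

primrec push :: "(nat \<Rightarrow> nat set) \<Rightarrow> nat \<Rightarrow> nat set \<Rightarrow> nat set" where
  "push N 0 Y = Y"
| "push N (Suc r) Y = push N r (matched_part Y (N (Suc r)))"

lemma push_initial_ext:
  assumes "\<And>r. finite (N r)" "initial_ext W V E" "finite V"
  shows "initial_ext (push N r W) (push N r V) (push N r E) \<and> finite (push N r V)"
  using assms(2,3)
proof (induction r arbitrary: W V E)
  case (Suc r)
  then show ?case using Suc.IH[OF initial_ext_matched_part[OF Suc.prems assms(1)]
      finite_subset[OF matched_part_subset assms(1)]] by simp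
qed simp

subsection \<open>Bracketing and heights\<close>

definition bracket_val :: "nat \<Rightarrow> nat \<Rightarrow> int" where
  "bracket_val i x = (if x = Suc i then 1 else if x = i then -1 else 0)"

definition suffix_ht :: "nat \<Rightarrow> nat list \<Rightarrow> nat \<Rightarrow> int" where
  "suffix_ht i w p = sum_list (map (bracket_val i) (drop p w))"

lemma suffix_ht_Suc: "p < length w \<Longrightarrow> suffix_ht i w p = bracket_val i (w ! p) + suffix_ht i w (Suc p)"
  by (simp add: suffix_ht_def Cons_nth_drop_Suc[symmetric])

lemma suffix_ht_length: "suffix_ht i w (length w) = 0"
  by (simp add: suffix_ht_def)

text \<open>Nested pairs cancel, so a matched pair encloses a stretch lying below the common height
  at its two ends. Heights can thus replace the inductive definition.\<close>

lemma matched_imp_ht: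
  "matched i w p q \<Longrightarrow> p < q \<and> q < length w \<and> w ! p = Suc i \<and> w ! q = i \<and>
    suffix_ht i w p = suffix_ht i w (Suc q) \<and> (\<forall>k. p < k \<longrightarrow> k \<le> q \<longrightarrow> suffix_ht i w k < suffix_ht i w p)"
proof (induction rule: matched.induct)
  case (match p q)
  let ?S = "suffix_ht i w"
  have Sp: "?S p = 1 + ?S (Suc p)" and Sq: "?S q = ?S (Suc q) - 1"
    using match by (simp_all add: suffix_ht_Suc bracket_val_def)
  have step: "?S k = ?S (Suc k) + bracket_val i (w ! k)" if "k < q" for k
    using suffix_ht_Suc[of k w i] that match by simp
  \<comment> \<open>Going right, only a closing bracket raises the height, and the height after it
    was already attained at its partner, which lies after \<open>p\<close> and before the
    bracket.\<close>
  have le: "?S k \<le> ?S (Suc p)" if "p < k" "k \<le> q" for k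
    using that
  proof (induction k rule: less_induct)
    case (less k)
    show ?case
    proof (cases "k = Suc p")
      case False
      then obtain m where m: "k = Suc m" "p < m" "m < q" using less.prems by (cases k) auto
      show ?thesis
      proof (cases "w ! m = i")
        case True
        obtain l where l: "p < l" "l < q" "l < m" "?S l = ?S (Suc m)"
          using match.IH[OF m(2,3)] True by auto
        then show ?thesis using less.IH[of l] l m by simp
      next
        case False
        then have "0 \<le> bracket_val i (w ! m)" by (simp add: bracket_val_def)
        then show ?thesis using less.IH[of m] m step[of m] by simp
      qed
    qed simp
  qed
  have ge: "?S k \<le> ?S q" if "p < k" "k \<le> q" for k
    using that
  proof (induction "q - k" arbitrary: k rule: less_induct)
    case less
    show ?case
    proof (cases "k = q")
      case False
      then have kq: "k < q" using less.prems by simp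
      show ?thesis
      proof (cases "w ! k = Suc i")
        case True
        obtain l where l: "p < l" "l < q" "k < l" "?S k = ?S (Suc l)"
          using match.IH[OF less.prems(1) kq] True by auto
        then show ?thesis using less.hyps[of "Suc l"] l kq by simp
      next
        case False
        then have "bracket_val i (w ! k) \<le> 0" by (simp add: bracket_val_def)
        moreover have "?S (Suc k) \<le> ?S q" using less.hyps[of "Suc k"] less.prems kq by simp
        ultimately show ?thesis using step[OF kq] by linarith
      qed
    qed simp
  qed
  have "?S (Suc p) \<le> ?S q" "?S q \<le> ?S (Suc p)" using ge[of "Suc p"] le[of q] match by auto
  then have "?S p = ?S (Suc q)" using Sp Sq by simp
  moreover have "?S k < ?S p" if "p < k" "k \<le> q" for k using le[OF that] Sp by simp
  ultimately show ?case using match by auto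
qed

text \<open>Heights change by at most one per letter. The first later position that is at least as
  high as \<open>p\<close> is thus exactly as high, and the letter before it closes
  \<open>p\<close>.\<close>

lemma first_return:
  assumes "p < length w" "w ! p = Suc i" "p < q" "q \<le> length w" "suffix_ht i w p \<le> suffix_ht i w q"
  obtains l where "p < l" "l < q" "w ! l = i" "suffix_ht i w p = suffix_ht i w (Suc l)"
    "\<And>k. p < k \<Longrightarrow> k \<le> l \<Longrightarrow> suffix_ht i w k < suffix_ht i w p"
proof -
  let ?S = "suffix_ht i w"
  define m where "m = (LEAST m. p < m \<and> ?S p \<le> ?S m)"
  have m: "p < m" "?S p \<le> ?S m" and mq: "m \<le> q"
    using LeastI[of "\<lambda>m. p < m \<and> ?S p \<le> ?S m" q] Least_le[of "\<lambda>m. p < m \<and> ?S p \<le> ?S m" q] assms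
    by (auto simp: m_def)
  have min: "?S k < ?S p" if "p < k" "k < m" for k
    using not_less_Least[of k "\<lambda>m. p < m \<and> ?S p \<le> ?S m"] that by (auto simp: m_def)
  have "?S (Suc p) < ?S p" using suffix_ht_Suc[OF assms(1), of i] assms(2) by (simp add: bracket_val_def)
  then have "m \<noteq> Suc p" using m by auto
  then obtain l where l: "m = Suc l" "p < l" using m(1) by (cases m) auto
  have "?S l < ?S p" using min l by simp
  then have "w ! l = i \<and> ?S p = ?S (Suc l)"
    using suffix_ht_Suc[of l w i] m(2) l mq assms(4) by (auto simp: bracket_val_def split: if_splits)
  then show ?thesis using that[of l] l mq min by auto
qed

lemma last_departure:
  assumes "q < length w" "w ! q = i" "p \<le> q" "suffix_ht i w (Suc q) \<le> suffix_ht i w p"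
  obtains l where "p \<le> l" "l < q" "w ! l = Suc i" "suffix_ht i w l = suffix_ht i w (Suc q)"
    "\<And>k. l < k \<Longrightarrow> k \<le> q \<Longrightarrow> suffix_ht i w k < suffix_ht i w (Suc q)"
proof -
  let ?S = "suffix_ht i w"
  define l where "l = (GREATEST l. l \<le> q \<and> ?S (Suc q) \<le> ?S l)"
  have ex: "p \<le> q \<and> ?S (Suc q) \<le> ?S p" using assms by simp
  have l: "l \<le> q" "?S (Suc q) \<le> ?S l"
    using GreatestI_nat[of "\<lambda>l. l \<le> q \<and> ?S (Suc q) \<le> ?S l" p q] ex by (auto simp: l_def)
  have "p \<le> l" unfolding l_def by (rule Greatest_le_nat[where b = q]) (use ex in auto)
  have max: "?S k < ?S (Suc q)" if "l < k" "k \<le> q" for k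
  proof (rule ccontr)
    assume "\<not> ?S k < ?S (Suc q)"
    then have "k \<le> l" unfolding l_def using that by (intro Greatest_le_nat[where b = q]) auto
    then show False using that by simp
  qed
  have "?S q < ?S (Suc q)" using suffix_ht_Suc[OF assms(1), of i] assms(2) by (simp add: bracket_val_def)
  then have "l < q" using l by (cases "l = q") auto
  then have "?S (Suc l) < ?S (Suc q)" using max by simp
  then have "w ! l = Suc i \<and> ?S l = ?S (Suc q)"
    using suffix_ht_Suc[of l w i] l \<open>l < q\<close> assms(1) by (auto simp: bracket_val_def split: if_splits)
  then show ?thesis using that[of l] \<open>p \<le> l\<close> \<open>l < q\<close> max by auto
qed

text \<open>By induction on the length: every bracket strictly inside finds its partner by a first
  return or a last departure, and the heights at the two ends keep that partner inside.\<close>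

lemma ht_imp_matched:
  assumes "p < q" "q < length w" "w ! p = Suc i" "w ! q = i" "suffix_ht i w p = suffix_ht i w (Suc q)"
    "\<And>k. p < k \<Longrightarrow> k \<le> q \<Longrightarrow> suffix_ht i w k < suffix_ht i w p"
  shows "matched i w p q"
  using assms
proof (induction "q - p" arbitrary: p q rule: less_induct)
  case less
  let ?S = "suffix_ht i w"
  note H = less.prems
  have Sp: "?S p = 1 + ?S (Suc p)" and Sq: "?S q = ?S (Suc q) - 1"
    using H by (simp_all add: suffix_ht_Suc bracket_val_def)
  show ?case
  proof (rule match[OF H(1-4)])
    fix k assume k: "p < k" "k < q" "w ! k = i \<or> w ! k = Suc i"
    show "\<exists>l. p < l \<and> l < q \<and> (matched i w k l \<or> matched i w l k)"
    proof (cases "w ! k = i")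
      case True
      have le: "?S (Suc k) \<le> ?S (Suc p)" using H(6)[of "Suc k"] k Sp by simp
      have k': "k < length w" "Suc p \<le> k" using k H(2) by auto
      obtain l where l: "Suc p \<le> l" "l < k" "w ! l = Suc i" "?S l = ?S (Suc k)"
        "\<And>m. l < m \<Longrightarrow> m \<le> k \<Longrightarrow> ?S m < ?S (Suc k)"
        using last_departure[OF k'(1) True k'(2) le] by metis
      have "matched i w l k"
        using l k H(2) True by (intro less.hyps) auto
      then show ?thesis using l(1,2) k(2) by (intro exI[of _ l]) auto
    next
      case False
      then have o: "w ! k = Suc i" using k by simp
      have le: "?S k \<le> ?S q" using H(6)[of k] k Sq H(5) by simp
      have k': "k < length w" "q \<le> length w" using k H(2) by auto
      obtain l where l: "k < l" "l < q" "w ! l = i" "?S k = ?S (Suc l)"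
        "\<And>m. k < m \<Longrightarrow> m \<le> l \<Longrightarrow> ?S m < ?S k"
        using first_return[OF k'(1) o k(2) k'(2) le] by metis
      have "matched i w k l"
        using l k H(2) o by (intro less.hyps) auto
      then show ?thesis using l(1,2) k(1) by (intro exI[of _ l]) auto
    qed
  qed
qed

lemma unmatched_open_iff:
  "p \<in> unmatched_open i w \<longleftrightarrow> p < length w \<and> w ! p = Suc i \<and>
    (\<forall>q. p < q \<longrightarrow> q \<le> length w \<longrightarrow> suffix_ht i w q < suffix_ht i w p)"
proof -
  have "(\<nexists>q. matched i w p q) \<longleftrightarrow> (\<forall>q. p < q \<longrightarrow> q \<le> length w \<longrightarrow> suffix_ht i w q < suffix_ht i w p)"
    if p: "p < length w" "w ! p = Suc i"
  proof
    assume n: "\<nexists>q. matched i w p q"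
    show "\<forall>q. p < q \<longrightarrow> q \<le> length w \<longrightarrow> suffix_ht i w q < suffix_ht i w p"
    proof (intro allI impI, rule ccontr)
      fix q assume q: "p < q" "q \<le> length w" "\<not> suffix_ht i w q < suffix_ht i w p"
      then obtain l where "p < l" "l < q" "w ! l = i" "suffix_ht i w p = suffix_ht i w (Suc l)"
        "\<And>k. p < k \<Longrightarrow> k \<le> l \<Longrightarrow> suffix_ht i w k < suffix_ht i w p"
        using first_return[OF p q(1,2)] by (metis not_less)
      then have "matched i w p l" using p q by (intro ht_imp_matched) auto
      then show False using n by blast
    qed
  next
    assume *: "\<forall>q. p < q \<longrightarrow> q \<le> length w \<longrightarrow> suffix_ht i w q < suffix_ht i w p"
    show "\<nexists>q. matched i w p q"
    proof
      assume "\<exists>q. matched i w p q"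
      then obtain q where "p < q" "q < length w" "suffix_ht i w p = suffix_ht i w (Suc q)"
        using matched_imp_ht by blast
      then show False using *[rule_format, of "Suc q"] by simp
    qed
  qed
  then show ?thesis by (auto simp: unmatched_open_def)
qed

lemma unmatched_close_iff:
  "q \<in> unmatched_close i w \<longleftrightarrow> q < length w \<and> w ! q = i \<and>
    (\<forall>p\<le>q. suffix_ht i w p < suffix_ht i w (Suc q))"
proof -
  have "(\<nexists>p. matched i w p q) \<longleftrightarrow> (\<forall>p\<le>q. suffix_ht i w p < suffix_ht i w (Suc q))"
    if q: "q < length w" "w ! q = i"
  proof
    assume n: "\<nexists>p. matched i w p q"
    show "\<forall>p\<le>q. suffix_ht i w p < suffix_ht i w (Suc q)"
    proof (intro allI impI, rule ccontr)
      fix p assume p: "p \<le> q" "\<not> suffix_ht i w p < suffix_ht i w (Suc q)"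
      then obtain l where "p \<le> l" "l < q" "w ! l = Suc i" "suffix_ht i w l = suffix_ht i w (Suc q)"
        "\<And>k. l < k \<Longrightarrow> k \<le> q \<Longrightarrow> suffix_ht i w k < suffix_ht i w (Suc q)"
        using last_departure[OF q p(1)] by (metis not_less)
      then have "matched i w l q" using q by (intro ht_imp_matched) auto
      then show False using n by blast
    qed
  next
    assume *: "\<forall>p\<le>q. suffix_ht i w p < suffix_ht i w (Suc q)"
    show "\<nexists>p. matched i w p q"
    proof
      assume "\<exists>p. matched i w p q"
      then obtain p where "p < q" "suffix_ht i w p = suffix_ht i w (Suc q)"
        using matched_imp_ht by blast
      then show False using *[rule_format, of p] by simp
    qed
  qed
  then show ?thesis by (auto simp: unmatched_close_def)
qed

section \<open>Reading words as sorted lists of cells\<close>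

lemma sorted_wrt_concat_map:
  assumes "sorted_wrt Q ks" "\<And>k. k \<in> set ks \<Longrightarrow> sorted_wrt R (f k)"
    "\<And>k l x y. Q k l \<Longrightarrow> x \<in> set (f k) \<Longrightarrow> y \<in> set (f l) \<Longrightarrow> R x y"
  shows "sorted_wrt R (concat (map f ks))"
  using assms(1,2)
proof (induction ks)
  case (Cons k ks)
  then show ?case using assms(3)[of k] by (auto simp: sorted_wrt_append)
qed simp

text \<open>Turns a suffix of a reading word into a set of cells cut out by the reading order, whose
  balls can be counted row by row.\<close>

lemma set_drop_sorted_wrt:
  assumes "sorted_wrt R bs" "\<And>x y. R x y \<Longrightarrow> \<not> R y x" "p < length bs"
  shows "set (drop p bs) = {b \<in> set bs. b = bs ! p \<or> R (bs ! p) b}" (is "?L = ?R")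
proof -
  have *: "k \<ge> p \<longleftrightarrow> bs ! k = bs ! p \<or> R (bs ! p) (bs ! k)" if "k < length bs" for k
    using sorted_wrt_nth_less[OF assms(1), of k p] sorted_wrt_nth_less[OF assms(1), of p k] assms(2,3) that
    by (metis linorder_cases nless_le not_le)
  have "drop p bs = map (nth bs) (drop p [0..<length bs])"
    by (simp add: drop_map[symmetric] map_nth del: drop_upt)
  then have drop: "?L = nth bs ` {p..<length bs}" by simp
  show ?thesis
  proof
    show "?L \<subseteq> ?R"
    proof
      fix b assume "b \<in> ?L"
      then obtain k where "b = bs ! k" "p \<le> k" "k < length bs" unfolding drop by auto
      then show "b \<in> ?R" using *[of k] by auto
    qed
    show "?R \<subseteq> ?L"
    proof
      fix b assume "b \<in> ?R"
      then obtain k where "b = bs ! k" "k < length bs" "b = bs ! p \<or> R (bs ! p) b"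
        by (auto simp: in_set_conv_nth)
      then show "b \<in> ?L" unfolding drop using *[of k] by auto
    qed
  qed
qed

lemma set_take_sorted_wrt:
  assumes "sorted_wrt R bs" "\<And>x y. R x y \<Longrightarrow> \<not> R y x" "q < length bs"
  shows "set (take (Suc q) bs) = {b \<in> set bs. b = bs ! q \<or> R b (bs ! q)}"
proof -
  have *: "k \<le> q \<longleftrightarrow> bs ! k = bs ! q \<or> R (bs ! k) (bs ! q)" if "k < length bs" for k
    using sorted_wrt_nth_less[OF assms(1), of k q] sorted_wrt_nth_less[OF assms(1), of q k] assms(2,3) that
    by (metis linorder_cases nless_le not_le)
  moreover have "set (take (Suc q) bs) = nth bs ` {..q}"
    using nth_image[of "Suc q" bs] assms(3) by (simp add: lessThan_Suc_atMost atLeast0LessThan)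
  moreover have "set bs = nth bs ` {..<length bs}"
    using nth_image[of "length bs" bs] by (simp add: atLeast0LessThan)
  moreover have "nth bs ` {..q} = {b \<in> nth bs ` {..<length bs}. b = bs ! q \<or> R b (bs ! q)}" (is "?L = ?R")
  proof
    show "?L \<subseteq> ?R"
    proof
      fix b assume "b \<in> ?L"
      then obtain k where "b = bs ! k" "k \<le> q" by blast
      then show "b \<in> ?R" using *[of k] assms(3) by auto
    qed
    show "?R \<subseteq> ?L"
    proof
      fix b assume "b \<in> ?R"
      then obtain k where "b = bs ! k" "k < length bs" "b = bs ! q \<or> R b (bs ! q)" by blast
      then show "b \<in> ?L" using *[of k] by auto
    qed
  qed
  ultimately show ?thesis by simp
qed

lemma distinct_sorted_wrt: "sorted_wrt R bs \<Longrightarrow> (\<And>x. \<not> R x x) \<Longrightarrow> distinct bs"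
  by (induction bs) auto

lemma sum_list_bracket_val:
  assumes "distinct bs"
  shows "sum_list (map (bracket_val i) (map lab bs)) =
    int (card {b \<in> set bs. lab b = Suc i}) - int (card {b \<in> set bs. lab b = i})"
proof -
  have "sum_list (map (bracket_val i) (map lab bs)) = (\<Sum>b\<in>set bs. bracket_val i (lab b))"
    using sum_list_distinct_conv_sum_set[OF assms, of "\<lambda>b. bracket_val i (lab b)"] by (simp add: comp_def)
  also have "\<dots> = (\<Sum>b\<in>set bs. of_bool (lab b = Suc i) - of_bool (lab b = i))"
    by (intro sum.cong) (auto simp: bracket_val_def)
  also have "\<dots> = int (card {b \<in> set bs. lab b = Suc i}) - int (card {b \<in> set bs. lab b = i})"
    by (simp add: sum_subtractf of_bool_def sum.If_cases Int_def conj_commute)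
  finally show ?thesis .
qed

subsection \<open>Queues as configurations\<close>

definition balls :: "queue \<Rightarrow> config" where
  "balls M = {(r, c). 1 \<le> r \<and> r \<le> length M \<and> c \<in> row M r}"

lemma rowc_balls: "1 \<le> r \<Longrightarrow> r \<le> length M \<Longrightarrow> rowc (balls M) r = row M r"
  by (auto simp: balls_def)

lemma balls_inj:
  assumes "length M = length N" "balls M = balls N"
  shows "M = N"
proof (rule nth_equalityI)
  fix k assume "k < length M"
  then have "row M (Suc k) = row N (Suc k)"
    using rowc_balls[of "Suc k" M] rowc_balls[of "Suc k" N] assms by simp
  then show "M ! k = N ! k" by (simp add: row_def)
qed (rule assms)

lemma length_move_ball: "length (move_ball b b' M) = length M"
  by (simp add: move_ball_def Let_def)

lemma row_list_update:
  "1 \<le> k \<Longrightarrow> k \<le> length M \<Longrightarrow> 1 \<le> r \<Longrightarrow> row (M[k - 1 := S]) r = (if r = k then S else row M r)"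
  by (auto simp: row_def nth_list_update)

lemma balls_move_ball:
  assumes "1 \<le> a" "a \<le> length M" "1 \<le> b" "b \<le> length M" "(a, c) \<noteq> (b, d)"
  shows "balls (move_ball (a, c) (b, d) M) = insert (b, d) (balls M - {(a, c)})"
proof -
  define M1 where "M1 = M[a - 1 := row M a - {c}]"
  have M1: "row M1 r = (if r = a then row M a - {c} else row M r)" if "1 \<le> r" for r
    unfolding M1_def using row_list_update[of a M r] assms that by simp
  have "move_ball (a, c) (b, d) M = M1[b - 1 := insert d (row M1 b)]"
    by (simp add: move_ball_def M1_def Let_def)
  moreover have "length M1 = length M" by (simp add: M1_def)
  ultimately have "row (move_ball (a, c) (b, d) M) r = (if r = b then insert d (row M1 b) else row M1 r)"
    if "1 \<le> r" for r
    using row_list_update[of b M1 r] assms that by simp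
  then have "balls (move_ball (a, c) (b, d) M)
      = {(r, x). 1 \<le> r \<and> r \<le> length M \<and> x \<in> (if r = b then insert d (row M1 b) else row M1 r)}"
    by (auto simp: balls_def length_move_ball)
  also have "\<dots> = insert (b, d) (balls M - {(a, c)})"
    using assms by (auto simp: balls_def M1 split: if_splits)
  finally show ?thesis .
qed

lemma set_cw_balls:
  assumes "balls M \<subseteq> box (length M) n"
  shows "set (cw_balls n M) = balls M"
  using assms by (fastforce simp: cw_balls_def balls_def simp del: upt_Suc split: if_splits)

lemma set_rw_balls:
  assumes "balls M \<subseteq> box (length M) n"
  shows "set (rw_balls n M) = balls M"
  using assms by (fastforce simp: rw_balls_def balls_def simp del: upt_Suc split: if_splits)

lemma sorted_rev_upt: "sorted_wrt (\<lambda>x y. y < x) (rev [a..<b])"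
  by (simp add: sorted_wrt_rev)

lemma sorted_cw_balls: "sorted_wrt (\<lambda>b b'. snd b < snd b' \<or> snd b = snd b' \<and> fst b' < fst b) (cw_balls n M)"
  unfolding cw_balls_def
  by (rule sorted_wrt_concat_map[OF sorted_wrt_upt] sorted_wrt_concat_map[OF sorted_rev_upt] |
      force split: if_splits)+

lemma sorted_rw_balls: "sorted_wrt (\<lambda>b b'. fst b' < fst b \<or> fst b = fst b' \<and> snd b' < snd b) (rw_balls n M)"
  unfolding rw_balls_def
  by (rule sorted_wrt_concat_map[OF sorted_rev_upt] | force split: if_splits)+

text \<open>Columns are read from top to bottom, so in the column of position \<open>p\<close> only
  rows \<le> \<open>r\<close> remain. Counting starts at \<open>c\<close> for these rows and at
  \<open>Suc c\<close> for the others.\<close>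

lemma suffix_ht_cw:
  assumes "balls M \<subseteq> box (length M) n" "p < length (cw_balls n M)" "cw_balls n M ! p = (r, c)"
  shows "suffix_ht j (cw n M) p =
    int (card (rowc (balls M) (Suc j) \<inter> {if Suc j \<le> r then c else Suc c..})) -
    int (card (rowc (balls M) j \<inter> {if j \<le> r then c else Suc c..}))"
proof -
  let ?bs = "cw_balls n M" and ?R = "\<lambda>b b' :: nat \<times> nat. snd b < snd b' \<or> snd b = snd b' \<and> fst b' < fst b"
  have d: "distinct ?bs" by (rule distinct_sorted_wrt[OF sorted_cw_balls]) auto
  have "set (drop p ?bs) = {b \<in> set ?bs. b = ?bs ! p \<or> ?R (?bs ! p) b}"
    by (rule set_drop_sorted_wrt[OF sorted_cw_balls _ assms(2)]) auto
  then have s: "set (drop p ?bs) = {b \<in> balls M. b = (r, c) \<or> ?R (r, c) b}"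
    using assms by (simp add: set_cw_balls)
  have "{b \<in> set (drop p ?bs). fst b = k} = Pair k ` (rowc (balls M) k \<inter> {if k \<le> r then c else Suc c..})" for k
    unfolding s by (auto simp: Suc_le_eq split: if_splits)
  then have "card {b \<in> set (drop p ?bs). fst b = k} = card (rowc (balls M) k \<inter> {if k \<le> r then c else Suc c..})" for k
    by (simp add: card_image inj_on_def)
  then show ?thesis
    using sum_list_bracket_val[OF distinct_drop[OF d], of j fst p]
    by (simp add: suffix_ht_def cw_def drop_map)
qed

text \<open>Unmatched closing brackets are governed by prefixes, hence the subtraction of the total
  height. Rows are read from right to left, so of row \<open>r\<close> the columns \<ge>
  \<open>c\<close> belong to the prefix.\<close>

lemma prefix_ht_rw:
  assumes "balls M \<subseteq> box (length M) n" "q < length (rw_balls n M)" "rw_balls n M ! q = (r, c)"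
  shows "suffix_ht i (rw n M) (Suc q) - suffix_ht i (rw n M) 0 =
    int (card (col (balls M) i \<inter> {if c \<le> i then r else Suc r..})) -
    int (card (col (balls M) (Suc i) \<inter> {if c \<le> Suc i then r else Suc r..}))"
proof -
  let ?bs = "rw_balls n M" and ?R = "\<lambda>b b' :: nat \<times> nat. fst b' < fst b \<or> fst b = fst b' \<and> snd b' < snd b"
  have d: "distinct ?bs" by (rule distinct_sorted_wrt[OF sorted_rw_balls]) auto
  have "set (take (Suc q) ?bs) = {b \<in> set ?bs. b = ?bs ! q \<or> ?R b (?bs ! q)}"
    by (rule set_take_sorted_wrt[OF sorted_rw_balls _ assms(2)]) auto
  then have s: "set (take (Suc q) ?bs) = {b \<in> balls M. b = (r, c) \<or> ?R b (r, c)}"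
    using assms by (simp add: set_rw_balls)
  have "{b \<in> set (take (Suc q) ?bs). snd b = k} = (\<lambda>r. (r, k)) ` (col (balls M) k \<inter> {if c \<le> k then r else Suc r..})" for k
    unfolding s by (auto simp: Suc_le_eq split: if_splits)
  then have k: "card {b \<in> set (take (Suc q) ?bs). snd b = k} = card (col (balls M) k \<inter> {if c \<le> k then r else Suc r..})" for k
    by (simp add: card_image inj_on_def)
  have "suffix_ht i (rw n M) 0 = sum_list (map (bracket_val i) (take (Suc q) (rw n M) @ drop (Suc q) (rw n M)))"
    unfolding append_take_drop_id by (simp add: suffix_ht_def)
  also have "\<dots> = sum_list (map (bracket_val i) (map snd (take (Suc q) ?bs))) + suffix_ht i (rw n M) (Suc q)"
    unfolding map_append sum_list_append by (simp add: suffix_ht_def rw_def take_map)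
  finally show ?thesis
    using sum_list_bracket_val[OF distinct_take[OF d], of i snd "Suc q"] k by simp
qed

lemma e_down_balls:
  assumes M: "balls M \<subseteq> box (length M) n" and j: "1 \<le> j" "j < length M"
  shows "balls (e_down n j M) = down j (balls M) \<and> length (e_down n j M) = length M"
proof -
  let ?A = "rowc (balls M) (Suc j)" and ?B = "rowc (balls M) j"
  let ?bs = "cw_balls n M" and ?S = "suffix_ht j (cw n M)" and ?U = "unmatched_open j (cw n M)"
  note fin = finite_Image_sing[OF finite_box[OF M]]
  have len: "length (cw n M) = length ?bs" by (simp add: cw_def)
  have le_Suc: "card (A \<inter> {Suc c..}) \<le> card (A \<inter> {c..})" if "finite A" for A :: "nat set" and c
    using that by (intro card_mono) auto
  \<comment> \<open>The two counts start at different columns only for a ball of row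
    \<open>j\<close> itself; the lower count then starts one column earlier, which can only push the
    value below \<open>hgt\<close> at \<open>Suc c\<close>.\<close>
  have bound: "?S p \<le> hgt ?A ?B c \<and> Suc j \<le> r \<or> ?S p \<le> hgt ?A ?B (Suc c) \<and> r < Suc j"
    if "p < length ?bs" "?bs ! p = (r, c)" for p r c
    using suffix_ht_cw[OF M that, of j] le_Suc[OF fin, of j c] by (auto simp: hgt_def)
  have upper: "?S p = hgt ?A ?B c" if "p < length ?bs" "?bs ! p = (Suc j, c)" for p c
    using suffix_ht_cw[OF M that, of j] by (simp add: hgt_def)
  have Uiff: "p \<in> ?U \<longleftrightarrow> p < length ?bs \<and> fst (?bs ! p) = Suc j \<and> (\<forall>q. p < q \<longrightarrow> q \<le> length ?bs \<longrightarrow> ?S q < ?S p)" for p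
    unfolding unmatched_open_iff len by (auto simp: cw_def)
  have finU: "finite ?U" by (rule finite_subset[of _ "{..<length ?bs}"]) (auto simp: Uiff)
  show ?thesis
  proof (cases "\<exists>c. peak ?A ?B c")
    case True
    then obtain c where c: "peak ?A ?B c" by blast
    have "(Suc j, c) \<in> balls M" using peak_mem(1)[OF fin fin c] by simp
    then obtain p where p: "p < length ?bs" "?bs ! p = (Suc j, c)"
      using set_cw_balls[OF M] by (metis in_set_conv_nth)
    have Sp: "?S p = hgt ?A ?B c" using upper[OF p] .
    have pmax: "hgt ?A ?B x \<le> hgt ?A ?B c" "c < x \<Longrightarrow> hgt ?A ?B x < hgt ?A ?B c" for x
      using c by (auto simp: peak_def)
    have "?S q < ?S p" if q: "p < q" "q \<le> length ?bs" for q
    proof (cases "q = length ?bs")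
      case True
      then show ?thesis using Sp peak_pos[OF fin fin c] suffix_ht_length[of j "cw n M"] len by simp
    next
      case False
      then have q': "q < length ?bs" using q by simp
      obtain r' c' where rc: "?bs ! q = (r', c')" by fastforce
      have "c < c' \<or> c = c' \<and> r' < Suc j"
        using sorted_wrt_nth_less[OF sorted_cw_balls q(1) q'] p(2) rc by simp
      then show ?thesis using bound[OF q' rc] Sp pmax(2)[of c'] pmax(2)[of "Suc c'"] by auto
    qed
    then have pU: "p \<in> ?U" using p by (auto simp: Uiff)
    \<comment> \<open>An unmatched opening bracket before \<open>p\<close> would have a greater
      suffix height than \<open>p\<close>, where the maximum is already attained.\<close>
    have "Min ?U = p"
    proof (rule Min_eqI[OF finU _ pU])
      fix q assume "q \<in> ?U"
      then have q: "q < length ?bs" "q < p \<Longrightarrow> ?S p < ?S q" unfolding Uiff using p by auto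
      obtain r' c' where rc: "?bs ! q = (r', c')" by fastforce
      show "p \<le> q"
        using bound[OF q(1) rc] q(2) Sp pmax(1)[of c'] pmax(1)[of "Suc c'"] by linarith
    qed
    then have "e_down n j M = move_ball (Suc j, c) (j, c) M"
      using pU p by (auto simp: e_down_def Let_def)
    then show ?thesis using j by (simp add: balls_move_ball length_move_ball down_peak[OF c])
  next
    case False
    have "?U = {}"
    proof (rule ccontr)
      assume "?U \<noteq> {}"
      then obtain p where p: "p < length ?bs" "?S (length ?bs) < ?S p" unfolding ex_in_conv[symmetric] Uiff by auto
      obtain r c where "?bs ! p = (r, c)" by fastforce
      then have "0 < hgt ?A ?B c \<or> 0 < hgt ?A ?B (Suc c)"
        using bound[OF p(1)] p(2) suffix_ht_length[of j "cw n M"] len by fastforce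
      then show False using peak_exists[OF fin fin] False by blast
    qed
    then show ?thesis using False by (simp add: e_down_def down_no_peak)
  qed
qed

lemma f_right_balls:
  assumes M: "balls M \<subseteq> box (length M) n"
  shows "balls (f_right n i M) = right i (balls M) \<and> length (f_right n i M) = length M"
proof -
  let ?A = "col (balls M) i" and ?B = "col (balls M) (Suc i)"
  let ?bs = "rw_balls n M" and ?U = "unmatched_close i (rw n M)"
  define V where "V q = suffix_ht i (rw n M) q - suffix_ht i (rw n M) 0" for q
  note fin = finite_col[OF finite_box[OF M]]
  have len: "length (rw n M) = length ?bs" by (simp add: rw_def)
  have le_Suc: "card (A \<inter> {Suc c..}) \<le> card (A \<inter> {c..})" if "finite A" for A :: "nat set" and c
    using that by (intro card_mono) auto
  have bound: "V (Suc q) \<le> hgt ?A ?B r \<and> c \<le> i \<or> V (Suc q) \<le> hgt ?A ?B (Suc r) \<and> i < c"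
    if "q < length ?bs" "?bs ! q = (r, c)" for q r c
    using prefix_ht_rw[OF M that, of i] le_Suc[OF fin, of "Suc i" r] by (auto simp: hgt_def V_def)
  have upper: "V (Suc q) = hgt ?A ?B r" if "q < length ?bs" "?bs ! q = (r, i)" for q r
    using prefix_ht_rw[OF M that, of i] by (simp add: hgt_def V_def)
  have Uiff: "q \<in> ?U \<longleftrightarrow> q < length ?bs \<and> snd (?bs ! q) = i \<and> (\<forall>p\<le>q. V p < V (Suc q))" for q
    unfolding unmatched_close_iff len by (auto simp: rw_def V_def)
  have finU: "finite ?U" by (rule finite_subset[of _ "{..<length ?bs}"]) (auto simp: Uiff)
  have V0: "V 0 = 0" by (simp add: V_def)
  show ?thesis
  proof (cases "\<exists>r. peak ?A ?B r")
    case True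
    then obtain r where r: "peak ?A ?B r" by blast
    have rM: "(r, i) \<in> balls M" using peak_mem(1)[OF fin fin r] by simp
    then obtain q where q: "q < length ?bs" "?bs ! q = (r, i)"
      using set_rw_balls[OF M] by (metis in_set_conv_nth)
    have Vq: "V (Suc q) = hgt ?A ?B r" using upper[OF q] .
    have pmax: "hgt ?A ?B x \<le> hgt ?A ?B r" "r < x \<Longrightarrow> hgt ?A ?B x < hgt ?A ?B r" for x
      using r by (auto simp: peak_def)
    have "V p < V (Suc q)" if p: "p \<le> q" for p
    proof (cases p)
      case 0
      then show ?thesis using Vq V0 peak_pos[OF fin fin r] by simp
    next
      case (Suc p')
      then have p': "p' < q" "p' < length ?bs" using p q by auto
      obtain r' c' where rc: "?bs ! p' = (r', c')" by fastforce
      have "r < r' \<or> r = r' \<and> i < c'"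
        using sorted_wrt_nth_less[OF sorted_rw_balls p'(1) q(1)] q(2) rc by auto
      then show ?thesis using bound[OF p'(2) rc] Vq pmax(2)[of r'] pmax(2)[of "Suc r'"] Suc by auto
    qed
    then have qU: "q \<in> ?U" using q by (auto simp: Uiff)
    have "Max ?U = q"
    proof (rule Max_eqI[OF finU _ qU])
      fix p assume "p \<in> ?U"
      then have p: "p < length ?bs" "\<And>k. k \<le> p \<Longrightarrow> V k < V (Suc p)" unfolding Uiff by auto
      obtain r' c' where rc: "?bs ! p = (r', c')" by fastforce
      have "V (Suc p) \<le> V (Suc q)"
        using bound[OF p(1) rc] Vq pmax(1)[of r'] pmax(1)[of "Suc r'"] by linarith
      then show "p \<le> q" using p(2)[of "Suc q"] by (meson Suc_leI leD leI)
    qed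
    then have "f_right n i M = move_ball (r, i) (r, Suc i) M"
      using qU q by (auto simp: f_right_def Let_def)
    moreover have "1 \<le> r" "r \<le> length M" using rM by (auto simp: balls_def)
    ultimately show ?thesis by (simp add: balls_move_ball length_move_ball right_peak[OF r])
  next
    case False
    have "?U = {}"
    proof (rule ccontr)
      assume "?U \<noteq> {}"
      then obtain q where q: "q < length ?bs" "V 0 < V (Suc q)" unfolding ex_in_conv[symmetric] Uiff by auto
      obtain r c where "?bs ! q = (r, c)" by fastforce
      then have "0 < hgt ?A ?B r \<or> 0 < hgt ?A ?B (Suc r)"
        using bound[OF q(1)] q(2) V0 by fastforce
      then show False using peak_exists[OF fin fin] False by blast
    qed
    then show ?thesis using False by (simp add: f_right_def right_no_peak)
  qed
qed

lemma box_star: "X \<subseteq> box L n \<Longrightarrow> 1 \<le> j \<Longrightarrow> j < L \<Longrightarrow> star j X \<subseteq> box L n"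
  unfolding star_def by (intro box_downs) auto

text \<open>The loop is unfolded along the induction on the string length, which at the same time
  supplies its termination.\<close>

lemma e_down_star_balls:
  assumes M: "balls M \<subseteq> box (length M) n" and j: "1 \<le> j" "j < length M"
  shows "balls (e_down_star n j M) = star j (balls M) \<and> length (e_down_star n j M) = length M"
proof -
  have unfold: "e_down_star n j M = (if e_down n j M \<noteq> M then e_down_star n j (e_down n j M) else M)" for M
    unfolding e_down_star_def by (subst while_unfold) simp
  have fix_iff: "e_down n j M = M \<longleftrightarrow> down j (balls M) = balls M"
    if "balls M \<subseteq> box (length M) n" "j < length M" for M
    using e_down_balls[OF that(1) j(1) that(2)] balls_inj by metis
  have main: "\<forall>M. balls M = X \<longrightarrow> X \<subseteq> box (length M) n \<longrightarrow> j < length M \<longrightarrow>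
      balls (e_down_star n j M) = star j X \<and> length (e_down_star n j M) = length M" if "finite X" for X
    using that
  proof (induction X rule: star_induct[where j = j])
    case (fixed X)
    show ?case
    proof (intro allI impI)
      fix M assume M: "balls M = X" "X \<subseteq> box (length M) n" "j < length M"
      then have "e_down n j M = M" using fix_iff[of M] fixed.hyps(2) by simp
      then have "e_down_star n j M = M" using unfold[of M] by simp
      then show "balls (e_down_star n j M) = star j X \<and> length (e_down_star n j M) = length M"
        using M fixed.hyps(3) by simp
    qed
  next
    case (step X)
    show ?case
    proof (intro allI impI)
      fix M assume M: "balls M = X" "X \<subseteq> box (length M) n" "j < length M"
      have "e_down n j M \<noteq> M" using fix_iff[of M] M step.hyps(2) by auto
      then have "e_down_star n j M = e_down_star n j (e_down n j M)" using unfold[of M] by simp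
      moreover have "balls (e_down n j M) = down j X" "length (e_down n j M) = length M"
        using e_down_balls[of M n j] M j by auto
      moreover have "down j X \<subseteq> box (length M) n" using box_down[OF M(2) j(1) M(3)] .
      ultimately show "balls (e_down_star n j M) = star j X \<and> length (e_down_star n j M) = length M"
        using step.IH step.hyps(3) M(3) by simp
    qed
  qed
  show ?thesis using main[OF finite_box[OF M]] M j by simp
qed

lemma foldr_e_down_star_balls:
  assumes "balls M \<subseteq> box (length M) n" "set js \<subseteq> {1..<length M}"
  shows "balls (foldr (e_down_star n) js M) = foldr star js (balls M) \<and>
    length (foldr (e_down_star n) js M) = length M \<and> foldr star js (balls M) \<subseteq> box (length M) n"
  using assms(2)
proof (induction js)
  case (Cons j js)
  then show ?case
    using e_down_star_balls[of "foldr (e_down_star n) js M" n j] box_star[of "foldr star js (balls M)" "length M" n j]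
    by simp
qed (use assms in simp)

lemma collapse_balls:
  assumes "balls M \<subseteq> box (length M) n" "k \<le> length M"
  shows "balls (collapse n M k) = coll (balls M) k \<and> length (collapse n M k) = length M \<and>
    coll (balls M) k \<subseteq> box (length M) n"
  using assms(2)
proof (induction k)
  case (Suc k)
  have "set [1..<Suc k] \<subseteq> {1..<length M}" using Suc.prems by auto
  then show ?case using foldr_e_down_star_balls[of "collapse n M k" n "[1..<Suc k]"] Suc by (simp del: upt_Suc)
qed (use assms in simp)

section \<open>Crystal edges as column moves\<close>

lemma MLQ_iff:
  "M \<in> MLQ n lam \<longleftrightarrow> length M = largest_part lam \<and> balls M \<subseteq> box (largest_part lam) n \<and>
    (\<forall>r\<in>{1..largest_part lam}. card (rowc (balls M) r) = conj_part lam r)"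
proof (cases "length M = largest_part lam")
  case True
  have "(\<forall>r\<in>{1..largest_part lam}. row M r \<subseteq> {1..n}) \<longleftrightarrow> balls M \<subseteq> box (largest_part lam) n"
    using True by (fastforce simp: balls_def)
  then show ?thesis using True by (auto simp: MLQ_def rowc_balls)
qed (simp add: MLQ_def)

lemma MLQ_f_right:
  assumes "M \<in> MLQ n lam" "1 \<le> i" "i < n"
  shows "f_right n i M \<in> MLQ n lam" "balls (f_right n i M) = right i (balls M)"
proof -
  have M: "length M = largest_part lam" "balls M \<subseteq> box (length M) n" using assms(1) by (auto simp: MLQ_iff)
  note f = f_right_balls[OF M(2), of i]
  show "balls (f_right n i M) = right i (balls M)" using f by simp
  show "f_right n i M \<in> MLQ n lam"
    using assms f box_right[OF M(2) assms(2,3)] card_row_right[OF finite_box[OF M(2)]] by (simp add: MLQ_iff)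
qed

lemma equivclp_edge_sim:
  assumes "equivclp (crystal_edge n lam) M M'" "M \<in> MLQ n lam"
  shows "M' \<in> MLQ n lam \<and> sim n (balls M) (balls M')"
  using assms(1)
proof (induction rule: equivclp_induct)
  case (step M' M'')
  have "M'' \<in> MLQ n lam \<and> (sim n (balls M') (balls M''))"
    using step.hyps(2)
  proof
    assume "crystal_edge n lam M' M''"
    then obtain i where i: "1 \<le> i" "i < n" "M'' = f_right n i M'" by (auto simp: crystal_edge_def)
    then show ?thesis using MLQ_f_right[of M' n lam i] step.IH sim_right[of i n] by simp
  next
    assume e: "crystal_edge n lam M'' M'"
    then obtain i where i: "1 \<le> i" "i < n" "M' = f_right n i M''" "M'' \<in> MLQ n lam"
      by (auto simp: crystal_edge_def)
    then show ?thesis using MLQ_f_right[of M'' n lam i] sim_sym[OF sim_right[of i n]] by simp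
  qed
  then show ?case using step.IH sim_trans by blast
qed (use assms sim_refl in auto)

definition queue_of :: "nat \<Rightarrow> config \<Rightarrow> queue" where
  "queue_of L X = map (\<lambda>r. rowc X (Suc r)) [0..<L]"

lemma balls_queue_of:
  assumes "X \<subseteq> box L n"
  shows "balls (queue_of L X) = X"
proof -
  have "row (queue_of L X) r = rowc X r" if "1 \<le> r" "r \<le> L" for r
    using that by (cases r) (simp_all add: queue_of_def row_def)
  then show ?thesis using assms by (auto simp: balls_def queue_of_def)
qed

lemma length_queue_of: "length (queue_of L X) = L"
  by (simp add: queue_of_def)

lemma queue_of_rights:
  assumes "X \<subseteq> box (largest_part lam) n" "set is \<subseteq> {1..<n}"
    "\<And>r. r \<in> {1..largest_part lam} \<Longrightarrow> card (rowc X r) = conj_part lam r"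
  shows "equivclp (crystal_edge n lam) (queue_of (largest_part lam) X) (queue_of (largest_part lam) (rights is X))"
  using assms(2)
proof (induction "is")
  case (Cons i "is")
  let ?L = "largest_part lam"
  let ?M = "queue_of ?L (rights is X)"
  have b: "rights is X \<subseteq> box ?L n" using box_rights[OF assms(1)] Cons.prems by simp
  have M: "?M \<in> MLQ n lam"
    using assms b by (simp add: MLQ_iff balls_queue_of[OF b] length_queue_of card_row_rights finite_box[OF assms(1)])
  have i: "1 \<le> i" "i < n" using Cons.prems by auto
  have "f_right n i ?M = queue_of ?L (rights (i # is) X)"
  proof (rule balls_inj)
    show "length (f_right n i ?M) = length (queue_of ?L (rights (i # is) X))"
      using MLQ_f_right(1)[OF M i] by (simp add: MLQ_iff length_queue_of)
    show "balls (f_right n i ?M) = balls (queue_of ?L (rights (i # is) X))"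
      using MLQ_f_right(2)[OF M i] balls_queue_of[OF b] balls_queue_of[OF box_rights[OF assms(1) Cons.prems]] by simp
  qed
  then have "crystal_edge n lam ?M (queue_of ?L (rights (i # is) X))"
    using M i unfolding crystal_edge_def by metis
  then show ?case using Cons equivclp_into_equivclp by (metis insert_subset list.simps(15))
qed simp

subsection \<open>Ferrari-Martin labels\<close>

text \<open>Greedy cyclic pairing, whatever the order: a ball left over at \<open>y\<close> was available at every
  step, so no pairing arc passes over \<open>y\<close>.\<close>

definition cyc_bij :: "(nat \<Rightarrow> nat) \<Rightarrow> nat set \<Rightarrow> nat set \<Rightarrow> nat set \<Rightarrow> bool" where
  "cyc_bij m A B S \<longleftrightarrow> S \<subseteq> B \<and> bij_betw m A S \<and>
    (\<forall>y\<in>B - S. \<forall>a\<in>A. (a \<le> y \<longrightarrow> a \<le> m a \<and> m a < y) \<and> (y < a \<longrightarrow> a \<le> m a \<or> m a < y))"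

lemma first_right_props:
  assumes "finite S" "S \<noteq> {}"
  shows "first_right S j \<in> S \<and> (\<forall>y\<in>S - {first_right S j}.
    (j \<le> y \<longrightarrow> j \<le> first_right S j \<and> first_right S j < y) \<and>
    (y < j \<longrightarrow> j \<le> first_right S j \<or> first_right S j < y))"
proof -
  let ?T = "{k \<in> S. j \<le> k}"
  have finT: "finite ?T" using assms by simp
  consider "?T \<noteq> {}" "first_right S j = Min ?T" | "?T = {}" "first_right S j = Min S"
    by (cases "\<exists>k\<in>S. j \<le> k") (auto simp: first_right_def)
  then show ?thesis
  proof cases
    case 1
    have "first_right S j \<in> S" "j \<le> first_right S j" "\<And>y. y \<in> S \<Longrightarrow> j \<le> y \<Longrightarrow> first_right S j \<le> y"
      unfolding 1(2) using Min_in[OF finT 1(1)] Min_le[OF finT] by auto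
    then show ?thesis by (auto simp: less_le)
  next
    case 2
    have "first_right S j \<in> S" "\<And>y. y \<in> S \<Longrightarrow> first_right S j \<le> y"
      unfolding 2(2) using Min_in[OF assms] Min_le[OF assms(1)] by auto
    then show ?thesis using 2(1) by (auto simp: order.order_iff_strict)
  qed
qed

text \<open>The used balls \<open>T\<close> and the pairing \<open>m\<close> do not depend on
  \<open>acc\<close>, hence the order of the quantifiers. The clause on appended lists allows the
  process to be cut at a label threshold and resumed with \<open>S - T\<close>.\<close>

lemma pair_balls_spec:
  assumes "distinct js" "finite S" "length js \<le> card S"
  shows "\<exists>T m. cyc_bij m (set js) S T \<and> (\<forall>acc. (\<forall>x. x \<notin> T \<longrightarrow> pair_balls lab js S acc x = acc x) \<and>
    (\<forall>a\<in>set js. pair_balls lab js S acc (m a) = lab a) \<and>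
    (\<forall>ks. pair_balls lab (js @ ks) S acc = pair_balls lab ks (S - T) (pair_balls lab js S acc)))"
  using assms
proof (induction js arbitrary: S)
  case Nil
  then show ?case by (intro exI[of _ "{}"]) (auto simp: cyc_bij_def)
next
  case (Cons j js)
  have ne: "S \<noteq> {}" using Cons.prems(3) by auto
  define k where "k = first_right S j"
  have fr: "k \<in> S" "\<And>y. y \<in> S - {k} \<Longrightarrow> (j \<le> y \<longrightarrow> j \<le> k \<and> k < y) \<and> (y < j \<longrightarrow> j \<le> k \<or> k < y)"
    using first_right_props[where j = j, OF Cons.prems(2) ne, folded k_def] by blast+
  have "length js \<le> card (S - {k})" using Cons.prems fr(1) by (simp add: card_Diff_singleton)
  have "distinct js" "finite (S - {k})" using Cons.prems by simp_all
  note IH = Cons.IH[OF this \<open>length js \<le> card (S - {k})\<close>]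
  obtain T m where T1: "cyc_bij m (set js) (S - {k}) T"
    and all: "\<forall>acc. (\<forall>x. x \<notin> T \<longrightarrow> pair_balls lab js (S - {k}) acc x = acc x) \<and>
      (\<forall>a\<in>set js. pair_balls lab js (S - {k}) acc (m a) = lab a) \<and>
      (\<forall>ks. pair_balls lab (js @ ks) (S - {k}) acc = pair_balls lab ks (S - {k} - T) (pair_balls lab js (S - {k}) acc))"
    using IH by metis
  have T: "cyc_bij m (set js) (S - {k}) T"
    "\<And>acc x. x \<notin> T \<Longrightarrow> pair_balls lab js (S - {k}) acc x = acc x"
    "\<And>acc a. a \<in> set js \<Longrightarrow> pair_balls lab js (S - {k}) acc (m a) = lab a"
    "\<And>acc ks. pair_balls lab (js @ ks) (S - {k}) acc = pair_balls lab ks (S - {k} - T) (pair_balls lab js (S - {k}) acc)"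
    using T1 all by blast+
  have kT: "k \<notin> T" using T(1) by (auto simp: cyc_bij_def)
  have jm: "j \<notin> set js" using Cons.prems by simp
  have b: "bij_betw m (set js) T" using T(1) by (simp add: cyc_bij_def)
  have "bij_betw (m(j := k)) (set js) T"
    using bij_betw_cong[of "set js" m "m(j := k)" T] b jm by fastforce
  then have "bij_betw (m(j := k)) (set js \<union> {j}) (T \<union> {(m(j := k)) j})"
    using notIn_Un_bij_betw[of j "set js" "m(j := k)" T] jm kT by simp
  then have bij: "bij_betw (m(j := k)) (set (j # js)) (insert k T)" by simp
  have cyc: "cyc_bij (m(j := k)) (set (j # js)) S (insert k T)"
    unfolding cyc_bij_def
  proof (intro conjI ballI bij)
    show "insert k T \<subseteq> S" using T(1) fr(1) by (auto simp: cyc_bij_def)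
    fix y a assume y: "y \<in> S - insert k T" and a: "a \<in> set (j # js)"
    have "(a \<le> y \<longrightarrow> a \<le> (m(j := k)) a \<and> (m(j := k)) a < y) \<and> (y < a \<longrightarrow> a \<le> (m(j := k)) a \<or> (m(j := k)) a < y)"
      using fr(2)[of y] a y T(1) by (cases "a = j") (simp_all add: cyc_bij_def)
    then show "a \<le> y \<longrightarrow> a \<le> (m(j := k)) a \<and> (m(j := k)) a < y"
      "y < a \<longrightarrow> a \<le> (m(j := k)) a \<or> (m(j := k)) a < y" by blast+
  qed
  have step: "pair_balls lab (j # xs) S acc = pair_balls lab xs (S - {k}) (acc(k := lab j))" for xs acc
    using ne by (simp add: k_def Let_def)
  have SD: "S - {k} - T = S - insert k T" by auto
  show ?case
  proof (intro exI[of _ "insert k T"] exI[of _ "m(j := k)"] conjI cyc allI ballI impI)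
    fix acc x assume "x \<notin> insert k T"
    then show "pair_balls lab (j # js) S acc x = acc x" unfolding step by (simp add: T(2))
  next
    fix acc a assume "a \<in> set (j # js)"
    then show "pair_balls lab (j # js) S acc ((m(j := k)) a) = lab a"
      unfolding step using T(2)[OF kT] T(3)[of a] jm by auto
  next
    fix acc ks
    show "pair_balls lab ((j # js) @ ks) S acc = pair_balls lab ks (S - insert k T) (pair_balls lab (j # js) S acc)"
      unfolding append_Cons step T(4) SD ..
  qed
qed

lemma cyc_bij_card: "cyc_bij m A B S \<Longrightarrow> card S = card A"
  by (metis bij_betw_same_card cyc_bij_def)

lemma filter_sorted_split:
  assumes "sorted_wrt (\<lambda>x y. Q y \<longrightarrow> Q x) xs"
  shows "xs = filter Q xs @ filter (\<lambda>x. \<not> Q x) xs"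
  using assms
proof (induction xs)
  case (Cons x xs)
  have "filter Q xs = []" if "\<not> Q x" using Cons.prems that by (auto simp: filter_empty_conv)
  then show ?case using Cons by (cases "Q x") (auto simp: filter_id_conv)
qed simp

text \<open>Larger labels pair first. Cutting the pairing order at \<open>t\<close>, the first block
  hands out all labels \<ge> \<open>t\<close>: the second block hands out smaller ones, and balls
  left over keep \<open>r < t\<close>.\<close>

lemma pair_balls_level:
  fixes lab :: "nat \<Rightarrow> nat"
  assumes "finite C" "finite B" "card C \<le> card B" "r < t"
  defines "res \<equiv> pair_balls lab (pairing_order lab C) B (\<lambda>j. if j \<in> B then r else 0)"
  shows "\<exists>m. cyc_bij m {j \<in> C. t \<le> lab j} B {x. t \<le> res x}"
proof -
  let ?js = "pairing_order lab C"
  define js1 where "js1 = filter (\<lambda>j. t \<le> lab j) ?js"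
  define js2 where "js2 = filter (\<lambda>j. \<not> t \<le> lab j) ?js"
  have js: "distinct ?js" "set ?js = C" "length ?js = card C"
    using assms(1) by (simp_all add: pairing_order_def)
  have "sorted_wrt (\<lambda>x y. - int (lab x) \<le> - int (lab y)) ?js"
    using sorted_sort_key[of "\<lambda>j. - int (lab j)" "sorted_list_of_set C"]
    unfolding pairing_order_def sorted_map .
  then have "sorted_wrt (\<lambda>x y. t \<le> lab y \<longrightarrow> t \<le> lab x) ?js"
    by (rule sorted_wrt_mono_rel[rotated]) auto
  then have split: "?js = js1 @ js2" unfolding js1_def js2_def by (rule filter_sorted_split)
  have len: "length js1 + length js2 = card C" using js(3) split by (metis length_append)
  have d: "distinct js1" "distinct js2" using js(1) by (simp_all add: js1_def js2_def)
  have "length js1 \<le> card B" using len assms(3) by simp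
  then obtain T m where T: "cyc_bij m (set js1) B T"
    "\<And>acc x. x \<notin> T \<Longrightarrow> pair_balls lab js1 B acc x = acc x"
    "\<And>acc a. a \<in> set js1 \<Longrightarrow> pair_balls lab js1 B acc (m a) = lab a"
    "\<And>acc ks. pair_balls lab (js1 @ ks) B acc = pair_balls lab ks (B - T) (pair_balls lab js1 B acc)"
    using pair_balls_spec[OF d(1) assms(2), of lab] by metis
  have TB: "T \<subseteq> B" "bij_betw m (set js1) T" using T(1) by (simp_all add: cyc_bij_def)
  have "card T = length js1" using cyc_bij_card[OF T(1)] d(1) by (simp add: distinct_card)
  then have "length js2 \<le> card (B - T)"
    using len assms(2,3) TB(1) by (simp add: card_Diff_subset finite_subset)
  then obtain T' m' where T': "cyc_bij m' (set js2) (B - T) T'"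
    "\<And>acc x. x \<notin> T' \<Longrightarrow> pair_balls lab js2 (B - T) acc x = acc x"
    "\<And>acc a. a \<in> set js2 \<Longrightarrow> pair_balls lab js2 (B - T) acc (m' a) = lab a"
    using pair_balls_spec[OF d(2) finite_Diff[OF assms(2)], of _ lab] by metis
  have T'B: "T' \<subseteq> B - T" "bij_betw m' (set js2) T'" using T'(1) by (simp_all add: cyc_bij_def)
  have set1: "set js1 = {j \<in> C. t \<le> lab j}" "\<And>a. a \<in> set js2 \<Longrightarrow> lab a < t"
    using js(2) by (auto simp: js1_def js2_def)
  let ?acc = "\<lambda>j. if j \<in> B then r else 0"
  have res: "res = pair_balls lab js2 (B - T) (pair_balls lab js1 B ?acc)"
    unfolding res_def split T(4) ..
  have "t \<le> res x \<longleftrightarrow> x \<in> T" for x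
  proof -
    consider "x \<in> T" | "x \<in> T'" "x \<notin> T" | "x \<notin> T" "x \<notin> T'" by blast
    then show ?thesis
    proof cases
      case 1
      then obtain a where a: "a \<in> set js1" "x = m a" using TB(2) by (auto simp: bij_betw_def)
      have "x \<notin> T'" using 1 T'B(1) by auto
      then have "res x = lab a" unfolding res using T'(2)[of x] T(3)[OF a(1)] a(2) by simp
      then show ?thesis using 1 a(1) set1(1) by auto
    next
      case 2
      then obtain a where a: "a \<in> set js2" "x = m' a" using T'B(2) by (auto simp: bij_betw_def)
      have "res x = lab a" unfolding res using T'(3)[OF a(1)] a(2) by simp
      then show ?thesis using 2 a(1) set1(2)[of a] by auto
    next
      case 3
      then have "res x = ?acc x" unfolding res using T'(2)[of x] T(2)[of x] by simp
      then show ?thesis using 3 assms(4) by (auto split: if_splits)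
    qed
  qed
  then have "{x. t \<le> res x} = T" by blast
  then show ?thesis using T(1) set1(1) by auto
qed

lemma pair_balls_values:
  fixes lab :: "nat \<Rightarrow> nat"
  assumes "finite C" "finite B" "card C \<le> card B" "\<And>j. j \<in> C \<Longrightarrow> r \<le> lab j \<and> lab j \<le> u" "r \<le> u"
  defines "res \<equiv> pair_balls lab (pairing_order lab C) B (\<lambda>j. if j \<in> B then r else 0)"
  shows "x \<notin> B \<Longrightarrow> res x = 0" "x \<in> B \<Longrightarrow> r \<le> res x \<and> res x \<le> u"
proof -
  let ?js = "pairing_order lab C"
  have js: "distinct ?js" "set ?js = C" "length ?js \<le> card B"
    using assms(1,3) by (simp_all add: pairing_order_def)
  obtain T m where T: "cyc_bij m (set ?js) B T"
    "\<And>acc x. x \<notin> T \<Longrightarrow> pair_balls lab ?js B acc x = acc x"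
    "\<And>acc a. a \<in> set ?js \<Longrightarrow> pair_balls lab ?js B acc (m a) = lab a"
    using pair_balls_spec[OF js(1) assms(2) js(3), of lab] by metis
  have TB: "T \<subseteq> B" "T = m ` C" using T(1) js(2) by (auto simp: cyc_bij_def bij_betw_def)
  show "res x = 0" if "x \<notin> B"
  proof -
    have "x \<notin> T" using that TB(1) by auto
    then show ?thesis using that by (simp add: res_def T(2))
  qed
  show "r \<le> res x \<and> res x \<le> u" if "x \<in> B"
  proof (cases "x \<in> T")
    case True
    then obtain a where "a \<in> C" "x = m a" using TB(2) by auto
    then show ?thesis using js(2) assms(4) by (simp add: res_def T(3))
  next
    case False
    then show ?thesis using that assms(5) by (simp add: res_def T(2))
  qed
qed

section \<open>Labels and their level sets\<close>

definition fm_admissible :: "queue \<Rightarrow> bool" where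
  "fm_admissible Bs \<longleftrightarrow> (\<forall>B\<in>set Bs. finite B) \<and> sorted_wrt (\<lambda>B C. card C \<le> card B) Bs"

lemma fm_labels_values:
  "fm_admissible (B # Bs) \<Longrightarrow> (x \<notin> B \<longrightarrow> fm_labels r (B # Bs) x = 0) \<and>
    (x \<in> B \<longrightarrow> r \<le> fm_labels r (B # Bs) x \<and> fm_labels r (B # Bs) x \<le> r + length Bs)"
proof (induction Bs arbitrary: r B x)
  case (Cons C Bs)
  let ?lab = "fm_labels (Suc r) (C # Bs)"
  have adm: "fm_admissible (C # Bs)" "finite C" "finite B" "card C \<le> card B"
    using Cons.prems by (auto simp: fm_admissible_def)
  have lab: "r \<le> ?lab j \<and> ?lab j \<le> r + Suc (length Bs)" if "j \<in> C" for j
    using Cons.IH[OF adm(1), of j "Suc r"] that by simp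
  show ?case
    using pair_balls_values[where r = r and lab = ?lab and u = "r + Suc (length Bs)" and x = x, OF adm(2-4) lab]
    by (simp add: Let_def)
qed simp

definition fm_level :: "queue \<Rightarrow> nat \<Rightarrow> nat \<Rightarrow> nat set" where
  "fm_level M r t = {x. t \<le> fm_labels r (drop (r - 1) M) x}"

lemma fm_admissible_drop: "fm_admissible M \<Longrightarrow> fm_admissible (drop k M)"
  by (auto simp: fm_admissible_def sorted_wrt_drop dest: in_set_dropD)

lemma drop_row: "1 \<le> r \<Longrightarrow> r \<le> length M \<Longrightarrow> drop (r - 1) M = row M r # drop r M"
  using Cons_nth_drop_Suc[of "r - 1" M] by (simp add: row_def)

lemma fm_labels_drop_values:
  assumes "fm_admissible M" "1 \<le> r" "r \<le> length M"
  shows "x \<notin> row M r \<Longrightarrow> fm_labels r (drop (r - 1) M) x = 0"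
    "x \<in> row M r \<Longrightarrow> r \<le> fm_labels r (drop (r - 1) M) x"
  using fm_labels_values[of "row M r" "drop r M" x r] fm_admissible_drop[OF assms(1), of "r - 1"]
    drop_row[OF assms(2,3)] by simp_all

lemma fm_level_subset:
  assumes "fm_admissible M" "1 \<le> r" "r \<le> length M" "1 \<le> t"
  shows "fm_level M r t \<subseteq> row M r"
proof
  fix x assume "x \<in> fm_level M r t"
  then show "x \<in> row M r"
    using fm_labels_drop_values(1)[OF assms(1-3), of x] assms(4) by (cases "x \<in> row M r") (auto simp: fm_level_def)
qed

lemma fm_level_base:
  assumes "fm_admissible M" "1 \<le> r" "r \<le> length M"
  shows "fm_level M r r = row M r"
  using fm_level_subset[OF assms assms(2)] fm_labels_drop_values(2)[OF assms] by (auto simp: fm_level_def)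

lemma fm_level_step:
  assumes adm: "fm_admissible M" and r: "1 \<le> r" "r < length M" "r < t"
  shows "\<exists>m. cyc_bij m (fm_level M (Suc r) t) (row M r) (fm_level M r t)"
proof -
  let ?C = "row M (Suc r)" and ?B = "row M r"
  have d1: "drop (r - 1) M = ?B # drop r M" using drop_row[of r M] r by simp
  have d2: "drop r M = ?C # drop (Suc r) M" using drop_row[of "Suc r" M] r by simp
  let ?lab = "fm_labels (Suc r) (drop r M)"
  have a1: "fm_admissible (?B # ?C # drop (Suc r) M)"
    using fm_admissible_drop[OF adm, of "r - 1"] d1 d2 by simp
  then have a: "finite ?C" "finite ?B" "card ?C \<le> card ?B" by (auto simp: fm_admissible_def)
  have a2: "fm_admissible (?C # drop (Suc r) M)" using fm_admissible_drop[OF adm, of r] d2 by simp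
  have "{j \<in> ?C. t \<le> ?lab j} = fm_level M (Suc r) t"
    using fm_level_subset[OF adm, of "Suc r" t] r by (auto simp: fm_level_def)
  moreover have "fm_labels r (drop (r - 1) M) = pair_balls ?lab (pairing_order ?lab ?C) ?B (\<lambda>j. if j \<in> ?B then r else 0)"
    unfolding d1 by (subst (1 2 3) d2) (simp add: Let_def)
  then have "{x. t \<le> pair_balls ?lab (pairing_order ?lab ?C) ?B (\<lambda>j. if j \<in> ?B then r else 0) x} = fm_level M r t"
    by (simp add: fm_level_def)
  ultimately show ?thesis using pair_balls_level[OF a r(3), of ?lab] by simp
qed

lemma mlq_type_eq_iff:
  assumes "fm_admissible M" "fm_admissible M'" "length M' = length M" "1 \<le> length M"
    "row M 1 \<subseteq> {1..n}" "row M' 1 \<subseteq> {1..n}"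
  shows "mlq_type n M = mlq_type n M' \<longleftrightarrow> (\<forall>t\<in>{1..length M}. fm_level M 1 t = fm_level M' 1 t)"
proof
  have d: "M = row M 1 # drop 1 M" "M' = row M' 1 # drop 1 M'"
    using drop_row[of 1 M] drop_row[of 1 M'] assms by simp_all
  have v: "x \<notin> row M 1 \<longrightarrow> fm_labels 1 M x = 0" "x \<in> row M 1 \<longrightarrow> 1 \<le> fm_labels 1 M x \<and> fm_labels 1 M x \<le> length M" for x
    using fm_labels_values[of "row M 1" "drop 1 M" x 1] d(1) assms(1,4) by (simp_all, linarith)
  have v': "x \<notin> row M' 1 \<longrightarrow> fm_labels 1 M' x = 0" "x \<in> row M' 1 \<longrightarrow> 1 \<le> fm_labels 1 M' x \<and> fm_labels 1 M' x \<le> length M" for x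
    using fm_labels_values[of "row M' 1" "drop 1 M'" x 1] d(2) assms(2,3,4) by (simp_all, linarith)
  {
    assume "mlq_type n M = mlq_type n M'"
    then have eq: "fm_labels 1 M x = fm_labels 1 M' x" if "x \<in> {1..n}" for x
      using that by (auto simp: mlq_type_def simp del: upt_Suc)
    have "fm_labels 1 M x = fm_labels 1 M' x" for x
    proof (cases "x \<in> {1..n}")
      case False
      then have "x \<notin> row M 1" "x \<notin> row M' 1" using assms by auto
      then show ?thesis using v v' by simp
    qed (rule eq)
    then show "\<forall>t\<in>{1..length M}. fm_level M 1 t = fm_level M' 1 t" by (simp add: fm_level_def)
  }
  {
    assume lev: "\<forall>t\<in>{1..length M}. fm_level M 1 t = fm_level M' 1 t"
    have iff: "t \<le> fm_labels 1 M x \<longleftrightarrow> t \<le> fm_labels 1 M' x" for x t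
    proof (cases "t \<in> {1..length M}")
      case True
      then have "x \<in> fm_level M 1 t \<longleftrightarrow> x \<in> fm_level M' 1 t" using lev by simp
      then show ?thesis by (simp add: fm_level_def)
    next
      case False
      then have "t = 0 \<or> length M < t" by auto
      moreover have "fm_labels 1 M x \<le> length M" using v[of x] by (cases "x \<in> row M 1") simp_all
      moreover have "fm_labels 1 M' x \<le> length M" using v'[of x] by (cases "x \<in> row M' 1") simp_all
      ultimately show ?thesis by linarith
    qed
    have "fm_labels 1 M x = fm_labels 1 M' x" for x
      using iff[of "fm_labels 1 M x" x] iff[of "fm_labels 1 M' x" x] by simp
    then show "mlq_type n M = mlq_type n M'" by (simp add: mlq_type_def)
  }
qed

section \<open>Cyclic pairing as a reflection and as a matching\<close>

lemma card_le_imageI: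
  assumes "finite A" "B \<subseteq> m ` A"
  shows "card B \<le> card A"
  using assms card_image_le card_mono by (metis finite_imageI order_trans)

text \<open>No arc passes over the unpaired ball \<open>y\<close>. Paired balls of \<open>B\<close>
  in \<open>[y, c)\<close> are therefore reached from \<open>A\<close> within \<open>[y, c)\<close>,
  and each raised ball counts twice, so the height is strictly smaller right of \<open>y\<close>.
  Arcs starting in \<open>[c, y)\<close> also end there, so it is not larger to the left.\<close>

lemma cyc_bij_peak:
  assumes fin: "finite A" "finite B" and m: "cyc_bij m A B S"
    and R2: "R2 \<subseteq> B - S" "y \<in> R2" and min: "\<And>z. z \<in> B - S \<Longrightarrow> y \<le> z \<longleftrightarrow> z \<in> R2"
  shows "peak (A \<union> R2) (B - R2) y"
proof -
  have S: "S \<subseteq> B" and inj: "inj_on m A" and im: "m ` A = S" using m by (auto simp: cyc_bij_def bij_betw_def)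
  have le: "\<And>a z. z \<in> B - S \<Longrightarrow> a \<in> A \<Longrightarrow> a \<le> z \<Longrightarrow> a \<le> m a \<and> m a < z"
    and gt: "\<And>a z. z \<in> B - S \<Longrightarrow> a \<in> A \<Longrightarrow> z < a \<Longrightarrow> a \<le> m a \<or> m a < z"
    using m by (auto simp: cyc_bij_def)
  have y: "y \<in> B - S" using R2 by auto
  have disj: "A \<inter> R2 = {}" using le R2(1) by fastforce
  have finR: "finite R2" using R2(1) fin finite_subset by blast
  let ?H = "hgt (A \<union> R2) (B - R2)"
  have H: "hgt (A \<union> R2) (B - R2) c = hgt A B c + 2 * int (card (R2 \<inter> {c..}))" for c
  proof -
    have "card ((A \<union> R2) \<inter> {c..}) = card (A \<inter> {c..}) + card (R2 \<inter> {c..})"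
      using disj fin finR by (subst card_Un_disjoint[symmetric]) (auto simp: Int_Un_distrib2)
    moreover have "card (B \<inter> {c..}) = card ((B - R2) \<inter> {c..}) + card (R2 \<inter> {c..})"
    proof -
      have "B \<inter> {c..} = ((B - R2) \<inter> {c..}) \<union> (R2 \<inter> {c..})" using R2(1) by auto
      then show ?thesis using fin finR by (simp add: card_Un_disjoint disjoint_iff)
    qed
    ultimately show ?thesis by (simp add: hgt_def)
  qed
  show ?thesis
    unfolding peak_def
  proof (intro conjI allI impI)
    fix c
    have gtc: "?H c < ?H y" if "y < c" for c
    proof -
      have "S \<inter> {y..<c} \<subseteq> m ` (A \<inter> {y..<c})"
      proof
        fix s assume s: "s \<in> S \<inter> {y..<c}"
        then obtain a where a: "a \<in> A" "s = m a" using im by auto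
        then have "y < a" using le[OF y a(1)] s by fastforce
        then show "s \<in> m ` (A \<inter> {y..<c})" using gt[OF y a(1)] a s by auto
      qed
      then have "card (S \<inter> {y..<c}) \<le> card (A \<inter> {y..<c})" using card_le_imageI fin by blast
      moreover have "B \<inter> {y..<c} = (S \<inter> {y..<c}) \<union> (R2 \<inter> {y..<c})"
        using S R2(1) min by (auto, metis Diff_iff)
      then have "card (B \<inter> {y..<c}) \<le> card (S \<inter> {y..<c}) + card (R2 \<inter> {y..<c})" by (simp add: card_Un_le)
      moreover have "0 < card (R2 \<inter> {y..<c})" using R2(2) that finR by (auto simp: card_gt_0_iff)
      moreover have "card (R2 \<inter> {y..}) = card (R2 \<inter> {y..<c}) + card (R2 \<inter> {c..})"
      proof -
        have "R2 \<inter> {y..} = (R2 \<inter> {y..<c}) \<union> (R2 \<inter> {c..})" using that by auto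
        then show ?thesis using finR by (simp add: card_Un_disjoint disjoint_iff)
      qed
      ultimately show ?thesis using hgt_split[OF fin, of y c] that unfolding H by linarith
    qed
    show "?H c \<le> ?H y"
    proof (cases "y < c")
      case True
      then show ?thesis using gtc by (simp add: less_imp_le)
    next
      case False
      have "m ` (A \<inter> {c..<y}) \<subseteq> B \<inter> {c..<y}"
        using le[OF y] im S by (fastforce simp: less_imp_le)
      then have "card (A \<inter> {c..<y}) \<le> card (B \<inter> {c..<y})"
        using card_image[OF inj_on_subset[OF inj]] fin by (metis card_mono finite_Int inf_le1)
      moreover have "R2 \<inter> {c..} = R2 \<inter> {y..}" using False min R2(1) by fastforce
      ultimately show ?thesis using hgt_split[OF fin, of c y] False unfolding H by simp
    qed
    show "?H c < ?H y" if "y < c" using gtc[OF that] .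
  qed
qed

definition put_rows :: "nat \<Rightarrow> nat set \<Rightarrow> nat set \<Rightarrow> config \<Rightarrow> config" where
  "put_rows j U V X = {(r, c) \<in> X. r \<noteq> j \<and> r \<noteq> Suc j} \<union> Pair (Suc j) ` U \<union> Pair j ` V"

lemma put_rows_rows:
  "rowc (put_rows j U V X) (Suc j) = U" "rowc (put_rows j U V X) j = V"
  "r \<noteq> j \<Longrightarrow> r \<noteq> Suc j \<Longrightarrow> rowc (put_rows j U V X) r = rowc X r"
  by (auto simp: put_rows_def)

lemma put_rows_self: "put_rows j (rowc X (Suc j)) (rowc X j) X = X"
  by (auto simp: put_rows_def)

text \<open>The cyclically unmatched balls of the lower row, moved up, are exactly the ones which
  the vertical operator moves down again, from left to right.\<close>

lemma cyc_bij_reflection: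
  assumes fin: "finite X" and m: "cyc_bij m (rowc X (Suc j)) (rowc X j) S"
  defines "Y \<equiv> put_rows j (rowc X (Suc j) \<union> (rowc X j - S)) S X"
  defines "d \<equiv> card (rowc X j) - card (rowc X (Suc j))"
  shows "downs (replicate d j) Y = X \<and> reduced (replicate d j) Y"
proof -
  let ?A = "rowc X (Suc j)" and ?B = "rowc X j"
  let ?R = "?B - S"
  note finr = finite_Image_sing[OF fin]
  have S: "S \<subseteq> ?B" using m by (simp add: cyc_bij_def)
  have disj: "?A \<inter> ?R = {}" using m by (fastforce simp: cyc_bij_def)
  \<comment> \<open>Generalised to final segments \<open>R2\<close> of the unpaired balls: the
    minimum of \<open>R2\<close> is the peak, and after it has come down the rest is again a final
    segment.\<close>
  have main: "R2 \<subseteq> ?R \<Longrightarrow> (\<And>x z. x \<in> ?R \<Longrightarrow> z \<in> R2 \<Longrightarrow> z \<le> x \<Longrightarrow> x \<in> R2) \<Longrightarrow> card R2 = k \<Longrightarrow>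
      downs (replicate k j) (put_rows j (?A \<union> R2) (?B - R2) X) = X \<and>
      reduced (replicate k j) (put_rows j (?A \<union> R2) (?B - R2) X)" for R2 k
  proof (induction k arbitrary: R2)
    case 0
    then have "R2 = {}" using finr finite_subset by fastforce
    then show ?case by (simp add: put_rows_self)
  next
    case (Suc k)
    have finR: "finite R2" using Suc.prems(1) finr finite_subset by fastforce
    have ne: "R2 \<noteq> {}" using Suc.prems(3) by auto
    define y where "y = Min R2"
    have y: "y \<in> R2" "\<And>z. z \<in> R2 \<Longrightarrow> y \<le> z" using finR ne by (simp_all add: y_def)
    let ?Y = "put_rows j (?A \<union> R2) (?B - R2) X"
    have "peak (?A \<union> R2) (?B - R2) y"
    proof (rule cyc_bij_peak[OF finr finr m Suc.prems(1) y(1)])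
      fix z assume "z \<in> ?R"
      then show "y \<le> z \<longleftrightarrow> z \<in> R2" using y Suc.prems(2)[of z y] by blast
    qed
    then have pk: "peak (rowc ?Y (Suc j)) (rowc ?Y j) y" by (simp only: put_rows_rows)
    have eq: "?A \<union> R2 - {y} = ?A \<union> (R2 - {y})" "insert y (?B - R2) = ?B - (R2 - {y})"
      using disj y(1) Suc.prems(1) by auto
    have D: "down j ?Y = put_rows j (?A \<union> (R2 - {y})) (?B - (R2 - {y})) X"
      unfolding down_peak[OF pk] eq[symmetric] by (auto simp: put_rows_def)
    have neq: "down j ?Y \<noteq> ?Y"
    proof
      assume "down j ?Y = ?Y"
      then have "rowc (down j ?Y) j = rowc ?Y j" by simp
      then have "?B - (R2 - {y}) = ?B - R2" unfolding D put_rows_rows .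
      then show False using y(1) Suc.prems(1) by auto
    qed
    have "downs (replicate k j) (down j ?Y) = X \<and> reduced (replicate k j) (down j ?Y)"
      unfolding D
    proof (rule Suc.IH)
      show "R2 - {y} \<subseteq> ?R" "card (R2 - {y}) = k" using Suc.prems y(1) finR by auto
      fix x z assume xz: "x \<in> ?R" "z \<in> R2 - {y}" "z \<le> x"
      then show "x \<in> R2 - {y}" using Suc.prems(2)[of x z] y(2)[of z] by auto
    qed
    moreover have "reduced (replicate (Suc k) j) ?Y \<longleftrightarrow> reduced (replicate k j @ [j]) ?Y"
      by (simp only: replicate_append_same replicate_Suc)
    ultimately show ?case using neq by (simp only: downs_replicate_Suc reduced_append) simp
  qed
  have card: "card ?R = d"
    unfolding d_def using cyc_bij_card[OF m] S finr by (simp add: card_Diff_subset finite_subset)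
  have "?B - ?R = S" using S by auto
  then show ?thesis unfolding Y_def using main[OF order_refl _ card] by simp
qed

text \<open>Arcs starting in a window that ends at an unpaired ball stay inside and avoid that ball,
  so the window has too few balls of \<open>A\<close>. For a paired ball the witness is the window
  after the nearest unpaired ball to its left, or the window from column 0 if there is none.\<close>

lemma cyc_bij_matched_part:
  assumes fin: "finite A" "finite B" and m: "cyc_bij m A B S" and h: "\<And>x. hgt A B x \<le> 0"
  shows "S = matched_part A B"
proof -
  have S: "S \<subseteq> B" and inj: "inj_on m A" and im: "m ` A = S" using m by (auto simp: cyc_bij_def bij_betw_def)
  have le: "\<And>a z. z \<in> B - S \<Longrightarrow> a \<in> A \<Longrightarrow> a \<le> z \<Longrightarrow> a \<le> m a \<and> m a < z"
    and gt: "\<And>a z. z \<in> B - S \<Longrightarrow> a \<in> A \<Longrightarrow> z < a \<Longrightarrow> a \<le> m a \<or> m a < z"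
    using m by (auto simp: cyc_bij_def)
  note iff = matched_part_iff[OF fin]
  show ?thesis
  proof
    show "matched_part A B \<subseteq> S"
    proof (rule ccontr)
      assume "\<not> matched_part A B \<subseteq> S"
      then obtain c where c: "c \<in> B - S" "c \<in> matched_part A B" using matched_part_subset by blast
      then obtain a where a: "a \<le> c" "card (B \<inter> {a..<Suc c}) \<le> card (A \<inter> {a..<Suc c})"
        unfolding iff by blast
      have "m ` (A \<inter> {a..<Suc c}) \<subseteq> B \<inter> {a..<Suc c} - {c}"
        using le[OF c(1)] im S by (fastforce simp: less_Suc_eq_le)
      then have "card (A \<inter> {a..<Suc c}) \<le> card (B \<inter> {a..<Suc c} - {c})"
        using card_image[OF inj_on_subset[OF inj]] fin by (metis card_mono finite_Diff finite_Int inf_le1)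
      also have "\<dots> < card (B \<inter> {a..<Suc c})" using c(1) a(1) fin by (intro card_Diff1_less) auto
      finally show False using a(2) by simp
    qed
    show "S \<subseteq> matched_part A B"
    proof
      fix c assume c: "c \<in> S"
      have cover: "card (B \<inter> {a..<Suc c}) \<le> card (A \<inter> {a..<Suc c}) \<Longrightarrow> a \<le> c \<Longrightarrow> c \<in> matched_part A B" for a
        unfolding iff using c S by auto
      show "c \<in> matched_part A B"
      proof (cases "\<exists>y\<in>B - S. y < c")
        case True
        define y where "y = Max {y \<in> B - S. y < c}"
        have y: "y \<in> B - S" "y < c" and ymax: "\<And>z. z \<in> B - S \<Longrightarrow> z < c \<Longrightarrow> z \<le> y"
        proof -
          have f: "finite {y \<in> B - S. y < c}" "{y \<in> B - S. y < c} \<noteq> {}" using True fin by auto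
          show "y \<in> B - S" "y < c" using Max_in[OF f] unfolding y_def by blast+
          show "z \<le> y" if "z \<in> B - S" "z < c" for z
            unfolding y_def by (rule Max_ge[OF f(1)]) (use that in blast)
        qed
        have "B \<inter> {Suc y..<Suc c} \<subseteq> m ` (A \<inter> {Suc y..<Suc c})"
        proof
          fix s assume s: "s \<in> B \<inter> {Suc y..<Suc c}"
          have "s \<in> S"
          proof (rule ccontr)
            assume "s \<notin> S"
            then have "s \<in> B - S" "s < c" using s c by (auto simp: less_Suc_eq)
            then show False using ymax s by fastforce
          qed
          then obtain a where a: "a \<in> A" "s = m a" using im by auto
          then have "y < a" using le[OF y(1) a(1)] s by fastforce
          then show "s \<in> m ` (A \<inter> {Suc y..<Suc c})" using gt[OF y(1) a(1)] a s by auto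
        qed
        then show ?thesis using card_le_imageI[of "A \<inter> {Suc y..<Suc c}"] fin y(2) by (intro cover[of "Suc y"]) auto
      next
        case none: False
        show ?thesis
        proof (cases "B - S = {}")
          case True
          then have "card A = card B" using cyc_bij_card[OF m] S by (metis Diff_eq_empty_iff antisym)
          \<comment> \<open>As the total height is 0, \<open>hgt A B (Suc c) \<le> 0\<close> says
            that the columns up to \<open>c\<close> hold at least as many balls of \<open>A\<close>
            as of \<open>B\<close>.\<close>
          then have "hgt A B 0 = 0" by (simp add: hgt_0)
          then show ?thesis using hgt_split[OF fin, of 0 "Suc c"] h[of "Suc c"] by (intro cover[of 0]) auto
        next
          case False
          define y where "y = Max (B - S)"
          have y: "y \<in> B - S" and ymax: "\<And>z. z \<in> B - S \<Longrightarrow> z \<le> y"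
            using Max_in[of "B - S"] Max_ge[of "B - S"] False fin unfolding y_def by auto
          have "c < y" using none y c by (metis DiffD2 linorder_neqE_nat)
          \<comment> \<open>Counting with \<open>h\<close> turns this inclusion into an equality. So
            arcs starting right of the last unpaired ball \<open>y\<close> also end right of it, and
            none of them wraps around to the columns up to \<open>c\<close>.\<close>
          have sub: "B \<inter> {Suc y..} \<subseteq> m ` (A \<inter> {Suc y..})"
          proof
            fix s assume s: "s \<in> B \<inter> {Suc y..}"
            then have "s \<in> S" using ymax by fastforce
            then obtain a where a: "a \<in> A" "s = m a" using im by auto
            then have "y < a" using le[OF y a(1)] s by fastforce
            then show "s \<in> m ` (A \<inter> {Suc y..})" using a by auto
          qed
          have "card (m ` (A \<inter> {Suc y..})) \<le> card (A \<inter> {Suc y..})" using fin by (intro card_image_le) auto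
          also have "\<dots> \<le> card (B \<inter> {Suc y..})" using h[of "Suc y"] by (simp add: hgt_def)
          finally have eq: "B \<inter> {Suc y..} = m ` (A \<inter> {Suc y..})"
            using card_seteq[OF _ sub] fin by simp
          have "B \<inter> {0..<Suc c} \<subseteq> m ` (A \<inter> {0..<Suc c})"
          proof
            fix s assume s: "s \<in> B \<inter> {0..<Suc c}"
            then have "s \<in> S" using none c by (auto simp: less_Suc_eq)
            then obtain a where a: "a \<in> A" "s = m a" using im by auto
            have "\<not> y < a"
            proof
              assume "y < a"
              then have "m a \<in> B \<inter> {Suc y..}" unfolding eq using a by auto
              then show False using a s \<open>c < y\<close> by auto
            qed
            then have "a \<le> m a" using le[OF y a(1)] by simp
            then show "s \<in> m ` (A \<inter> {0..<Suc c})" using a s by auto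
          qed
          then show ?thesis using card_le_imageI[of "A \<inter> {0..<Suc c}"] fin by (intro cover[of 0]) auto
        qed
      qed
    qed
  qed
qed

text \<open>Any greedy pairing has the matched part as its image; the one that treats
  \<open>A\<close> in increasing order exists by \<open>pair_balls_spec\<close>.\<close>

lemma card_matched_part:
  assumes fin: "finite A" "finite B" and h: "\<And>x. hgt A B x \<le> 0"
  shows "card (matched_part A B) = card A"
proof -
  have "length (sorted_list_of_set A) \<le> card B" using h[of 0] by (simp add: hgt_0)
  then obtain T m where "cyc_bij m (set (sorted_list_of_set A)) B T"
    using pair_balls_spec[of "sorted_list_of_set A" B] fin by fastforce
  then have m: "cyc_bij m A B T" using fin by simp
  show ?thesis using cyc_bij_matched_part[OF fin m h] cyc_bij_card[OF m] by simp
qed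

subsection \<open>Components and types\<close>

lemma hgt_mono1: "finite A' \<Longrightarrow> A \<subseteq> A' \<Longrightarrow> hgt A B x \<le> hgt A' B x"
  by (simp add: hgt_def) (meson Int_mono card_mono finite_Int order_refl)

lemma fm_admissibleI:
  assumes "\<And>r. 1 \<le> r \<Longrightarrow> r \<le> length M \<Longrightarrow> finite (row M r)"
    "\<And>r. 1 \<le> r \<Longrightarrow> r < length M \<Longrightarrow> card (row M (Suc r)) \<le> card (row M r)"
  shows "fm_admissible M"
proof -
  have "sorted_wrt (\<lambda>B C. card C \<le> card B) M"
  proof (subst sorted_wrt_iff_nth_Suc_transp)
    show "transp (\<lambda>B C :: nat set. card C \<le> card B)" by (auto simp: transp_def)
    show "\<forall>i. Suc i < length M \<longrightarrow> card (M ! Suc i) \<le> card (M ! i)"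
    proof (intro allI impI)
      fix i assume "Suc i < length M"
      then show "card (M ! Suc i) \<le> card (M ! i)" using assms(2)[of "Suc i"] by (simp add: row_def)
    qed
  qed
  moreover have "finite B" if "B \<in> set M" for B
  proof -
    obtain i where "i < length M" "B = M ! i" using \<open>B \<in> set M\<close> by (auto simp: in_set_conv_nth)
    then show ?thesis using assms(1)[of "Suc i"] by (simp add: row_def)
  qed
  ultimately show ?thesis by (simp add: fm_admissible_def)
qed

lemma conj_part_antimono: "r \<le> s \<Longrightarrow> conj_part lam s \<le> conj_part lam r"
  unfolding conj_part_def by (intro card_mono) auto

lemma MLQ_admissible:
  assumes "M \<in> MLQ n lam"
  shows "fm_admissible M"
proof (rule fm_admissibleI)
  have M: "length M = largest_part lam" "\<And>r. 1 \<le> r \<Longrightarrow> r \<le> length M \<Longrightarrow> row M r \<subseteq> {1..n} \<and> card (row M r) = conj_part lam r"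
    using assms by (auto simp: MLQ_def)
  show "finite (row M r)" if "1 \<le> r" "r \<le> length M" for r
    using M(2)[OF that] finite_subset by blast
  show "card (row M (Suc r)) \<le> card (row M r)" if "1 \<le> r" "r < length M" for r
    using M(2)[of r] M(2)[of "Suc r"] that conj_part_antimono[of r "Suc r"] by simp
qed

text \<open>The balls of row 1 with label at least \<open>k\<close> are carried down from row \<open>k\<close>; undoing the
  vertical moves turns them into the complete bottom row of a configuration.\<close>

lemma fm_level_lift:
  assumes k: "1 \<le> k" "k \<le> largest_part lam" and r: "r \<le> k" "1 \<le> r"
  shows "\<exists>js. set js \<subseteq> {r..<k} \<and> (\<forall>M\<in>MLQ n lam. \<exists>Y. Y \<subseteq> box (largest_part lam) n \<and>
    reduced js Y \<and> downs js Y = balls M \<and> rowc Y r = fm_level M r k \<and>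
    card (rowc Y r) = conj_part lam k \<and> (\<forall>s<r. rowc Y s = rowc (balls M) s))"
  using r
proof (induction r rule: inc_induct)
  case base
  have "fm_level M k k = rowc (balls M) k \<and> card (rowc (balls M) k) = conj_part lam k \<and>
      balls M \<subseteq> box (largest_part lam) n" if "M \<in> MLQ n lam" for M
    using fm_level_base[OF MLQ_admissible[OF that] k(1)] that k by (auto simp: MLQ_iff rowc_balls)
  then show ?case by (intro exI[of _ "[]"]) auto
next
  case (step r)
  let ?L = "largest_part lam"
  obtain js where js: "set js \<subseteq> {Suc r..<k}"
    and lift: "\<And>M. M \<in> MLQ n lam \<Longrightarrow> \<exists>Y. Y \<subseteq> box ?L n \<and>
    reduced js Y \<and> downs js Y = balls M \<and> rowc Y (Suc r) = fm_level M (Suc r) k \<and>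
    card (rowc Y (Suc r)) = conj_part lam k \<and> (\<forall>s<Suc r. rowc Y s = rowc (balls M) s)"
    using step.IH by auto
  \<comment> \<open>The number of balls of row \<open>r\<close> left unpaired by labels \<ge>
    \<open>k\<close>. It depends on the shape only, so the same word \<open>js\<close> serves all
    queues, which \<open>lift_sim\<close> relies on.\<close>
  let ?d = "conj_part lam r - conj_part lam k"
  have rk: "r < k" "r < ?L" using step.hyps k by auto
  have "\<exists>Z. Z \<subseteq> box ?L n \<and> reduced (js @ replicate ?d r) Z \<and> downs (js @ replicate ?d r) Z = balls M \<and>
    rowc Z r = fm_level M r k \<and> card (rowc Z r) = conj_part lam k \<and> (\<forall>s<r. rowc Z s = rowc (balls M) s)"
    if M: "M \<in> MLQ n lam" for M
  proof -
    obtain Y where Y: "Y \<subseteq> box ?L n" "reduced js Y" "downs js Y = balls M" "rowc Y (Suc r) = fm_level M (Suc r) k"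
      "card (rowc Y (Suc r)) = conj_part lam k" "\<forall>s<Suc r. rowc Y s = rowc (balls M) s"
      using lift[OF M] by blast
    have len: "length M = ?L" using M by (simp add: MLQ_iff)
    have B: "rowc Y r = row M r" "card (rowc Y r) = conj_part lam r"
      using Y(6) step.prems rk M by (auto simp: rowc_balls MLQ_iff)
    obtain m where m: "cyc_bij m (rowc Y (Suc r)) (rowc Y r) (fm_level M r k)"
      using fm_level_step[OF MLQ_admissible[OF M] step.prems _ rk(1)] rk(2) len Y(4) B(1) by auto
    let ?S = "fm_level M r k"
    let ?Z = "put_rows r (rowc Y (Suc r) \<union> (rowc Y r - ?S)) ?S Y"
    have S: "?S \<subseteq> rowc Y r" using m by (simp add: cyc_bij_def)
    have "downs (replicate ?d r) ?Z = Y \<and> reduced (replicate ?d r) ?Z"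
      using cyc_bij_reflection[OF finite_box[OF Y(1)] m] Y(5) B(2) by simp
    moreover have "?Z \<subseteq> box ?L n" using Y(1) S rk(2) by (auto simp: put_rows_def)
    moreover have "rowc ?Z r = ?S" by (rule put_rows_rows(2))
    moreover have "card ?S = conj_part lam k" using cyc_bij_card[OF m] Y(5) by simp
    moreover have "\<forall>s<r. rowc ?Z s = rowc (balls M) s"
    proof (intro allI impI)
      fix s assume "s < r"
      then show "rowc ?Z s = rowc (balls M) s" using put_rows_rows(3)[of s r] Y(6) by simp
    qed
    ultimately show ?thesis using Y(2,3) by (intro exI[of _ ?Z]) (simp add: reduced_append)
  qed
  moreover have "set (js @ replicate ?d r) \<subseteq> {r..<k}" using js rk by auto
  ultimately show ?case by blast
qed

text \<open>A column move on a queue lifts to the same move above it: it commutes with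
  \<open>js\<close> and keeps \<open>js\<close> reduced, and by \<open>reduced_inj\<close> there is
  only one lift. A path of crystal edges thus lifts step by step.\<close>

lemma lift_sim:
  assumes "equivclp (crystal_edge n lam) M M'" "M \<in> MLQ n lam"
    and ex: "\<And>M. M \<in> MLQ n lam \<Longrightarrow> \<exists>Y. finite Y \<and> reduced js Y \<and> downs js Y = balls M"
    and Y: "finite Y" "reduced js Y" "downs js Y = balls M"
    and Y': "finite Y'" "reduced js Y'" "downs js Y' = balls M'"
  shows "sim n Y Y'"
  using assms(1) Y'
proof (induction arbitrary: Y' rule: equivclp_induct)
  case base
  then have "Y = Y'" using reduced_inj Y by metis
  then show ?case by (simp add: sim_refl)
next
  case (step M1 M2)
  have M1: "M1 \<in> MLQ n lam" using equivclp_edge_sim[OF step.hyps(1) assms(2)] by simp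
  show ?case
    using step.hyps(2)
  proof
    assume "crystal_edge n lam M1 M2"
    then obtain i where i: "1 \<le> i" "i < n" "M2 = f_right n i M1" by (auto simp: crystal_edge_def)
    obtain Y1 where Y1: "finite Y1" "reduced js Y1" "downs js Y1 = balls M1" using ex[OF M1] by blast
    have "downs js (right i Y1) = downs js Y'"
      using MLQ_f_right(2)[OF M1 i(1,2)] i(3) Y1 step.prems by (simp add: downs_right)
    then have "right i Y1 = Y'"
      using reduced_inj[of "right i Y1" Y' js] Y1 step.prems by (simp add: finite_right reduced_right)
    then show ?thesis using step.IH[OF Y1] sim_right[of i n Y1] i sim_trans by fastforce
  next
    assume "crystal_edge n lam M2 M1"
    then obtain i where i: "1 \<le> i" "i < n" "M1 = f_right n i M2" "M2 \<in> MLQ n lam"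
      by (auto simp: crystal_edge_def)
    have "sim n Y (right i Y')"
      using step.prems i MLQ_f_right(2)[OF i(4,1,2)]
      by (intro step.IH) (simp_all add: finite_right reduced_right downs_right)
    then show ?thesis using sim_sym[OF sim_right[of i n Y']] i sim_trans by fastforce
  qed
qed

lemma card_push:
  assumes fin: "\<And>r. finite (N r)" and h: "\<And>j x. 1 \<le> j \<Longrightarrow> j \<le> r \<Longrightarrow> hgt (N (Suc j)) (N j) x \<le> 0"
    and Y: "Y \<subseteq> N (Suc r)"
  shows "card (push N r Y) = card Y"
  using h Y
proof (induction r arbitrary: Y)
  case (Suc r)
  have "hgt Y (N (Suc r)) x \<le> 0" for x
    using hgt_mono1[OF fin Suc.prems(2), of "N (Suc r)" x] Suc.prems(1)[of "Suc r" x] by simp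
  then have "card (matched_part Y (N (Suc r))) = card Y"
    using Suc.prems(2) fin finite_subset by (intro card_matched_part) blast+
  then show ?case using Suc matched_part_subset by simp
qed simp

text \<open>Descending induction on \<open>m\<close>. Pushed to the bottom, row \<open>m\<close>
  before its step of the sweep lies between the set for row \<open>m + 1\<close>, known by
  induction, and the push of the whole row \<open>N m\<close>, known by assumption; its size is
  known because pushing between nonwrapping rows preserves sizes. So
  \<open>initial_ext_unique\<close> applies, and \<open>m = 1\<close> gives row 1 of
  \<open>X\<close>.\<close>

lemma up_bottom_determined:
  assumes fin: "finite X" "finite X'" and L: "1 \<le> L"
  defines "N \<equiv> rowc (up X (L - 1))" and "N' \<equiv> rowc (up X' (L - 1))"
  assumes h: "\<And>j x. 1 \<le> j \<Longrightarrow> j < L \<Longrightarrow> hgt (N (Suc j)) (N j) x \<le> 0 \<and> hgt (N' (Suc j)) (N' j) x \<le> 0"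
    and push: "\<And>t. 1 \<le> t \<Longrightarrow> t \<le> L \<Longrightarrow> push N (t - 1) (N t) = push N' (t - 1) (N' t)"
    and card: "\<And>m. 1 \<le> m \<Longrightarrow> m \<le> L \<Longrightarrow> card (rowc (up X (m - 1)) m) = card (rowc (up X' (m - 1)) m)"
  shows "rowc X 1 = rowc X' 1"
proof -
  have finN: "finite (N r)" "finite (N' r)" for r
    unfolding N_def N'_def using fin by (simp_all add: finite_up finite_Image_sing)
  have "push N (m - 1) (rowc (up X (m - 1)) m) = push N' (m - 1) (rowc (up X' (m - 1)) m)" if "m \<le> L" "1 \<le> m" for m
    using that
  proof (induction m rule: inc_induct)
    case base
    then show ?case using push[of L] L by (simp add: N_def N'_def)
  next
    case (step m)
    have *: "initial_ext (push N m (rowc (up X m) (Suc m))) (push N (m - 1) (N m)) (push N (m - 1) (rowc (up X (m - 1)) m))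
        \<and> finite (push N (m - 1) (N m)) \<and> card (push N (m - 1) (rowc (up X (m - 1)) m)) = card (rowc (up X (m - 1)) m)"
      if X: "finite X" "N = rowc (up X (L - 1))"
        and h: "\<And>j x. 1 \<le> j \<Longrightarrow> j < L \<Longrightarrow> hgt (N (Suc j)) (N j) x \<le> 0" for X N
    proof -
      have finN: "finite (N r)" for r
        unfolding X(2) using X(1) by (simp add: finite_up finite_Image_sing)
      have ext: "initial_ext (matched_part (rowc (up X m) (Suc m)) (N m)) (N m) (rowc (up X (m - 1)) m)"
        using up_initial_ext[OF X(1), of m L] step X(2) by simp
      have m: "m = Suc (m - 1)" using step.prems by simp
      have "push N m (rowc (up X m) (Suc m)) = push N (m - 1) (matched_part (rowc (up X m) (Suc m)) (N m))"
        using push.simps(2)[of N "m - 1" "rowc (up X m) (Suc m)"] unfolding m[symmetric] .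
      moreover have "card (push N (m - 1) (rowc (up X (m - 1)) m)) = card (rowc (up X (m - 1)) m)"
      proof (rule card_push[OF finN])
        show "hgt (N (Suc j)) (N j) x \<le> 0" if "1 \<le> j" "j \<le> m - 1" for j x
          using h that step.hyps by simp
        show "rowc (up X (m - 1)) m \<subseteq> N (Suc (m - 1))" using ext unfolding m[symmetric] by (simp add: initial_ext_def)
      qed
      ultimately show ?thesis using push_initial_ext[where r = "m - 1", OF finN ext finN] by simp
    qed
    note a = *[OF fin(1) N_def[THEN meta_eq_to_obj_eq] conjunct1[OF h]]
      and b = *[OF fin(2) N'_def[THEN meta_eq_to_obj_eq] conjunct2[OF h]]
    have "push N m (rowc (up X m) (Suc m)) = push N' m (rowc (up X' m) (Suc m))" using step.IH by simp
    moreover have "push N (m - 1) (N m) = push N' (m - 1) (N' m)" using push step by simp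
    moreover have "card (rowc (up X (m - 1)) m) = card (rowc (up X' (m - 1)) m)" using card step by simp
    ultimately show ?case using a b initial_ext_unique by metis
  qed
  from this[of 1] L show ?thesis by simp
qed

text \<open>Between nonwrapping rows each labelling step is a plain matching by
  \<open>cyc_bij_matched_part\<close>, and passing to a subset of the upper row keeps the pair
  nonwrapping.\<close>

lemma push_fm_level:
  assumes adm: "fm_admissible N" and h: "\<And>j x. 1 \<le> j \<Longrightarrow> j < length N \<Longrightarrow> hgt (row N (Suc j)) (row N j) x \<le> 0"
    and t: "t \<le> length N" and eq: "\<And>r. 1 \<le> r \<Longrightarrow> r \<le> length N \<Longrightarrow> Nf r = row N r"
  shows "r < t \<Longrightarrow> push Nf r (fm_level N (Suc r) t) = fm_level N 1 t"
proof (induction r)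
  case (Suc r)
  have fin: "finite (row N j)" if "1 \<le> j" "j \<le> length N" for j
    using adm that by (auto simp: fm_admissible_def row_def)
  have sub: "fm_level N (Suc (Suc r)) t \<subseteq> row N (Suc (Suc r))"
    using fm_level_subset[OF adm] Suc.prems t by simp
  have f: "finite (row N (Suc (Suc r)))" "finite (row N (Suc r))" using fin Suc.prems t by simp_all
  obtain m where m: "cyc_bij m (fm_level N (Suc (Suc r)) t) (row N (Suc r)) (fm_level N (Suc r) t)"
    using fm_level_step[OF adm, of "Suc r" t] Suc.prems t by auto
  have "hgt (fm_level N (Suc (Suc r)) t) (row N (Suc r)) x \<le> 0" for x
    using hgt_mono1[OF f(1) sub, of "row N (Suc r)" x] h[of "Suc r" x] Suc.prems t by simp
  then have "fm_level N (Suc r) t = matched_part (fm_level N (Suc (Suc r)) t) (row N (Suc r))"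
    using cyc_bij_matched_part[OF finite_subset[OF sub f(1)] f(2) m] by blast
  then show ?case using Suc eq[of "Suc r"] t by simp
qed simp

lemma downs_row_other: "(\<And>j. j \<in> set js \<Longrightarrow> r \<noteq> j \<and> r \<noteq> Suc j) \<Longrightarrow> rowc (downs js X) r = rowc X r"
  by (induction js) (auto simp: down_row_other)

lemma rho_N_balls:
  assumes "M \<in> MLQ n lam"
  shows "balls (rho_N n M) = coll (balls M) (largest_part lam)" "length (rho_N n M) = largest_part lam"
    "balls (rho_N n M) \<subseteq> box (largest_part lam) n"
    "\<And>j. 1 \<le> j \<Longrightarrow> j < largest_part lam \<Longrightarrow> down j (balls (rho_N n M)) = balls (rho_N n M)"
  using collapse_balls[of M n "length M"] coll_fixed[of "balls M" "largest_part lam" n] assms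
  by (simp_all add: MLQ_iff rho_N_def)

lemma nonwrapping_admissible:
  assumes "balls N \<subseteq> box (length N) n" "\<And>j. 1 \<le> j \<Longrightarrow> j < length N \<Longrightarrow> down j (balls N) = balls N"
  shows "fm_admissible N"
    and "\<And>j x. 1 \<le> j \<Longrightarrow> j < length N \<Longrightarrow> hgt (row N (Suc j)) (row N j) x \<le> 0"
proof -
  note fin = finite_box[OF assms(1)]
  show h: "hgt (row N (Suc j)) (row N j) x \<le> 0" if "1 \<le> j" "j < length N" for j x
    using assms(2)[OF that] down_fixed_iff[OF fin, of j] rowc_balls[of j N] rowc_balls[of "Suc j" N] that by simp
  show "fm_admissible N"
  proof (rule fm_admissibleI)
    show "finite (row N r)" if "1 \<le> r" "r \<le> length N" for r
      using finite_Image_sing[OF fin, of r] rowc_balls[OF that] by simp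
    show "card (row N (Suc r)) \<le> card (row N r)" if "1 \<le> r" "r < length N" for r
      using h[OF that, of 0] by (simp add: hgt_0)
  qed
qed

lemma type_determined:
  assumes comp: "same_component n lam M M'"
    and type: "mlq_type n (rho_N n M) = mlq_type n (rho_N n M')"
  shows "mlq_type n M = mlq_type n M'"
proof (cases "largest_part lam = 0")
  case True
  then have "M = []" "M' = []" using comp by (auto simp: same_component_def MLQ_def)
  then show ?thesis by simp
next
  case False
  define L where "L = largest_part lam"
  have L: "1 \<le> L" using False by (simp add: L_def)
  have M: "M \<in> MLQ n lam" "M' \<in> MLQ n lam" and eqv: "equivclp (crystal_edge n lam) M M'"
    using comp by (auto simp: same_component_def)
  have len: "length M = L" "length M' = L" and bM: "balls M \<subseteq> box L n" "balls M' \<subseteq> box L n"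
    using M by (auto simp: MLQ_iff L_def)
  let ?N = "rho_N n M" and ?N' = "rho_N n M'"
  note N = rho_N_balls[OF M(1), folded L_def] and N' = rho_N_balls[OF M(2), folded L_def]
  have adm: "fm_admissible ?N" "fm_admissible ?N'"
    and hN: "\<And>j x. 1 \<le> j \<Longrightarrow> j < L \<Longrightarrow> hgt (row ?N (Suc j)) (row ?N j) x \<le> 0 \<and> hgt (row ?N' (Suc j)) (row ?N' j) x \<le> 0"
    using nonwrapping_admissible[of ?N n] nonwrapping_admissible[of ?N' n] N N' by simp_all
  have rows: "rowc (balls ?N) r = row ?N r" "rowc (balls ?N') r = row ?N' r" if "1 \<le> r" "r \<le> L" for r
    using that N(2) N'(2) by (simp_all add: rowc_balls)
  have levN: "fm_level ?N 1 t = fm_level ?N' 1 t" if "1 \<le> t" "t \<le> L" for t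
  proof -
    have "rowc (balls ?N) 1 \<subseteq> {1..n}" "rowc (balls ?N') 1 \<subseteq> {1..n}"
      using N(3) N'(3) by auto
    then have "row ?N 1 \<subseteq> {1..n}" "row ?N' 1 \<subseteq> {1..n}" using rows[OF order_refl L] by simp_all
    then show ?thesis using mlq_type_eq_iff[OF adm] type L N(2) N'(2) that by simp
  qed
  have pushN: "push (rowc (balls ?N)) (t - 1) (rowc (balls ?N) t) = push (rowc (balls ?N')) (t - 1) (rowc (balls ?N') t)"
    if t: "1 \<le> t" "t \<le> L" for t
  proof -
    have "push (rowc (balls ?N)) (t - 1) (rowc (balls ?N) t) = fm_level ?N 1 t"
      using push_fm_level[OF adm(1), of t "rowc (balls ?N)" "t - 1"] hN rows fm_level_base[OF adm(1) t(1)] N(2) t by simp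
    moreover have "push (rowc (balls ?N')) (t - 1) (rowc (balls ?N') t) = fm_level ?N' 1 t"
      using push_fm_level[OF adm(2), of t "rowc (balls ?N')" "t - 1"] hN rows fm_level_base[OF adm(2) t(1)] N'(2) t by simp
    ultimately show ?thesis using levN t by simp
  qed
  have "fm_level M 1 k = fm_level M' 1 k" if k: "1 \<le> k" "k \<le> L" for k
  proof -
    obtain js where js: "set js \<subseteq> {1..<k}" and all: "\<forall>M\<in>MLQ n lam. \<exists>Y. Y \<subseteq> box L n \<and>
        reduced js Y \<and> downs js Y = balls M \<and> rowc Y 1 = fm_level M 1 k \<and>
        card (rowc Y 1) = conj_part lam k \<and> (\<forall>s<1. rowc Y s = rowc (balls M) s)"
      using fm_level_lift[OF k(1) k(2)[unfolded L_def] k(1) order_refl, of n, folded L_def] by (elim exE conjE)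
    have lift: "\<exists>Y. Y \<subseteq> box L n \<and> reduced js Y \<and> downs js Y = balls M \<and> rowc Y 1 = fm_level M 1 k"
      if "M \<in> MLQ n lam" for M
      using bspec[OF all that] by (elim exE conjE) (intro exI conjI)
    obtain Y where Y: "Y \<subseteq> box L n" "reduced js Y" "downs js Y = balls M" "rowc Y 1 = fm_level M 1 k"
      using lift[OF M(1)] by blast
    obtain Y' where Y': "Y' \<subseteq> box L n" "reduced js Y'" "downs js Y' = balls M'" "rowc Y' 1 = fm_level M' 1 k"
      using lift[OF M(2)] by blast
    note fin = finite_box[OF Y(1)] and fin' = finite_box[OF Y'(1)]
    have sim: "sim n Y Y'"
    proof (rule lift_sim[OF eqv M(1) _ fin Y(2,3) fin' Y'(2,3)])
      fix M assume "M \<in> MLQ n lam"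
      from lift[OF this] obtain Z where Z: "Z \<subseteq> box L n" "reduced js Z" "downs js Z = balls M"
        by (elim exE conjE)
      then show "\<exists>Y. finite Y \<and> reduced js Y \<and> downs js Y = balls M"
        using finite_box[OF Z(1)] by (intro exI[of _ Z] conjI)
    qed
    \<comment> \<open>Putting the rows above the first in order leaves row 1, and with it the label
      set, untouched. The same word works for \<open>Y'\<close> because fixedness is constant along
      column moves.\<close>
    obtain w where w: "set w \<subseteq> {2..<L}" "\<forall>j\<in>{2..<L}. down j (downs w Y) = downs w Y"
      using exists_down_fixed[OF Y(1), of "{2..<L}"] by auto
    have simX: "sim n (downs w Y) (downs w Y')"
      using sim_map[OF sim fin, of "downs w"] by (simp add: downs_right)
    have w': "\<forall>j\<in>{2..<L}. down j (downs w Y') = downs w Y'"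
    proof
      fix j assume "j \<in> {2..<L}"
      then show "down j (downs w Y') = downs w Y'"
        using sim_invariant[OF simX finite_downs[OF fin], of "\<lambda>X. down j X = X"] w(2) down_right_fixed_iff by simp
    qed
    \<comment> \<open>Two routes lead down from \<open>Y\<close>: \<open>w\<close> followed by the
      sweep, or \<open>js\<close> back to the queue followed by collapsing. Both ends are
      nonwrapping, so \<open>downs_fixed_unique\<close> identifies them.\<close>
    have up_eq: "up (downs w Y) (L - 1) = coll (balls M) L"
      if Y: "Y \<subseteq> box L n" "downs js Y = balls M" "\<forall>j\<in>{2..<L}. down j (downs w Y) = downs w Y"
        and M: "balls M \<subseteq> box L n" for Y M
    proof -
      have X: "downs w Y \<subseteq> box L n" using box_downs[OF Y(1)] w(1) by fastforce
      obtain v where v: "set v \<subseteq> {1..L - 1}" "up (downs w Y) (L - 1) = downs (v @ w) Y"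
        using up_downs[of "L - 1" "downs w Y"] by auto
      obtain u where u: "set u \<subseteq> {1..<L}" "coll (balls M) L = downs (u @ js) Y"
        using coll_downs[of L "balls M"] Y(2) by auto
      have "downs (v @ w) Y = downs (u @ js) Y"
      proof (rule downs_fixed_unique[OF Y(1)])
        have "{1..L - 1} = {1..<L}" "{2..<L} \<subseteq> {1..<L}" "{1..<k} \<subseteq> {1..<L}" using L k by auto
        then show "set (v @ w) \<subseteq> {1..<L}" "set (u @ js) \<subseteq> {1..<L}"
          using v(1) w(1) u(1) js unfolding set_append by blast+
        show "down j (downs (v @ w) Y) = downs (v @ w) Y" if "j \<in> {1..<L}" for j
          using up_fixed[OF X, of j] Y(3) that v(2) by simp
        show "down j (downs (u @ js) Y) = downs (u @ js) Y" if "j \<in> {1..<L}" for j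
          using coll_fixed[OF M, of j] that u(2) by simp
      qed
      then show ?thesis using u v by simp
    qed
    have upN: "up (downs w Y) (L - 1) = balls ?N" "up (downs w Y') (L - 1) = balls ?N'"
      using up_eq[OF Y(1,3) w(2) bM(1)] up_eq[OF Y'(1,3) w' bM(2)] N(1) N'(1) by simp_all
    have "rowc (downs w Y) 1 = rowc (downs w Y') 1"
    proof (rule up_bottom_determined[where L = L, OF finite_downs[OF fin, of w] finite_downs[OF fin', of w] L, unfolded upN])
      show "hgt (rowc (balls ?N) (Suc j)) (rowc (balls ?N) j) x \<le> 0 \<and> hgt (rowc (balls ?N') (Suc j)) (rowc (balls ?N') j) x \<le> 0"
        if "1 \<le> j" "j < L" for j x
        using hN[OF that, of x] rows[of j] rows[of "Suc j"] that by simp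
      show "push (rowc (balls ?N)) (t - 1) (rowc (balls ?N) t) = push (rowc (balls ?N')) (t - 1) (rowc (balls ?N') t)"
        if "1 \<le> t" "t \<le> L" for t using pushN[OF that] .
      \<comment> \<open>The sweep commutes with column moves, which preserve row sizes at each of
        its stages.\<close>
      show "card (rowc (up (downs w Y) (m - 1)) m) = card (rowc (up (downs w Y') (m - 1)) m)" for m
        using sim_invariant[OF simX finite_downs[OF fin], of "\<lambda>X. card (rowc (up X (m - 1)) m)"]
        by (simp add: up_right card_row_right finite_up)
    qed
    moreover have "rowc (downs w Z) 1 = rowc Z 1" for Z
      using w(1) by (intro downs_row_other) auto
    ultimately show ?thesis using Y(4) Y'(4) by simp
  qed
  moreover have "row M 1 \<subseteq> {1..n}" "row M' 1 \<subseteq> {1..n}"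
    using M L by (auto simp: MLQ_def L_def)
  ultimately show ?thesis
    using mlq_type_eq_iff[OF MLQ_admissible[OF M(1)] MLQ_admissible[OF M(2)]] len L by simp
qed

section \<open>The recording tableau and its fibres\<close>

lemma rec_tab_cong:
  assumes "\<And>i j. 1 \<le> j \<Longrightarrow> j \<le> i \<Longrightarrow> i \<le> k \<Longrightarrow> card (row (collapse n M i) j) = card (row (collapse n M' i) j)"
  shows "rec_tab n M k = rec_tab n M' k"
  using assms
proof (induction k)
  case (Suc k)
  have "rec_tab n M k = rec_tab n M' k" using Suc by simp
  then show ?case using Suc.prems by (auto simp del: collapse.simps upt_Suc)
qed simp

lemma length_rec_tab: "length (rec_tab n M k) = k"
  by (induction k) simp_all

lemma rec_tab_entries: "x \<in> set R \<Longrightarrow> R \<in> set (rec_tab n M k) \<Longrightarrow> x \<le> k"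
proof (induction k arbitrary: R x)
  case (Suc k)
  have "R \<in> (\<lambda>j. row (rec_tab n M k) j @ replicate (card (row (collapse n M (Suc k)) j) -
      card (row (collapse n M k) j)) (Suc k)) ` {1..k} \<union> {replicate (card (row (collapse n M (Suc k)) (Suc k))) (Suc k)}"
    using Suc.prems(2) by (simp add: atLeastLessThanSuc_atLeastAtMost disj_commute del: collapse.simps upt_Suc)
  then consider j where "j \<in> {1..k}" "R = row (rec_tab n M k) j @
      replicate (card (row (collapse n M (Suc k)) j) - card (row (collapse n M k) j)) (Suc k)"
    | "R = replicate (card (row (collapse n M (Suc k)) (Suc k))) (Suc k)"
    by blast
  then show ?case
  proof cases
    case 1
    have "row (rec_tab n M k) j \<in> set (rec_tab n M k)"
      unfolding row_def using 1(1) length_rec_tab[of n M k] by (intro nth_mem) auto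
    then show ?thesis using 1(2) Suc.IH Suc.prems(1) by fastforce
  qed (use Suc.prems in auto)
qed simp

lemma rec_tab_Suc_nth:
  "j < k \<Longrightarrow> rec_tab n M (Suc k) ! j = rec_tab n M k ! j @
    replicate (card (row (collapse n M (Suc k)) (Suc j)) - card (row (collapse n M k) (Suc j))) (Suc k)"
  by (simp add: nth_append row_def del: collapse.simps upt_Suc)

text \<open>Step \<open>k + 1\<close> adds only entries \<open>k + 1\<close>, so the earlier tableau
  is recovered by restriction; \<open>take\<close> removes the new row.\<close>

lemma rec_tab_filter: "rec_tab n M k = map (filter (\<lambda>x. x \<le> k)) (take k (rec_tab n M (Suc k)))"
proof (rule nth_equalityI)
  show "length (rec_tab n M k) = length (map (filter (\<lambda>x. x \<le> k)) (take k (rec_tab n M (Suc k))))"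
    using length_rec_tab[of n M k] length_rec_tab[of n M "Suc k"] by simp
  fix j assume "j < length (rec_tab n M k)"
  then have j: "j < k" by (simp add: length_rec_tab)
  then have "rec_tab n M k ! j \<in> set (rec_tab n M k)" by (simp add: length_rec_tab)
  then have "filter (\<lambda>x. x \<le> k) (rec_tab n M k ! j) = rec_tab n M k ! j"
    using rec_tab_entries by (simp add: filter_id_conv)
  then show "rec_tab n M k ! j = map (filter (\<lambda>x. x \<le> k)) (take k (rec_tab n M (Suc k))) ! j"
    using j length_rec_tab[of n M "Suc k"] by (simp add: rec_tab_Suc_nth del: rec_tab.simps)
qed

text \<open>Growth of the rows makes the truncated subtraction exact, so the lengths
  telescope.\<close>

lemma rec_tab_lengths:
  assumes "\<And>i j. 1 \<le> j \<Longrightarrow> j \<le> i \<Longrightarrow> i < k \<Longrightarrow> card (row (collapse n M i) j) \<le> card (row (collapse n M (Suc i)) j)"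
    and "j < k"
  shows "length (rec_tab n M k ! j) = card (row (collapse n M k) (Suc j))"
  using assms
proof (induction k)
  case (Suc k)
  show ?case
  proof (cases "j = k")
    case True
    then show ?thesis by (simp add: nth_append del: collapse.simps upt_Suc)
  next
    case False
    then have "j < k" using Suc.prems by simp
    then show ?thesis using Suc.IH Suc.prems(1)[of "Suc j" k] Suc.prems(1)
      by (simp add: rec_tab_Suc_nth del: rec_tab.simps collapse.simps)
  qed
qed simp

lemma rec_tab_prefix: "rec_tab n M k = rec_tab n M' k \<Longrightarrow> i \<le> k \<Longrightarrow> rec_tab n M i = rec_tab n M' i"
proof (induction k)
  case (Suc k)
  show ?case
  proof (cases "i = Suc k")
    case False
    have "rec_tab n M k = rec_tab n M' k"
      using rec_tab_filter[of n M k, unfolded Suc.prems(1)] rec_tab_filter[of n M' k, symmetric] by (rule trans)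
    then show ?thesis using Suc.IH Suc.prems(2) False by simp
  qed (use Suc.prems in blast)
qed simp

lemma row_card_coll:
  assumes "M \<in> MLQ n lam" "i \<le> largest_part lam" "1 \<le> j" "j \<le> largest_part lam"
  shows "card (row (collapse n M i) j) = card (rowc (coll (balls M) i) j)"
proof -
  have "balls (collapse n M i) = coll (balls M) i" "length (collapse n M i) = largest_part lam"
    using collapse_balls[of M n i] assms by (auto simp: MLQ_iff)
  then show ?thesis using rowc_balls[of j "collapse n M i"] assms by simp
qed

text \<open>Collapsing commutes with column moves, which preserve row sizes, so every recorded shape
  is constant on a component.\<close>

lemma rho_Q_invariant:
  assumes "equivclp (crystal_edge n lam) M M'" "M \<in> MLQ n lam"
  shows "rho_Q n M = rho_Q n M'"
proof -
  have M': "M' \<in> MLQ n lam" "sim n (balls M) (balls M')" using equivclp_edge_sim[OF assms] by auto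
  have fin: "finite (balls M)" using assms(2) finite_box by (auto simp: MLQ_iff)
  have len: "length M = largest_part lam" "length M' = largest_part lam" using assms(2) M'(1) by (auto simp: MLQ_iff)
  have "card (row (collapse n M i) j) = card (row (collapse n M' i) j)"
    if "1 \<le> j" "j \<le> i" "i \<le> largest_part lam" for i j
    using sim_invariant[OF M'(2) fin, of "\<lambda>X. card (rowc (coll X i) j)"] that
    by (simp add: row_card_coll[OF assms(2)] row_card_coll[OF M'(1)] coll_right card_row_right finite_coll)
  then show ?thesis unfolding rho_Q_def len by (rule rec_tab_cong)
qed

text \<open>Both queues are replaced by dominant ones in their components, with the same tableau.
  For these \<open>coll_dominant\<close> shows that rows grow, as \<open>rec_tab_lengths\<close>
  requires, and \<open>dominant_determined\<close> makes them equal.\<close>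

lemma rho_Q_imp_component:
  assumes M: "M \<in> MLQ n lam" "M' \<in> MLQ n lam" and Q: "rho_Q n M = rho_Q n M'"
  shows "equivclp (crystal_edge n lam) M M'"
proof -
  let ?L = "largest_part lam"
  have base: "\<exists>X. X \<subseteq> box ?L n \<and> (\<forall>i\<in>{1..<n}. dominant i X) \<and> queue_of ?L X \<in> MLQ n lam \<and>
    equivclp (crystal_edge n lam) (queue_of ?L X) M" if M: "M \<in> MLQ n lam" for M
  proof -
    have bM: "balls M \<subseteq> box ?L n" using M by (simp add: MLQ_iff)
    obtain "is" X where X: "X \<subseteq> box ?L n" "set is \<subseteq> {1..<n}" "balls M = rights is X" "\<forall>i\<in>{1..<n}. dominant i X"
      using exists_dominant[OF bM] by blast
    have card: "card (rowc X r) = conj_part lam r" if "r \<in> {1..?L}" for r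
      using card_row_rights[OF finite_box[OF X(1)], of "is" r] M X(3) that by (simp add: MLQ_iff)
    have "queue_of ?L (rights is X) = M"
      using balls_queue_of[OF bM] M by (intro balls_inj) (simp_all add: length_queue_of MLQ_iff flip: X(3))
    moreover have "queue_of ?L X \<in> MLQ n lam"
      using X(1) card by (simp add: MLQ_iff balls_queue_of length_queue_of)
    ultimately show ?thesis using queue_of_rights[OF X(1,2) card] X(1,4) by metis
  qed
  obtain X where X: "X \<subseteq> box ?L n" "\<forall>i\<in>{1..<n}. dominant i X" "queue_of ?L X \<in> MLQ n lam"
    "equivclp (crystal_edge n lam) (queue_of ?L X) M" using base[OF M(1)] by blast
  obtain X' where X': "X' \<subseteq> box ?L n" "\<forall>i\<in>{1..<n}. dominant i X'" "queue_of ?L X' \<in> MLQ n lam"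
    "equivclp (crystal_edge n lam) (queue_of ?L X') M'" using base[OF M(2)] by blast
  have tab: "rec_tab n (queue_of ?L X) ?L = rec_tab n (queue_of ?L X') ?L"
    using rho_Q_invariant[OF X(4,3)] rho_Q_invariant[OF X'(4,3)] Q by (simp add: rho_Q_def length_queue_of)
  have length_rows: "length (rec_tab n (queue_of ?L X) i ! j) = card (rowc (coll X i) (Suc j))"
    if X: "X \<subseteq> box ?L n" "\<forall>i\<in>{1..<n}. dominant i X" "queue_of ?L X \<in> MLQ n lam" and ij: "j < i" "i \<le> ?L" for X i j
  proof -
    have "card (row (collapse n (queue_of ?L X) k) s) \<le> card (row (collapse n (queue_of ?L X) (Suc k)) s)"
      if "1 \<le> s" "s \<le> k" "k < i" for k s
    proof -
      have "rowc (coll X k) s \<subseteq> rowc (coll X (Suc k)) s"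
        using coll_dominant[OF X(1), of "Suc k"] X(2) that ij by simp
      then show ?thesis
        using row_card_coll[OF X(3), of k s] row_card_coll[OF X(3), of "Suc k" s] that ij
          card_mono[OF finite_Image_sing[OF finite_coll[OF finite_box[OF X(1)]]]] balls_queue_of[OF X(1)] by (simp del: coll.simps collapse.simps)
    qed
    then show ?thesis
      using rec_tab_lengths[of i n "queue_of ?L X" j] row_card_coll[OF X(3), of i "Suc j"] ij balls_queue_of[OF X(1)] by simp
  qed
  have "X = X'"
  proof (rule dominant_determined[OF X(1) _ X'(1)])
    fix i j assume ij: "1 \<le> j" "j \<le> i" "i \<le> ?L"
    then have "rec_tab n (queue_of ?L X) i = rec_tab n (queue_of ?L X') i" using rec_tab_prefix[OF tab] by simp
    then show "card (rowc (coll X i) j) = card (rowc (coll X' i) j)"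
      using length_rows[OF X(1-3), of "j - 1" i] length_rows[OF X'(1-3), of "j - 1" i] ij by simp
  qed (use X X' in auto)
  then show ?thesis using X(4) X'(4) equivclp_sym equivclp_trans by metis
qed

theorem theorem2p37:
  fixes n :: nat and lam :: "nat list" and M M' :: queue
  assumes "is_partition lam" and "length lam < n"
    and "M \<in> MLQ n lam" and "M' \<in> MLQ n lam"
  shows "(same_component n lam M M' \<longleftrightarrow> rho_Q n M = rho_Q n M') \<and>
    (same_component n lam M M' \<longrightarrow>
       mlq_type n (rho_N n M) = mlq_type n (rho_N n M') \<longrightarrow> mlq_type n M = mlq_type n M')"
  using rho_Q_invariant rho_Q_imp_component type_determined assms(3,4)
  unfolding same_component_def by blast

end
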